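(* Let $k$ be a field and let $G$ be a graph. Then: (1) $L_G^{k}(3)$ is prime if and only if $G$ does not contain $K_{1,3}$ and does not contain $K_{2,2}$. (2) $L_G^{k}(2)$ is a complete intersection if and only if $G$ does not contain $K_{1,3}$ and does not contain $C_{2m}$ for any $m\ge 2$.
   Context: Graphs are finite simple graphs. $K_{a,b}$ is the complete bipartite graph with parts of sizes $a,b\ge 1$; $C_n$ ($n\ge 3$) is the cycle with $n$ vertices. "$G$ contains $G'$" means that $G$ has a (not necessarily induced) subgraph isomorphic to $G'$. For a graph $G=(V,E)$, a field $k$ and an integer $d\ge 1$, let $S=k[y_{i,\ell} : i\in V,\ \ell\in\{1,\dots,d\}]$, and for every edge $e=\{i,j\}\in E$ put $f_e^{(d)}=\sum_{\ell=1}^d y_{i,\ell}\,y_{j,\ell}$. The Lovász–Saks–Schrijver ideal is $L_G^{k}(d)=(f_e^{(d)} : e\in E)\subseteq S$. An ideal is a complete intersection if it is generated by a regular sequence (the zero ideal counts); for $L_G^k(d)$ this is equivalent to the generators $f_e^{(d)}$, $e\in E$, forming a regular sequence in $S$. *)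

theory Defs
  imports "HOL-Algebra.Ideal" "HOL-Library.Poly_Mapping"
begin

section \<open>Finite simple graphs\<close>

type_synonym 'v ugraph = "'v set \<times> 'v set set"

abbreviation verts :: "'v ugraph \<Rightarrow> 'v set" where "verts \<equiv> fst"

abbreviation edges :: "'v ugraph \<Rightarrow> 'v set set" where "edges \<equiv> snd"

definition simple_graph :: "'v ugraph \<Rightarrow> bool" where
  "simple_graph G \<longleftrightarrow> finite (verts G) \<and> (\<forall>e\<in>edges G. e \<subseteq> verts G \<and> card e = 2)"

definition is_subgraph :: "'v ugraph \<Rightarrow> 'v ugraph \<Rightarrow> bool" where
  "is_subgraph H G \<longleftrightarrow> simple_graph H \<and> verts H \<subseteq> verts G \<and> edges H \<subseteq> edges G"

definition graph_iso :: "'v ugraph \<Rightarrow> 'w ugraph \<Rightarrow> bool" where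
  "graph_iso G H \<longleftrightarrow>
     (\<exists>\<phi>. bij_betw \<phi> (verts G) (verts H) \<and>
          (\<forall>i\<in>verts G. \<forall>j\<in>verts G. {i, j} \<in> edges G \<longleftrightarrow> {\<phi> i, \<phi> j} \<in> edges H))"

definition contains_graph :: "'v ugraph \<Rightarrow> 'w ugraph \<Rightarrow> bool" where
  "contains_graph G G' \<longleftrightarrow> (\<exists>H. is_subgraph H G \<and> graph_iso H G')"

definition complete_bipartite :: "nat \<Rightarrow> nat \<Rightarrow> (nat + nat) ugraph" where
  "complete_bipartite a b =
     ({..<a} <+> {..<b}, {{Inl i, Inr j} | i j. i < a \<and> j < b})"

text \<open>Only meaningful for \<open>n \<ge> 3\<close>.\<close>

definition cycle_graph :: "nat \<Rightarrow> nat ugraph" where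
  "cycle_graph n = ({..<n}, {{i, Suc i mod n} | i. i < n})"


section \<open>Polynomial rings\<close>

text \<open>A polynomial is a finitely supported function from monomials to coefficients, a monomial a
  finitely supported function from indeterminates to exponents.\<close>

type_synonym ('x, 'k) mpoly = "('x \<Rightarrow>\<^sub>0 nat) \<Rightarrow>\<^sub>0 'k"

definition indets :: "('x, 'k::zero) mpoly \<Rightarrow> 'x set" where
  "indets p = (\<Union>m\<in>Poly_Mapping.keys p. Poly_Mapping.keys m)"

definition pvar :: "'x \<Rightarrow> ('x, 'k::zero_neq_one) mpoly" where
  "pvar x = Poly_Mapping.single (Poly_Mapping.single x 1) 1"

text \<open>The ring \<open>k[X]\<close>, for a set \<open>X\<close> of indeterminates.\<close>

definition mpoly_ring :: "'k itself \<Rightarrow> 'x set \<Rightarrow> ('x, 'k::comm_ring_1) mpoly ring" where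
  "mpoly_ring k X =
     \<lparr>carrier = {p. indets p \<subseteq> X}, mult = (*), one = 1, zero = 0, add = (+)\<rparr>"

lemma cring_mpoly_ring: "cring (mpoly_ring (k :: 'k::comm_ring_1 itself) (X :: 'x set))"
proof -
  have plus: "indets (p + q) \<subseteq> X" if "indets p \<subseteq> X" "indets q \<subseteq> X" for p q :: "('x, 'k) mpoly"
    using that Poly_Mapping.keys_add[of p q] unfolding indets_def by blast
  have times: "indets (p * q) \<subseteq> X" if "indets p \<subseteq> X" "indets q \<subseteq> X" for p q :: "('x, 'k) mpoly"
  proof -
    have "Poly_Mapping.keys m \<subseteq> X" if m: "m \<in> Poly_Mapping.keys (p * q)" for m
    proof -
      obtain a b where "m = a + b" "a \<in> Poly_Mapping.keys p" "b \<in> Poly_Mapping.keys q"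
        using keys_mult[of p q] m by blast
      then show ?thesis
        using \<open>indets p \<subseteq> X\<close> \<open>indets q \<subseteq> X\<close> Poly_Mapping.keys_add[of a b]
        unfolding indets_def by blast
    qed
    then show ?thesis unfolding indets_def by blast
  qed
  have uminus: "indets (- p) = indets p" for p :: "('x, 'k) mpoly"
    by (simp add: indets_def)
  have const: "indets (0 :: ('x, 'k) mpoly) = {}" "indets (1 :: ('x, 'k) mpoly) = {}"
    by (auto simp: indets_def)
  show ?thesis
  proof (rule cringI)
    show "abelian_group (mpoly_ring k X)"
    proof (rule abelian_groupI)
      fix p assume "p \<in> carrier (mpoly_ring k X)"
      then show "\<exists>q\<in>carrier (mpoly_ring k X). q \<oplus>\<^bsub>mpoly_ring k X\<^esub> p = \<zero>\<^bsub>mpoly_ring k X\<^esub>"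
        by (intro bexI[of _ "- p"]) (simp_all add: mpoly_ring_def uminus)
    qed (simp_all add: mpoly_ring_def plus const algebra_simps)
    show "comm_monoid (mpoly_ring k X)"
      by (rule comm_monoidI) (simp_all add: mpoly_ring_def times const algebra_simps)
  qed (simp add: mpoly_ring_def algebra_simps)
qed


section \<open>Complete intersections\<close>

text \<open>As usual, a regular sequence generates a proper ideal. The empty sequence is regular in
  every nonzero ring and generates the zero ideal.\<close>

definition regular_sequence :: "('a, 'b) ring_scheme \<Rightarrow> 'a list \<Rightarrow> bool" where
  "regular_sequence R fs \<longleftrightarrow>
     set fs \<subseteq> carrier R \<and>
     (\<forall>n<length fs. \<forall>g\<in>carrier R.
        fs ! n \<otimes>\<^bsub>R\<^esub> g \<in> Idl\<^bsub>R\<^esub> set (take n fs) \<longrightarrow> g \<in> Idl\<^bsub>R\<^esub> set (take n fs)) \<and>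
     Idl\<^bsub>R\<^esub> set fs \<noteq> carrier R"

definition complete_intersection :: "'a set \<Rightarrow> ('a, 'b) ring_scheme \<Rightarrow> bool" where
  "complete_intersection I R \<longleftrightarrow> (\<exists>fs. regular_sequence R fs \<and> I = Idl\<^bsub>R\<^esub> set fs)"


section \<open>Lovasz-Saks-Schrijver ideals\<close>

text \<open>The indeterminate \<open>y\<^sub>i\<^sub>,\<^sub>l\<close> is \<open>pvar (i, l)\<close>.\<close>

definition lss_ring ::
  "'k itself \<Rightarrow> nat \<Rightarrow> 'v ugraph \<Rightarrow> ('v \<times> nat, 'k::field) mpoly ring" where
  "lss_ring k d G = mpoly_ring k (verts G \<times> {1..d})"

definition lss_poly :: "nat \<Rightarrow> 'v \<Rightarrow> 'v \<Rightarrow> ('v \<times> nat, 'k::field) mpoly" where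
  "lss_poly d i j = (\<Sum>l=1..d. pvar (i, l) * pvar (j, l))"

lemma lss_poly_closed:
  fixes G :: "'v ugraph"
  assumes "i \<in> verts G" "j \<in> verts G"
  shows "lss_poly d i j \<in> carrier (lss_ring (k :: 'k::field itself) d G)"
proof -
  let ?X = "verts G \<times> {1..d}"
  interpret S: cring "mpoly_ring k ?X" by (rule cring_mpoly_ring)
  have var: "(pvar x :: ('v \<times> nat, 'k) mpoly) \<in> carrier (mpoly_ring k ?X)" if "x \<in> ?X" for x
    using that by (simp add: mpoly_ring_def pvar_def indets_def)
  have "(\<Sum>l\<in>A. pvar (i, l) * pvar (j, l) :: ('v \<times> nat, 'k) mpoly) \<in> carrier (mpoly_ring k ?X)"
    if "finite A" "A \<subseteq> {1..d}" for A
    using that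
  proof (induction A)
    case empty
    show ?case using S.zero_closed by (simp add: mpoly_ring_def)
  next
    case (insert l A)
    then have "pvar (i, l) \<otimes>\<^bsub>mpoly_ring k ?X\<^esub> pvar (j, l) \<oplus>\<^bsub>mpoly_ring k ?X\<^esub>
        (\<Sum>l\<in>A. pvar (i, l) * pvar (j, l)) \<in> carrier (mpoly_ring k ?X)"
      using assms by (intro S.a_closed S.m_closed var) auto
    with insert show ?case by (simp add: mpoly_ring_def)
  qed
  then show ?thesis
    unfolding lss_poly_def lss_ring_def by blast
qed

definition lss_ideal ::
  "'k itself \<Rightarrow> nat \<Rightarrow> 'v ugraph \<Rightarrow> ('v \<times> nat, 'k::field) mpoly set" where
  "lss_ideal k d G = Idl\<^bsub>lss_ring k d G\<^esub> {lss_poly d i j | i j. {i, j} \<in> edges G}"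

end

theory Submission
  imports Defs "HOL-Computational_Algebra.Polynomial"
begin

text \<open>
  Everything takes place in a polynomial ring \<open>P\<close> with all indeterminates; ideals of \<open>k[X]\<close> are
  recovered by retraction.

  Primality for \<open>d = 3\<close> is proved by induction on the edges, from the classical fact that
  \<open>c\<^sub>1 X + c\<^sub>0\<close> is prime over a domain in which \<open>c\<^sub>1\<close>, \<open>c\<^sub>0\<close> is a regular sequence. A vertex of
  degree one gives such a linear equation. If all components are cycles, take adjacent vertices
  \<open>w\<close>, \<open>b\<close> with further neighbours \<open>a\<close> of \<open>w\<close> and \<open>u\<close> of \<open>b\<close>. After inverting a coordinate of
  \<open>a\<close>, which is a nonzerodivisor, and a change of coordinates, the equations at \<open>w\<close> and \<open>b\<close> become
  two successive linear equations; the leading coefficient of the first is the inner product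
  \<open>a \<cdot> u\<close>, nonzero because \<open>a\<close> and \<open>u\<close> are equal or not adjacent, there being no \<open>K\<^sub>2\<^sub>,\<^sub>2\<close>.

  For \<open>d = 2\<close>, the last edge of an odd cycle can be adjoined because the two-colouring of the
  remaining path gives weights for which the equations of the path are homogeneous while that of the
  last edge has a monomial as its form of top weight.

  Conversely, forbidden subgraphs give explicit relations. For \<open>d = 3\<close> these are products in the
  ideal. For \<open>d = 2\<close> they are syzygies of the generators whose coefficients are not all in the
  ideal, which is impossible for an ideal generated by a regular sequence. Non-membership is seen by
  evaluation at points.\<close>

section \<open>Ideals and nonzerodivisors\<close>

text \<open>Neither quotient rings nor localisations are formed. Ideals are the spans in the ring
  viewed as a module over itself; \<open>nzd_mod\<close> and \<open>prime_gen\<close> describe the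
  quotient through membership, and inverting an element becomes multiplying through and cancelling a
  nonzerodivisor. In dimension three the obstacle is that the ideal of a cycle needs a
  nonzerodivisor before it is known to be prime. Reordering regular sequences supplies it: a
  coordinate of a vertex is adjoined before the edges at that vertex and then moved past them, so
  that only primality for smaller edge sets enters. In dimension two a path of two edges already has
  a non-prime ideal: \<open>v . a = v . b = 0\<close> forces \<open>v = 0\<close> or
  \<open>a\<close>, \<open>b\<close> dependent. Nonzerodivisors are therefore carried along paths by
  alternating the two coordinates. Neither the characteristic nor a square root of -1 in the field
  matters: the points used for non-membership have coordinates 0 and 1, except for one isotropic
  vector whose coordinate is adjoined formally.\<close>

global_interpretation ring_ideal: module "(*) :: 'a::comm_ring_1 \<Rightarrow> 'a \<Rightarrow> 'a"
  defines ideal_gen = ring_ideal.span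
  by unfold_locales (simp_all add: algebra_simps)

text \<open>For this module the rule is associativity, oriented against
  \<open>mult.assoc\<close>.\<close>

declare ring_ideal.scale_scale [simp del]

lemma ideal_gen_insert: "x \<in> ideal_gen (insert a B) \<longleftrightarrow> (\<exists>k. x - k * a \<in> ideal_gen B)"
  by (simp add: ring_ideal.span_insert)

lemma ideal_gen_mult_left: "x \<in> ideal_gen B \<Longrightarrow> c * x \<in> ideal_gen B"
  by (rule ring_ideal.span_scale)

lemma ideal_gen_mult_right: "x \<in> ideal_gen B \<Longrightarrow> x * c \<in> ideal_gen B"
  using ideal_gen_mult_left[of x B c] by (simp add: mult.commute)

lemma ideal_gen_insertI: "x \<in> ideal_gen B \<Longrightarrow> x \<in> ideal_gen (insert a B)"
  using ring_ideal.span_mono[of B "insert a B"] by auto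

lemma ideal_gen_cong:
  assumes "x - y \<in> ideal_gen B"
  shows "x \<in> ideal_gen B \<longleftrightarrow> y \<in> ideal_gen B"
proof -
  have "x = y + (x - y)" by simp
  with ring_ideal.span_add_eq2[OF assms, of y] show ?thesis by simp
qed

lemma ideal_gen_add_cancel: "x + y \<in> ideal_gen B \<Longrightarrow> y \<in> ideal_gen B \<Longrightarrow> x \<in> ideal_gen B"
  using ring_ideal.span_diff[of "x + y" B y] by simp

text \<open>Properness is kept apart: modulo the unit ideal the condition holds for every
  element.\<close>

definition nzd_mod :: "'a::comm_ring_1 set \<Rightarrow> 'a \<Rightarrow> bool" where
  "nzd_mod B c \<longleftrightarrow> (\<forall>g. c * g \<in> ideal_gen B \<longrightarrow> g \<in> ideal_gen B)"

definition prime_gen :: "'a::comm_ring_1 set \<Rightarrow> bool" where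
  "prime_gen B \<longleftrightarrow> 1 \<notin> ideal_gen B \<and>
     (\<forall>g h. g * h \<in> ideal_gen B \<longrightarrow> g \<in> ideal_gen B \<or> h \<in> ideal_gen B)"

lemma prime_gen_mult:
  "prime_gen B \<Longrightarrow> g * h \<in> ideal_gen B \<longleftrightarrow> g \<in> ideal_gen B \<or> h \<in> ideal_gen B"
  unfolding prime_gen_def using ideal_gen_mult_left ideal_gen_mult_right by blast

lemma prime_gen_nzd: "prime_gen B \<Longrightarrow> c \<notin> ideal_gen B \<Longrightarrow> nzd_mod B c"
  unfolding nzd_mod_def by (simp add: prime_gen_mult)

lemma nzd_mod_mult: "nzd_mod B c \<Longrightarrow> nzd_mod B d \<Longrightarrow> nzd_mod B (c * d)"
  unfolding nzd_mod_def mult.assoc by blast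

lemma nzd_mod_1: "nzd_mod B 1"
  unfolding nzd_mod_def by simp

lemma nzd_mod_power: "nzd_mod B c \<Longrightarrow> nzd_mod B (c ^ n)"
  by (induction n) (auto intro: nzd_mod_mult nzd_mod_1)

text \<open>The half of the permutability of a regular sequence \<open>r\<close>, \<open>p\<close>
  that holds without a local ring or a grading: if \<open>r h = s p\<close> modulo \<open>B\<close>,
  then \<open>r\<close> divides \<open>s\<close>, and cancelling \<open>r\<close> shows that
  \<open>p\<close> divides \<open>h\<close>. It allows elements to be adjoined in the convenient
  order.\<close>

lemma nzd_mod_swap:
  assumes r: "nzd_mod B r" and p: "nzd_mod (insert r B) p"
  shows "nzd_mod (insert p B) r"
  unfolding nzd_mod_def
proof (intro allI impI)
  fix h assume "r * h \<in> ideal_gen (insert p B)"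
  then obtain s where s: "r * h - s * p \<in> ideal_gen B" by (auto simp: ideal_gen_insert)
  have "p * s \<in> ideal_gen (insert r B)"
    using ring_ideal.span_neg[OF s] by (auto simp: ideal_gen_insert algebra_simps intro!: exI[of _ h])
  then have "s \<in> ideal_gen (insert r B)" using p unfolding nzd_mod_def by blast
  then obtain t where "s - t * r \<in> ideal_gen B" by (auto simp: ideal_gen_insert)
  then have "(r * h - s * p) + p * (s - t * r) \<in> ideal_gen B"
    by (intro ring_ideal.span_add s ideal_gen_mult_left)
  then have "r * (h - t * p) \<in> ideal_gen B" by (simp add: algebra_simps)
  then show "h \<in> ideal_gen (insert p B)" using r unfolding nzd_mod_def ideal_gen_insert by blast
qed

section \<open>Univariate polynomials with coefficients taken modulo an ideal\<close>

lemma ideal_gen_coeff_mult: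
  assumes "\<And>n. coeff p n \<in> ideal_gen B"
  shows "coeff (p * q) n \<in> ideal_gen B"
  unfolding coeff_mult by (intro ring_ideal.span_sum ideal_gen_mult_right assms)

text \<open>Modulo the ideal, multiplication by \<open>f\<close> raises degrees by exactly
  \<open>d\<close>, so the coefficients of \<open>q\<close> vanish one after the other from the
  top.\<close>

lemma coeff_nzd_lead:
  fixes f q :: "'a::comm_ring_1 poly"
  assumes lead: "nzd_mod B (coeff f d)" "degree f \<le> d"
    and fq: "\<And>n. N + d \<le> n \<Longrightarrow> coeff (f * q) n \<in> ideal_gen B"
    and "N \<le> n"
  shows "coeff q n \<in> ideal_gen B"
proof -
  \<comment> \<open>Descending induction on \<open>n\<close>: \<open>m\<close> bounds the distance
    to \<open>degree q + 1\<close>, from where on the coefficients are zero.\<close>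
  have "coeff q n \<in> ideal_gen B" if "N \<le> n" "degree q + 1 - n \<le> m" for m n
    using that
  proof (induction m arbitrary: n)
    case 0
    then show ?case by (simp add: coeff_eq_0 ring_ideal.span_zero)
  next
    case (Suc m)
    have "(\<Sum>i\<in>{..n + d} - {d}. coeff f i * coeff q (n + d - i)) \<in> ideal_gen B"
    proof (intro ring_ideal.span_sum)
      fix i assume i: "i \<in> {..n + d} - {d}"
      show "coeff f i * coeff q (n + d - i) \<in> ideal_gen B"
      proof (cases "i < d")
        case True
        then have "coeff q (n + d - i) \<in> ideal_gen B" using Suc.prems by (intro Suc.IH) auto
        then show ?thesis by (rule ideal_gen_mult_left)
      next
        case False
        then have "coeff f i = 0" using i lead(2) by (intro coeff_eq_0) auto
        then show ?thesis by (simp add: ring_ideal.span_zero)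
      qed
    qed
    moreover have "coeff (f * q) (n + d) =
        coeff f d * coeff q n + (\<Sum>i\<in>{..n + d} - {d}. coeff f i * coeff q (n + d - i))"
      unfolding coeff_mult by (subst sum.remove[of _ d]) auto
    moreover have "coeff (f * q) (n + d) \<in> ideal_gen B" using fq Suc.prems by auto
    ultimately have "coeff f d * coeff q n \<in> ideal_gen B"
      using ideal_gen_add_cancel by fastforce
    then show ?case using lead(1) unfolding nzd_mod_def by blast
  qed
  then show ?thesis using \<open>N \<le> n\<close> by blast
qed

lemma pseudo_division:
  fixes p :: "'a::comm_ring_1 poly"
  shows "\<exists>N r q. smult (c1 ^ N) p = [:r:] + [:c0, c1:] * q"
proof (induction p)
  case 0
  show ?case by (rule exI[of _ 0], rule exI[of _ 0], rule exI[of _ 0]) simp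
next
  case (pCons a p)
  then obtain N r q where *: "smult (c1 ^ N) p = [:r:] + [:c0, c1:] * q" by blast
  have "smult (c1 ^ Suc N) (pCons a p) = [:c1 ^ Suc N * a:] + [:0, 1:] * smult c1 (smult (c1 ^ N) p)"
    by simp
  \<comment> \<open>\<open>c1 X\<close> is the divisor minus \<open>c0\<close>, so the shifted
    remainder \<open>c1 r X\<close> reduces to the constant \<open>- c0 r\<close>.\<close>
  also have "\<dots> = [:c1 ^ Suc N * a - c0 * r:] + [:c0, c1:] * ([:r:] + [:0, c1:] * q)"
    unfolding * by (simp add: algebra_simps smult_add_right smult_diff_right)
  finally show ?case by blast
qed

text \<open>\<open>Q\<close> is the ideal generated by \<open>B\<close> and
  \<open>f = c0 + c1 X\<close> in the polynomial ring. Regularity of \<open>c1\<close>,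
  \<open>c0\<close> makes \<open>c1\<close> cancellable modulo \<open>Q\<close>. With
  \<open>c1\<close> inverted, \<open>X\<close> would equal \<open>- c0 / c1\<close> and only
  constants would remain; pseudo-division does this without the inverse.\<close>

lemma linear_prime:
  fixes B :: "'a::comm_ring_1 set" and p p' :: "'a poly" and c0 c1 :: 'a
  defines "Q \<equiv> {p. \<exists>q. \<forall>n. coeff (p - [:c0, c1:] * q) n \<in> ideal_gen B}"
  assumes B: "prime_gen B" and c1: "c1 \<notin> ideal_gen B" and c0: "nzd_mod (insert c1 B) c0"
    and pp: "p * p' \<in> Q"
  shows "p \<in> Q \<or> p' \<in> Q"
proof -
  let ?f = "[:c0, c1:]"
  have nzd1: "nzd_mod B c1" using prime_gen_nzd[OF B c1] .
  have QI: "u \<in> Q" if "\<And>n. coeff (u - ?f * q) n \<in> ideal_gen B" for u q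
    using that unfolding Q_def by blast
  have Q_mult: "u * v \<in> Q" if "u \<in> Q" for u v
  proof -
    obtain q where q: "\<And>n. coeff (u - ?f * q) n \<in> ideal_gen B" using \<open>u \<in> Q\<close> unfolding Q_def by blast
    have "u * v - ?f * (q * v) = (u - ?f * q) * v"
      by (simp only: left_diff_distrib mult.assoc)
    then show ?thesis using ideal_gen_coeff_mult[OF q, of v] QI[of "u * v" "q * v"] by simp
  qed
  have Q_f: "?f * v \<in> Q" for v
    unfolding Q_def by (auto intro!: exI[of _ v] simp: ring_ideal.span_zero)
  have Q_add: "u + v \<in> Q" if uv: "u \<in> Q" "v \<in> Q" for u v
  proof -
    obtain q q' where "\<And>n. coeff (u - ?f * q) n \<in> ideal_gen B" "\<And>n. coeff (v - ?f * q') n \<in> ideal_gen B"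
      using uv unfolding Q_def by blast
    then have "coeff ((u - ?f * q) + (v - ?f * q')) n \<in> ideal_gen B" for n
      unfolding coeff_add by (intro ring_ideal.span_add)
    moreover have "(u + v) - ?f * (q + q') = (u - ?f * q) + (v - ?f * q')"
      by (simp only: distrib_left add_diff_add)
    ultimately have "coeff ((u + v) - ?f * (q + q')) n \<in> ideal_gen B" for n by (simp only:)
    then show ?thesis by (rule QI)
  qed
  have Q_diff: "u - v \<in> Q" if "u \<in> Q" "v \<in> Q" for u v
    using Q_add[OF that(1) Q_mult[OF that(2), of "-1"]] by simp
  have Q_cancel: "u \<in> Q" if u: "smult c1 u \<in> Q" for u
  proof -
    obtain q where q: "\<And>n. coeff (smult c1 u - ?f * q) n \<in> ideal_gen B" using u unfolding Q_def by blast
    \<comment> \<open>Read modulo \<open>c1\<close>, the relation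
      \<open>c1 u = (c0 + c1 X) q\<close> says that \<open>c0\<close> kills every coefficient of
      \<open>q\<close>.\<close>
    have qn: "coeff q n \<in> ideal_gen (insert c1 B)" for n
    proof (induction n)
      case 0
      have "c1 * coeff u 0 - c0 * coeff q 0 \<in> ideal_gen B" using q[of 0] by (simp add: coeff_mult)
      from ring_ideal.span_neg[OF this] have "c0 * coeff q 0 - coeff u 0 * c1 \<in> ideal_gen B"
        by (simp add: algebra_simps)
      then show ?case using c0 unfolding nzd_mod_def ideal_gen_insert by blast
    next
      case (Suc n)
      have "c1 * coeff u (Suc n) - (c0 * coeff q (Suc n) + c1 * coeff q n) \<in> ideal_gen B"
        using q[of "Suc n"] by (simp add: coeff_mult)
      from ring_ideal.span_neg[OF this] have "c0 * coeff q (Suc n) - (coeff u (Suc n) - coeff q n) * c1 \<in> ideal_gen B"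
        by (simp add: algebra_simps)
      then show ?case using c0 unfolding nzd_mod_def ideal_gen_insert by blast
    qed
    \<comment> \<open>Chosen quotients of the coefficients of \<open>q\<close> by \<open>c1\<close>;
      the value 0 beyond the degree makes them a polynomial.\<close>
    define k where "k n = (if n \<le> degree q then SOME k. coeff q n - k * c1 \<in> ideal_gen B else 0)" for n
    have k: "coeff q n - k n * c1 \<in> ideal_gen B" for n
      unfolding k_def using qn[of n] unfolding ideal_gen_insert
      by (auto simp: coeff_eq_0 ring_ideal.span_zero intro: someI_ex)
    define t where "t = Abs_poly k"
    have t: "coeff t = k" unfolding t_def
      by (rule coeff_Abs_poly[of "degree q"]) (simp add: k_def)
    have "coeff (u - ?f * t) n \<in> ideal_gen B" for n
    proof -
      have "coeff (q - smult c1 t) n \<in> ideal_gen B" for n using k[of n] t by (simp add: mult.commute)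
      from ideal_gen_coeff_mult[OF this, of ?f n] q[of n]
      have "coeff (smult c1 u - ?f * q) n + coeff ((q - smult c1 t) * ?f) n \<in> ideal_gen B"
        by (intro ring_ideal.span_add)
      moreover have "(smult c1 u - f * q) + (q - smult c1 t) * f = smult c1 (u - f * t)" for f
        by (simp add: algebra_simps smult_diff_right)
      ultimately have "coeff (smult c1 (u - ?f * t)) n \<in> ideal_gen B" by (metis coeff_add)
      then show ?thesis using nzd1 unfolding nzd_mod_def coeff_smult by blast
    qed
    then show ?thesis by (rule QI)
  qed
  have Q_cancel_pow: "u \<in> Q" if "smult (c1 ^ N) u \<in> Q" for u N
    using that
  proof (induction N)
    case (Suc N)
    have "smult c1 (smult (c1 ^ N) u) \<in> Q" using Suc.prems by simp
    then show ?case using Suc.IH Q_cancel by blast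
  qed simp
  obtain N r q where r: "smult (c1 ^ N) p = [:r:] + ?f * q" using pseudo_division by blast
  obtain N' r' q' where r': "smult (c1 ^ N') p' = [:r':] + ?f * q'" using pseudo_division by blast
  \<comment> \<open>Stated for a variable \<open>f\<close>, so that \<open>algebra_simps\<close>
    leaves the linear polynomial intact.\<close>
  have "(smult (c1 ^ N) p - f * q) * (smult (c1 ^ N') p' - f * q') = p * p' * [:c1 ^ N * c1 ^ N':] -
      f * (smult (c1 ^ N) p * q' + q * smult (c1 ^ N') p' - q * f * q')" for f
    by (simp add: algebra_simps)
  note expand = this[of ?f]
  have "[:r * r':] = (smult (c1 ^ N) p - ?f * q) * (smult (c1 ^ N') p' - ?f * q')"
    unfolding r r' by simp
  also have "\<dots> = p * p' * [:c1 ^ N * c1 ^ N':] - ?f *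
      (smult (c1 ^ N) p * q' + q * smult (c1 ^ N') p' - q * ?f * q')"
    by (rule expand)
  also have "\<dots> \<in> Q" by (rule Q_diff[OF Q_mult[OF pp] Q_f])
  finally obtain s where s: "\<And>n. coeff ([:r * r':] - ?f * s) n \<in> ideal_gen B" unfolding Q_def by blast
  \<comment> \<open>\<open>f s\<close> is constant modulo the ideal and the leading coefficient of
    \<open>f\<close> is regular, so \<open>s\<close> vanishes for reasons of degree.\<close>
  have "coeff s n \<in> ideal_gen B" for n
  proof (rule coeff_nzd_lead[of B ?f 1 0])
    fix n :: nat assume "0 + 1 \<le> n"
    then have "coeff ([:r * r':] - ?f * s) n = - coeff (?f * s) n" by (cases n) auto
    then show "coeff (?f * s) n \<in> ideal_gen B"
      using ring_ideal.span_neg[OF s[of n]] by (metis minus_minus)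
  qed (use nzd1 in auto)
  from ideal_gen_coeff_mult[OF this, of ?f 0] s[of 0]
  have "coeff (s * ?f) 0 + coeff ([:r * r':] - ?f * s) 0 \<in> ideal_gen B" by (intro ring_ideal.span_add)
  then have "r * r' \<in> ideal_gen B" by (simp add: mult.commute)
  then have "r \<in> ideal_gen B \<or> r' \<in> ideal_gen B" by (simp add: prime_gen_mult[OF B])
  moreover have "[:a:] \<in> Q" if "a \<in> ideal_gen B" for a
    unfolding Q_def using that
    by (auto intro!: exI[of _ 0] simp: coeff_pCons ring_ideal.span_zero split: nat.split)
  ultimately have "smult (c1 ^ N) p \<in> Q \<or> smult (c1 ^ N') p' \<in> Q"
    unfolding r r' using Q_add Q_f by blast
  then show ?thesis using Q_cancel_pow by blast
qed

section \<open>Substitution homomorphisms\<close>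

definition is_ring_hom :: "('a::comm_ring_1 \<Rightarrow> 'b::comm_ring_1) \<Rightarrow> bool" where
  "is_ring_hom f \<longleftrightarrow> f 1 = 1 \<and> (\<forall>x y. f (x + y) = f x + f y) \<and> (\<forall>x y. f (x * y) = f x * f y)"

lemma
  assumes "is_ring_hom f"
  shows hom_one: "f 1 = 1" and hom_add: "f (x + y) = f x + f y" and hom_mult: "f (x * y) = f x * f y"
    and hom_zero: "f 0 = 0" and hom_diff: "f (x - y) = f x - f y" and hom_minus: "f (- x) = - f x"
proof -
  show 1: "f 1 = 1" "f (x + y) = f x + f y" "f (x * y) = f x * f y" for x y
    using assms unfolding is_ring_hom_def by auto
  have "f 0 + f 0 = f 0" using 1(2)[of 0 0] by simp
  then show 0: "f 0 = 0" by (metis add_cancel_right_left)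
  have "f (x - y) + f y = f x" for x y using 1(2)[of "x - y" y] by simp
  then show d: "f (x - y) = f x - f y" for x y by (metis add_diff_cancel_right')
  show "f (- x) = - f x" using d[of 0 x] 0 by simp
qed

lemmas hom_simps = hom_one hom_add hom_mult hom_zero hom_diff hom_minus

lemma hom_sum: "is_ring_hom f \<Longrightarrow> f (sum g A) = (\<Sum>x\<in>A. f (g x))"
  by (induction A rule: infinite_finite_induct) (simp_all add: hom_simps)

lemma hom_prod: "is_ring_hom f \<Longrightarrow> f (prod g A) = (\<Prod>x\<in>A. f (g x))"
  by (induction A rule: infinite_finite_induct) (simp_all add: hom_simps)

lemma hom_power: "is_ring_hom f \<Longrightarrow> f (x ^ n) = f x ^ n"
  by (induction n) (simp_all add: hom_simps)

lemma hom_comp: "is_ring_hom f \<Longrightarrow> is_ring_hom g \<Longrightarrow> is_ring_hom (\<lambda>x. f (g x))"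
  unfolding is_ring_hom_def by simp

lemma hom_poly_eval: "is_ring_hom (\<lambda>p. poly p a)"
  unfolding is_ring_hom_def by simp

lemma hom_coeff_0: "is_ring_hom (\<lambda>p. coeff p 0)"
  unfolding is_ring_hom_def by (simp add: coeff_mult)

lemma hom_const: "is_ring_hom (\<lambda>c. [:c:])"
  unfolding is_ring_hom_def by simp

lemma hom_id: "is_ring_hom (\<lambda>c. c)"
  unfolding is_ring_hom_def by simp

lemma hom_pcompose: "is_ring_hom (\<lambda>p. pcompose p q)"
  unfolding is_ring_hom_def by (simp add: pcompose_add pcompose_mult one_pCons pcompose_const)

lemma hom_ideal_gen:
  assumes "is_ring_hom f" "\<And>b. b \<in> B \<Longrightarrow> f b \<in> ideal_gen C" "p \<in> ideal_gen B"
  shows "f p \<in> ideal_gen C"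
  using assms(3)
proof (induction rule: ring_ideal.span_induct_alt)
  case base
  show ?case by (simp add: hom_zero[OF assms(1)] ring_ideal.span_zero)
next
  case (step c x y)
  then show ?case
    by (simp add: hom_simps[OF assms(1)] ring_ideal.span_add ideal_gen_mult_left assms(2))
qed

lemma hom_coeff_ideal_gen:
  assumes "is_ring_hom f" "\<And>b n. b \<in> B \<Longrightarrow> coeff (f b) n \<in> ideal_gen C" "p \<in> ideal_gen B"
  shows "coeff (f p) n \<in> ideal_gen C"
  using assms(3)
proof (induction arbitrary: n rule: ring_ideal.span_induct_alt)
  case base
  show ?case by (simp add: hom_zero[OF assms(1)] ring_ideal.span_zero)
next
  case (step c x y)
  have "coeff (f x * f c) n \<in> ideal_gen C" by (rule ideal_gen_coeff_mult) (simp add: assms(2) step)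
  then show ?case
    by (simp add: hom_simps[OF assms(1)] ring_ideal.span_add step mult.commute)
qed

section \<open>Evaluation homomorphisms\<close>

definition mconst :: "'k \<Rightarrow> ('x, 'k::comm_ring_1) mpoly" where
  "mconst c = Poly_Mapping.single 0 c"

lemma hom_mconst: "is_ring_hom mconst"
  unfolding is_ring_hom_def mconst_def by (simp add: single_add mult_single)

definition meval_monom :: "('x \<Rightarrow> 'r::comm_ring_1) \<Rightarrow> ('x \<Rightarrow>\<^sub>0 nat) \<Rightarrow> 'r" where
  "meval_monom v m = (\<Prod>x\<in>Poly_Mapping.keys m. v x ^ Poly_Mapping.lookup m x)"

definition meval :: "('k::comm_ring_1 \<Rightarrow> 'r::comm_ring_1) \<Rightarrow> ('x \<Rightarrow> 'r) \<Rightarrow> ('x, 'k) mpoly \<Rightarrow> 'r" where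
  "meval h v p = (\<Sum>m\<in>Poly_Mapping.keys p. h (Poly_Mapping.lookup p m) * meval_monom v m)"

lemma meval_monom_superset:
  assumes "finite A" "Poly_Mapping.keys m \<subseteq> A"
  shows "meval_monom v m = (\<Prod>x\<in>A. v x ^ Poly_Mapping.lookup m x)"
  unfolding meval_monom_def
  by (rule prod.mono_neutral_left) (use assms in \<open>auto simp: in_keys_iff\<close>)

lemma meval_monom_add: "meval_monom v (m + n) = meval_monom v m * meval_monom v n"
proof -
  let ?A = "Poly_Mapping.keys m \<union> Poly_Mapping.keys n"
  have "Poly_Mapping.keys (m + n) \<subseteq> ?A" by (rule Poly_Mapping.keys_add)
  then show ?thesis
    by (simp add: meval_monom_superset[of ?A] lookup_add power_add prod.distrib)
qed

lemma meval_superset: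
  assumes "is_ring_hom h" "finite A" "Poly_Mapping.keys p \<subseteq> A"
  shows "meval h v p = (\<Sum>m\<in>A. h (Poly_Mapping.lookup p m) * meval_monom v m)"
  unfolding meval_def
  by (rule sum.mono_neutral_left) (use assms in \<open>auto simp: in_keys_iff hom_zero\<close>)

lemma meval_single: "is_ring_hom h \<Longrightarrow> meval h v (Poly_Mapping.single m c) = h c * meval_monom v m"
  by (subst meval_superset[of _ "{m}"]) auto

lemma meval_add: 
  assumes h: "is_ring_hom h"
  shows "meval h v (p + q) = meval h v p + meval h v q"
proof -
  let ?A = "Poly_Mapping.keys p \<union> Poly_Mapping.keys q"
  have "Poly_Mapping.keys (p + q) \<subseteq> ?A" by (rule Poly_Mapping.keys_add)
  then show ?thesis
    by (simp add: meval_superset[OF h, of ?A] lookup_add hom_add[OF h] algebra_simps sum.distrib)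
qed

lemma mpoly_as_sum:
  "p = (\<Sum>m\<in>Poly_Mapping.keys p. Poly_Mapping.single m (Poly_Mapping.lookup p m))"
  by (rule poly_mapping_eqI)
     (auto simp: lookup_sum lookup_single when_def in_keys_iff sum.delta)

lemma meval_sum: "is_ring_hom h \<Longrightarrow> meval h v (sum f A) = (\<Sum>x\<in>A. meval h v (f x))"
  by (induction A rule: infinite_finite_induct) (simp_all add: meval_add, simp_all add: meval_def)

lemma meval_hom:
  assumes h: "is_ring_hom h"
  shows "is_ring_hom (meval h v)"
proof -
  have mult: "meval h v (p * q) = meval h v p * meval h v q" for p q
  proof -
    have "p * q = (\<Sum>m\<in>Poly_Mapping.keys p. \<Sum>n\<in>Poly_Mapping.keys q.
        Poly_Mapping.single (m + n) (Poly_Mapping.lookup p m * Poly_Mapping.lookup q n))"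
      by (subst mpoly_as_sum[of p], subst mpoly_as_sum[of q]) (simp add: sum_product mult_single)
    then have "meval h v (p * q) = (\<Sum>m\<in>Poly_Mapping.keys p. \<Sum>n\<in>Poly_Mapping.keys q.
        (h (Poly_Mapping.lookup p m) * meval_monom v m) * (h (Poly_Mapping.lookup q n) * meval_monom v n))"
      by (simp add: meval_sum[OF h] meval_single[OF h] hom_mult[OF h] meval_monom_add mult_ac)
    then show ?thesis by (simp add: meval_def sum_product)
  qed
  have "meval h v 1 = 1"
    using meval_single[OF h, of v 0 1] by (simp add: hom_one[OF h] meval_monom_def)
  with mult show ?thesis unfolding is_ring_hom_def by (simp add: meval_add[OF h])
qed

lemma meval_mconst: "is_ring_hom h \<Longrightarrow> meval h v (mconst c) = h c"
  unfolding mconst_def by (simp add: meval_single meval_monom_def)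

lemma meval_pvar: "is_ring_hom h \<Longrightarrow> meval h v (pvar x) = v x"
  unfolding pvar_def by (simp add: meval_single hom_one meval_monom_def)

text \<open>Constants and indeterminates generate the ring, so identities between homomorphisms
  reduce to these.\<close>

lemma mpoly_induct [case_names const var add mult]:
  assumes const: "\<And>c. Q (mconst c)" and var: "\<And>x. Q (pvar x)"
    and add: "\<And>p q. Q p \<Longrightarrow> Q q \<Longrightarrow> Q (p + q)" and mult: "\<And>p q. Q p \<Longrightarrow> Q q \<Longrightarrow> Q (p * q)"
  shows "Q (p :: ('x, 'k::comm_ring_1) mpoly)"
proof -
  have Q0: "Q 0" and Q1: "Q 1" using const[of 0] const[of 1] by (simp_all add: mconst_def)
  have sum: "Q (sum f A)" if "\<And>x. x \<in> A \<Longrightarrow> Q (f x)" for f and A :: "'z set"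
    using that by (induction A rule: infinite_finite_induct) (auto intro: Q0 add)
  have power: "Q (Poly_Mapping.single (Poly_Mapping.single x n) 1)" for x n
  proof (induction n)
    case (Suc n)
    have "Poly_Mapping.single (Poly_Mapping.single x (Suc n)) 1 =
        pvar x * (Poly_Mapping.single (Poly_Mapping.single x n) 1 :: ('x, 'k) mpoly)"
      by (simp add: pvar_def mult_single flip: single_add)
    then show ?case using mult[OF var Suc] by simp
  qed (simp add: Q1)
  have monom: "Q (Poly_Mapping.single (\<Sum>x\<in>A. Poly_Mapping.single x (f x)) 1)" for f and A :: "'x set"
  proof (induction A rule: infinite_finite_induct)
    case (insert x A)
    have "(Poly_Mapping.single (\<Sum>x\<in>insert x A. Poly_Mapping.single x (f x)) 1 :: ('x, 'k) mpoly) =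
        Poly_Mapping.single (Poly_Mapping.single x (f x)) 1 *
        Poly_Mapping.single (\<Sum>x\<in>A. Poly_Mapping.single x (f x)) 1"
      using insert by (simp add: mult_single)
    then show ?case using mult[OF power insert.IH] by simp
  qed (simp_all add: Q1)
  have "m = (\<Sum>x\<in>Poly_Mapping.keys m. Poly_Mapping.single x (Poly_Mapping.lookup m x))"
    for m :: "'x \<Rightarrow>\<^sub>0 nat"
    by (rule poly_mapping_eqI) (auto simp: lookup_sum lookup_single when_def in_keys_iff sum.delta)
  then have "Q (Poly_Mapping.single m 1)" for m using monom by metis
  then have "Q (mconst c * Poly_Mapping.single m 1)" for c m using mult const by blast
  then have "Q (Poly_Mapping.single m c)" for m c by (simp add: mconst_def mult_single)
  then have "Q (\<Sum>m\<in>Poly_Mapping.keys p. Poly_Mapping.single m (Poly_Mapping.lookup p m))"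
    by (intro sum)
  then show ?thesis using mpoly_as_sum[of p] by simp
qed

text \<open>A congruence rather than an equality, because the two coordinate changes for a cycle
  compose to a rescaling only modulo the ideal.\<close>

lemma hom_congruent:
  assumes f: "is_ring_hom f" and g: "is_ring_hom g"
    and "\<And>c. f (mconst c) = g (mconst c)" "\<And>x. f (pvar x) - g (pvar x) \<in> ideal_gen B"
  shows "f p - g p \<in> ideal_gen B"
proof (induction p rule: mpoly_induct)
  case (add p q)
  then have "(f p - g p) + (f q - g q) \<in> ideal_gen B" by (intro ring_ideal.span_add)
  then show ?case by (simp add: hom_simps[OF f] hom_simps[OF g] algebra_simps)
next
  case (mult p q)
  then have "(f p - g p) * f q + g p * (f q - g q) \<in> ideal_gen B"
    by (intro ring_ideal.span_add ideal_gen_mult_left ideal_gen_mult_right)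
  then show ?case by (simp add: hom_simps[OF f] hom_simps[OF g] algebra_simps)
qed (use assms in \<open>auto simp: ring_ideal.span_zero\<close>)

lemma hom_eqI:
  assumes "is_ring_hom f" "is_ring_hom g"
    and "\<And>c. f (mconst c) = g (mconst c)" "\<And>x. f (pvar x) = g (pvar x)"
  shows "f p = g p"
  using hom_congruent[of f g "{}" p] assms by auto


section \<open>Singling out a variable\<close>

definition msubst :: "('x \<Rightarrow> ('y, 'k::comm_ring_1) mpoly) \<Rightarrow> ('x, 'k) mpoly \<Rightarrow> ('y, 'k) mpoly" where
  "msubst v = meval mconst v"

text \<open>The coefficients stay in the type of the polynomial itself, so the same ideals serve for
  both.\<close>

definition as_poly :: "'x \<Rightarrow> ('x, 'k::comm_ring_1) mpoly \<Rightarrow> ('x, 'k) mpoly poly" where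
  "as_poly x = meval (\<lambda>c. [:mconst c:]) (\<lambda>y. if y = x then [:0, 1:] else [:pvar y:])"

text \<open>The coefficient of \<open>T^n\<close> is the component of weight \<open>n\<close>;
  setting \<open>T = 1\<close> recovers the polynomial.\<close>

definition grade :: "('x \<Rightarrow> nat) \<Rightarrow> ('x, 'k::comm_ring_1) mpoly \<Rightarrow> ('x, 'k) mpoly poly" where
  "grade w = meval (\<lambda>c. [:mconst c:]) (\<lambda>y. monom (pvar y) (w y))"

lemma hom_pconst: "is_ring_hom (\<lambda>c. [:mconst c:])"
  using hom_comp[OF hom_const hom_mconst] .

lemma msubst_hom: "is_ring_hom (msubst v)"
  unfolding msubst_def by (rule meval_hom[OF hom_mconst])

lemma as_poly_hom: "is_ring_hom (as_poly x)"
  unfolding as_poly_def by (rule meval_hom[OF hom_pconst])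

lemma grade_hom: "is_ring_hom (grade w)"
  unfolding grade_def by (rule meval_hom[OF hom_pconst])

lemma msubst_pvar [simp]: "msubst v (pvar x) = v x"
  unfolding msubst_def by (rule meval_pvar[OF hom_mconst])

lemma msubst_mconst [simp]: "msubst v (mconst c) = mconst c"
  unfolding msubst_def by (rule meval_mconst[OF hom_mconst])

lemma as_poly_pvar [simp]: "as_poly x (pvar y) = (if y = x then [:0, 1:] else [:pvar y:])"
  unfolding as_poly_def by (rule meval_pvar[OF hom_pconst])

lemma as_poly_mconst [simp]: "as_poly x (mconst c) = [:mconst c:]"
  unfolding as_poly_def by (rule meval_mconst[OF hom_pconst])

lemma grade_pvar [simp]: "grade w (pvar y) = monom (pvar y) (w y)"
  unfolding grade_def by (rule meval_pvar[OF hom_pconst])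

lemma grade_mconst [simp]: "grade w (mconst c) = [:mconst c:]"
  unfolding grade_def by (rule meval_mconst[OF hom_pconst])

lemmas as_poly_simps [simp] = hom_simps[OF as_poly_hom]
lemmas grade_simps [simp] = hom_simps[OF grade_hom]
lemmas msubst_simps [simp] = hom_simps[OF msubst_hom]

lemma poly_as_poly: "poly (as_poly x p) (pvar x) = p"
  by (rule hom_eqI[OF hom_comp[OF hom_poly_eval as_poly_hom] hom_id]) auto

lemma poly_grade_1: "poly (grade w p) 1 = p"
  by (rule hom_eqI[OF hom_comp[OF hom_poly_eval grade_hom] hom_id]) (auto simp: poly_monom)

lemma msubst_id: "msubst pvar p = p"
  by (rule hom_eqI[OF msubst_hom hom_id]) auto

lemma poly_in_ideal_gen:
  assumes "\<And>n. coeff p n \<in> ideal_gen B"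
  shows "poly p a \<in> ideal_gen B"
  unfolding poly_altdef by (intro ring_ideal.span_sum ideal_gen_mult_right assms)

text \<open>Phrased through \<open>as_poly\<close> rather than \<open>indets\<close>, so that
  closure under the ring operations comes from the homomorphism.\<close>

definition free_of :: "'x \<Rightarrow> ('x, 'k::comm_ring_1) mpoly \<Rightarrow> bool" where
  "free_of x p \<longleftrightarrow> as_poly x p = [:p:]"

lemma free_of_simps [simp]:
  "y \<noteq> x \<Longrightarrow> free_of x (pvar y)"
  "free_of x p \<Longrightarrow> free_of x q \<Longrightarrow> free_of x (p + q)"
  "free_of x p \<Longrightarrow> free_of x q \<Longrightarrow> free_of x (p - q)"
  "free_of x p \<Longrightarrow> free_of x q \<Longrightarrow> free_of x (p * q)"
  "free_of x p \<Longrightarrow> free_of x (- p)"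
  "free_of x 0" "free_of x 1"
  unfolding free_of_def by (simp_all add: one_pCons)

lemma as_poly_free_of: "free_of x p \<Longrightarrow> as_poly x p = [:p:]"
  unfolding free_of_def .

definition fresh :: "'x \<Rightarrow> ('x, 'k::comm_ring_1) mpoly set \<Rightarrow> bool" where
  "fresh x B \<longleftrightarrow> (\<forall>b\<in>B. free_of x b)"

lemma fresh_insert [simp]: "fresh x (insert b B) \<longleftrightarrow> free_of x b \<and> fresh x B"
  unfolding fresh_def by auto

text \<open>Such an ideal is extended from the ring without \<open>x\<close>, so membership is
  decided coefficient by coefficient in \<open>x\<close>.\<close>

lemma fresh_coeff:
  assumes "fresh x B" "p \<in> ideal_gen B"
  shows "coeff (as_poly x p) n \<in> ideal_gen B"
proof (rule hom_coeff_ideal_gen[OF as_poly_hom _ assms(2)])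
  fix b n assume "b \<in> B"
  then show "coeff (as_poly x b) n \<in> ideal_gen B"
    using assms(1) by (auto simp: fresh_def free_of_def coeff_pCons ring_ideal.span_zero
        ring_ideal.span_base split: nat.split)
qed

lemma nzd_by_lead:
  assumes "fresh x B" "nzd_mod B (coeff (as_poly x f) d)" "degree (as_poly x f) \<le> d"
  shows "nzd_mod B f"
  unfolding nzd_mod_def
proof (intro allI impI)
  fix g assume "f * g \<in> ideal_gen B"
  then have "coeff (as_poly x f * as_poly x g) n \<in> ideal_gen B" for n
    using fresh_coeff[OF assms(1), of "f * g"] by simp
  then have "coeff (as_poly x g) n \<in> ideal_gen B" for n
    by (rule coeff_nzd_lead[OF assms(2,3), of 0]) simp
  from poly_in_ideal_gen[OF this, of "pvar x"] show "g \<in> ideal_gen B" by (simp add: poly_as_poly)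
qed

lemma nzd_linear:
  assumes "fresh x B" "nzd_mod B c" "f = c * pvar x + d" "free_of x c" "free_of x d"
  shows "nzd_mod B f"
  by (rule nzd_by_lead[of x _ _ 1]) (use assms in \<open>auto simp: as_poly_free_of\<close>)

lemma nzd_fresh: "fresh x B \<Longrightarrow> nzd_mod B (pvar x)"
  by (rule nzd_linear[of x B 1 _ 0]) (auto simp: nzd_mod_1)

text \<open>Reducing modulo \<open>x\<close> is setting \<open>x\<close> to zero, which leaves the
  generators in \<open>B\<close> alone.\<close>

lemma ideal_gen_insert_pvar:
  assumes "fresh x B"
  shows "g \<in> ideal_gen (insert (pvar x) B) \<longleftrightarrow> coeff (as_poly x g) 0 \<in> ideal_gen B"
proof
  assume "g \<in> ideal_gen (insert (pvar x) B)"
  then obtain k where "g - k * pvar x \<in> ideal_gen B" by (auto simp: ideal_gen_insert)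
  from fresh_coeff[OF assms this, of 0] show "coeff (as_poly x g) 0 \<in> ideal_gen B"
    by (simp add: coeff_mult)
next
  assume c: "coeff (as_poly x g) 0 \<in> ideal_gen B"
  obtain a q where aq: "as_poly x g = pCons a q" by (cases "as_poly x g")
  have "g = a + pvar x * poly q (pvar x)" using poly_as_poly[of x g] by (simp add: aq)
  then have "g - poly q (pvar x) * pvar x = a" by simp
  moreover have "a \<in> ideal_gen B" using c aq by simp
  ultimately show "g \<in> ideal_gen (insert (pvar x) B)" unfolding ideal_gen_insert by metis
qed

lemma nzd_insert_pvar:
  assumes "fresh x B" "nzd_mod B c" "free_of x c"
  shows "nzd_mod (insert (pvar x) B) c"
  using assms unfolding nzd_mod_def
  by (simp add: ideal_gen_insert_pvar as_poly_free_of)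

lemma prime_insert_pvar:
  assumes "fresh x B" "prime_gen B"
  shows "prime_gen (insert (pvar x) B)"
  using assms(2) unfolding prime_gen_def
  by (simp add: ideal_gen_insert_pvar[OF assms(1)] coeff_mult)

text \<open>Identifies the ideal generated by \<open>f\<close> and \<open>B\<close> with a set of
  the shape of \<open>Q\<close> in \<open>linear_prime\<close>.\<close>

lemma ideal_gen_insert_linear:
  assumes "fresh x B"
  shows "g \<in> ideal_gen (insert f B) \<longleftrightarrow>
    (\<exists>q. \<forall>n. coeff (as_poly x g - as_poly x f * q) n \<in> ideal_gen B)"
proof
  assume "g \<in> ideal_gen (insert f B)"
  then obtain k where "g - k * f \<in> ideal_gen B" by (auto simp: ideal_gen_insert)
  from fresh_coeff[OF assms this] show
    "\<exists>q. \<forall>n. coeff (as_poly x g - as_poly x f * q) n \<in> ideal_gen B"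
    by (auto intro!: exI[of _ "as_poly x k"] simp: mult.commute)
next
  assume "\<exists>q. \<forall>n. coeff (as_poly x g - as_poly x f * q) n \<in> ideal_gen B"
  then obtain q where "\<And>n. coeff (as_poly x g - as_poly x f * q) n \<in> ideal_gen B" by blast
  from poly_in_ideal_gen[OF this, of "pvar x"] show "g \<in> ideal_gen (insert f B)"
    by (auto simp: ideal_gen_insert poly_as_poly mult.commute)
qed

text \<open>A multiple of \<open>f\<close> has positive degree in \<open>x\<close> modulo
  \<open>B\<close> unless the multiplier vanishes, so adjoining \<open>f\<close> creates no new
  relation free of \<open>x\<close>. The case \<open>r = 1\<close> is properness.\<close>

lemma linear_elimination:
  assumes "fresh x B" "nzd_mod B c" "f = c * pvar x + d" "free_of x c" "free_of x d"
    and "free_of x r" "r \<in> ideal_gen (insert f B)"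
  shows "r \<in> ideal_gen B"
proof -
  have f: "as_poly x f = [:d, c:]" using assms by (simp add: as_poly_free_of)
  obtain s where s: "\<And>n. coeff ([:r:] - [:d, c:] * s) n \<in> ideal_gen B"
    using assms(6,7) ideal_gen_insert_linear[OF assms(1)] by (auto simp: f as_poly_free_of)
  have "coeff s n \<in> ideal_gen B" for n
  proof (rule coeff_nzd_lead[of B "[:d, c:]" 1 0])
    fix n :: nat assume "0 + 1 \<le> n"
    then have "coeff ([:r:] - [:d, c:] * s) n = - coeff ([:d, c:] * s) n" by (cases n) auto
    then show "coeff ([:d, c:] * s) n \<in> ideal_gen B"
      using ring_ideal.span_neg[OF s[of n]] by (metis minus_minus)
  qed (use assms(2) in auto)
  from ideal_gen_coeff_mult[OF this, of "[:d, c:]" 0] s[of 0]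
  have "coeff (s * [:d, c:]) 0 + coeff ([:r:] - [:d, c:] * s) 0 \<in> ideal_gen B"
    by (intro ring_ideal.span_add)
  then show ?thesis by (simp add: mult.commute)
qed

lemma prime_insert_linear:
  assumes x: "fresh x B" and B: "prime_gen B" and c: "c \<notin> ideal_gen B" and d: "nzd_mod (insert c B) d"
    and f: "f = c * pvar x + d" "free_of x c" "free_of x d"
  shows "prime_gen (insert f B)"
proof -
  have f': "as_poly x f = [:d, c:]" using f by (simp add: as_poly_free_of)
  have "1 \<notin> ideal_gen (insert f B)"
    using linear_elimination[OF x prime_gen_nzd[OF B c] f free_of_simps(7)] B
    unfolding prime_gen_def by blast
  then show ?thesis
    unfolding prime_gen_def ideal_gen_insert_linear[OF x] f'
    using linear_prime[OF B c d] by simp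
qed

section \<open>Weighted homogeneous ideals\<close>

definition homogeneous :: "('x \<Rightarrow> nat) \<Rightarrow> ('x, 'k::comm_ring_1) mpoly set \<Rightarrow> bool" where
  "homogeneous w B \<longleftrightarrow> (\<forall>b\<in>B. \<exists>n. grade w b = monom b n)"

lemma homogeneous_coeff:
  assumes "homogeneous w B" "p \<in> ideal_gen B"
  shows "coeff (grade w p) n \<in> ideal_gen B"
proof (rule hom_coeff_ideal_gen[OF grade_hom _ assms(2)])
  fix b n assume "b \<in> B"
  then obtain m where "grade w b = monom b m" using assms(1) unfolding homogeneous_def by blast
  with \<open>b \<in> B\<close> show "coeff (grade w b) n \<in> ideal_gen B"
    by (simp add: ring_ideal.span_zero ring_ideal.span_base)
qed

text \<open>As \<open>A\<close> has weight 0, the substitution multiplies the component of weight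
  \<open>n\<close> by \<open>A ^ n\<close>. Components of members are members, and the powers of
  \<open>A\<close> cancel separately in each component.\<close>

lemma homogeneous_rescale:
  assumes B: "homogeneous w B" and A: "grade w A = [:A:]" "nzd_mod B A"
    and g: "msubst (\<lambda>z. A ^ w z * pvar z) g \<in> ideal_gen B"
  shows "g \<in> ideal_gen B"
proof -
  \<comment> \<open>On the grading variable the substitution acts as \<open>T\<close> to
    \<open>A T\<close>.\<close>
  have "grade w (msubst (\<lambda>z. A ^ w z * pvar z) p) = pcompose (grade w p) [:0, A:]" for p
  proof (rule hom_eqI[OF hom_comp[OF grade_hom msubst_hom] hom_comp[OF hom_pcompose grade_hom]])
    fix x
    have "pcompose (monom (pvar x) (w x)) [:0, A:] = smult (pvar x) ([:0, A:] ^ w x)"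
      by (simp add: monom_altdef pcompose_smult hom_power[OF hom_pcompose] pcompose_pCons)
    also have "[:0, A:] = [:A:] * [:0, 1:]" by simp
    also have "smult (pvar x) (([:A:] * [:0, 1:]) ^ w x) = [:A:] ^ w x * monom (pvar x) (w x)"
      by (simp only: power_mult_distrib monom_altdef mult_smult_right)
    finally show "grade w (msubst (\<lambda>z. A ^ w z * pvar z) (pvar x)) =
        pcompose (grade w (pvar x)) [:0, A:]"
      by (simp add: hom_power[OF grade_hom] A(1))
  qed (simp add: pcompose_const)
  then have "A ^ n * coeff (grade w g) n \<in> ideal_gen B" for n
    using homogeneous_coeff[OF B g, of n] by (simp add: coeff_pcompose_linear)
  then have "coeff (grade w g) n \<in> ideal_gen B" for n
    using nzd_mod_power[OF A(2), of n] unfolding nzd_mod_def by blast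
  from poly_in_ideal_gen[OF this, of 1] show ?thesis by (simp add: poly_grade_1)
qed

lemma notin_ideal_gen:
  assumes "is_ring_hom f" "\<And>b. b \<in> B \<Longrightarrow> f b = 0" "f p \<noteq> 0"
  shows "p \<notin> ideal_gen B"
  using hom_ideal_gen[OF assms(1), of B "{}" p] assms(2,3) by auto

text \<open>Evaluation at the 0/1 point supported on \<open>S\<close>, which is available over every
  field.\<close>

definition eval_ind :: "'x set \<Rightarrow> ('x, 'k::comm_ring_1) mpoly \<Rightarrow> 'k" where
  "eval_ind S = meval (\<lambda>c. c) (\<lambda>x. of_bool (x \<in> S))"

lemma eval_ind_hom: "is_ring_hom (eval_ind S)"
  unfolding eval_ind_def by (rule meval_hom[OF hom_id])

lemma eval_ind_pvar [simp]: "eval_ind S (pvar x) = of_bool (x \<in> S)"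
  unfolding eval_ind_def by (rule meval_pvar[OF hom_id])

lemmas eval_ind_simps [simp] = hom_simps[OF eval_ind_hom]


section \<open>The polynomial ring is a domain\<close>

lemma msubst_cong:
  assumes "\<And>x. x \<in> indets p \<Longrightarrow> v x = w x"
  shows "msubst v p = msubst w p"
  unfolding msubst_def meval_def meval_monom_def
  by (intro sum.cong prod.cong refl arg_cong2[of _ _ _ _ "(*)"] arg_cong2[of _ _ _ _ "(^)"] assms)
     (auto simp: indets_def)

lemma finite_indets: "finite (indets p)"
  unfolding indets_def by simp

text \<open>Only finitely many indeterminates occur. Numbering them by naturals makes the monomials
  ordered, and there leading terms multiply.\<close>

lemma mpoly_no_zero_divisors:
  fixes p q :: "('x, 'k::idom) mpoly"
  assumes "p * q = 0"
  shows "p = 0 \<or> q = 0"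
proof -
  define X where "X = indets p \<union> indets q"
  have "finite X" unfolding X_def by (simp add: finite_indets)
  then obtain f :: "'x \<Rightarrow> nat" and n where f: "inj_on f X" using finite_imp_inj_to_nat_seg by metis
  let ?F = "msubst (\<lambda>x. pvar (f x)) :: ('x, 'k) mpoly \<Rightarrow> (nat, 'k) mpoly"
  let ?G = "msubst (\<lambda>n. pvar (inv_into X f n)) :: (nat, 'k) mpoly \<Rightarrow> ('x, 'k) mpoly"
  have inv: "?G (?F r) = r" if "indets r \<subseteq> X" for r
  proof -
    have "?G (?F r) = msubst (\<lambda>x. pvar (inv_into X f (f x))) r"
      by (rule hom_eqI[OF hom_comp[OF msubst_hom msubst_hom] msubst_hom]) auto
    also have "\<dots> = msubst pvar r"
      using that f by (intro msubst_cong) (auto simp: subset_iff)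
    finally show ?thesis by (simp add: msubst_id)
  qed
  have "?F p * ?F q = 0" using assms hom_simps[OF msubst_hom] by metis
  then have "?F p = 0 \<or> ?F q = 0" by simp
  then show ?thesis using inv[of p] inv[of q] hom_zero[OF msubst_hom] unfolding X_def
    by (metis sup.cobounded1 sup.cobounded2)
qed

lemma prime_gen_empty: "prime_gen ({} :: ('x, 'k::idom) mpoly set)"
  unfolding prime_gen_def using mpoly_no_zero_divisors by auto


section \<open>Lovasz-Saks-Schrijver ideals of edge sets\<close>

definition lss_gens :: "nat \<Rightarrow> 'v set set \<Rightarrow> ('v \<times> nat, 'k::field) mpoly set" where
  "lss_gens d E = {lss_poly d i j | i j. {i, j} \<in> E}"

definition del :: "'v set set \<Rightarrow> 'v \<Rightarrow> 'v set set" where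
  "del E w = {e \<in> E. w \<notin> e}"

text \<open>Maximum degree at most two, so the components are paths and cycles. It concerns the edge
  set alone and passes to subsets, as inductions that delete edges require.\<close>

definition paths_cycles :: "'v set set \<Rightarrow> bool" where
  "paths_cycles E \<longleftrightarrow> finite E \<and> (\<forall>e\<in>E. card e = 2) \<and>
     (\<forall>v a b c. {v, a} \<in> E \<longrightarrow> {v, b} \<in> E \<longrightarrow> {v, c} \<in> E \<longrightarrow> a = b \<or> a = c \<or> b = c)"

definition square_free :: "'v set set \<Rightarrow> bool" where
  "square_free E \<longleftrightarrow> (\<forall>a b u w. a \<noteq> b \<longrightarrow> u \<noteq> w \<longrightarrow>
     \<not> ({w, a} \<in> E \<and> {w, b} \<in> E \<and> {u, a} \<in> E \<and> {u, b} \<in> E))"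

lemma paths_cycles_mono: "paths_cycles E \<Longrightarrow> F \<subseteq> E \<Longrightarrow> paths_cycles F"
  unfolding paths_cycles_def by (meson finite_subset subsetD)

lemma square_free_mono: "square_free E \<Longrightarrow> F \<subseteq> E \<Longrightarrow> square_free F"
  unfolding square_free_def by blast

lemma del_subset: "del E w \<subseteq> E"
  unfolding del_def by blast

lemma paths_cycles_no_loop: "paths_cycles E \<Longrightarrow> {v, v} \<notin> E"
  unfolding paths_cycles_def by force

lemma paths_cycles_neq: "paths_cycles E \<Longrightarrow> {v, u} \<in> E \<Longrightarrow> v \<noteq> u"
  using paths_cycles_no_loop by fastforce

lemma paths_cycles_three:
  "paths_cycles E \<Longrightarrow> {v, a} \<in> E \<Longrightarrow> {v, b} \<in> E \<Longrightarrow> {v, c} \<in> E \<Longrightarrow> a = b \<or> a = c \<or> b = c"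
  unfolding paths_cycles_def by blast

lemma lss_poly_commute: "lss_poly d i j = lss_poly d j i"
  unfolding lss_poly_def by (simp add: mult.commute)

lemma lss_gens_del: "lss_gens d E = lss_gens d (del E w) \<union> (\<lambda>a. lss_poly d a w) ` {a. {w, a} \<in> E}"
proof (intro equalityI subsetI)
  fix p assume "p \<in> lss_gens d E"
  then obtain i j where p: "p = lss_poly d i j" and E: "{i, j} \<in> E" unfolding lss_gens_def by blast
  show "p \<in> lss_gens d (del E w) \<union> (\<lambda>a. lss_poly d a w) ` {a. {w, a} \<in> E}"
  proof (cases "w \<in> {i, j}")
    case True
    then have "(i = w \<and> {w, j} \<in> E) \<or> (j = w \<and> {w, i} \<in> E)" using E insert_commute[of i j] by auto
    then show ?thesis
    proof
      assume "i = w \<and> {w, j} \<in> E"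
      then show ?thesis using p lss_poly_commute[of d i j] by blast
    qed (use p in blast)
  next
    case False
    then show ?thesis using p E unfolding lss_gens_def del_def by blast
  qed
next
  fix p assume "p \<in> lss_gens d (del E w) \<union> (\<lambda>a. lss_poly d a w) ` {a. {w, a} \<in> E}"
  then show "p \<in> lss_gens d E"
  proof
    assume "p \<in> (\<lambda>a. lss_poly d a w) ` {a. {w, a} \<in> E}"
    then obtain a where "{w, a} \<in> E" "p = lss_poly d a w" by blast
    then show ?thesis unfolding lss_gens_def lss_poly_commute[of d a w] by blast
  qed (auto simp: lss_gens_def del_def)
qed

lemma free_of_sum: "(\<And>i. i \<in> A \<Longrightarrow> free_of x (f i)) \<Longrightarrow> free_of x (sum f A)"
  by (induction A rule: infinite_finite_induct) auto

lemma free_of_lss_poly: "i \<noteq> w \<Longrightarrow> j \<noteq> w \<Longrightarrow> free_of (w, l) (lss_poly d i j)"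
  unfolding lss_poly_def by (intro free_of_sum) auto

lemma fresh_lss_gens: "(\<And>e. e \<in> E \<Longrightarrow> w \<notin> e) \<Longrightarrow> fresh (w, l) (lss_gens d E)"
  unfolding fresh_def lss_gens_def by (blast intro: free_of_lss_poly)

lemma fresh_del: "fresh (w, l) (lss_gens d (del E w))"
  by (rule fresh_lss_gens) (auto simp: del_def)

text \<open>At the point of \<open>S\<close> adjacent vertices carry vectors with disjoint supports,
  so every summand of every edge polynomial vanishes.\<close>

lemma notin_lss_ideal:
  assumes "\<And>i j l. {i, j} \<in> E \<Longrightarrow> (i, l) \<in> S \<Longrightarrow> (j, l) \<notin> S" "eval_ind S p \<noteq> 0"
  shows "p \<notin> ideal_gen (lss_gens d E)"
proof (rule notin_ideal_gen[OF eval_ind_hom _ assms(2)])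
  fix b :: "('a \<times> nat, 'b) mpoly" assume "b \<in> lss_gens d E"
  then show "eval_ind S b = 0"
    using assms(1) by (auto simp: lss_gens_def lss_poly_def hom_sum[OF eval_ind_hom] intro!: sum.neutral)
qed

lemma pvar_notin_lss_ideal:
  assumes "paths_cycles E"
  shows "pvar x \<notin> ideal_gen (lss_gens d E)"
  by (rule notin_lss_ideal[of _ "{x}"]) (use paths_cycles_no_loop[OF assms] in auto)

lemma minor_notin_lss_ideal:
  assumes "paths_cycles E" "a \<noteq> b" "c \<noteq> c'"
  shows "pvar (a, c) * pvar (b, c') - pvar (b, c) * pvar (a, c') \<notin> ideal_gen (lss_gens d E)"
  by (rule notin_lss_ideal[of _ "{(a, c), (b, c')}"])
     (use assms paths_cycles_no_loop[OF assms(1)] in auto)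


section \<open>Primality in dimension three\<close>

text \<open>An ordering of the three coordinates. The arguments single out one or two of them, and
  the cycle case uses several orderings.\<close>

definition colours :: "nat \<Rightarrow> nat \<Rightarrow> nat \<Rightarrow> bool" where
  "colours c c' c'' \<longleftrightarrow> {1..3} = {c, c', c''} \<and> distinct [c, c', c'']"

lemma lss_poly_3:
  "colours c c' c'' \<Longrightarrow> lss_poly 3 i j =
     pvar (i, c) * pvar (j, c) + pvar (i, c') * pvar (j, c') + pvar (i, c'') * pvar (j, c'')"
  unfolding lss_poly_def colours_def by (simp add: add.assoc)

lemma colours_neq:
  "colours c c' c'' \<Longrightarrow> c \<noteq> c' \<and> c' \<noteq> c \<and> c \<noteq> c'' \<and> c'' \<noteq> c \<and> c' \<noteq> c'' \<and> c'' \<noteq> c'"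
  unfolding colours_def by auto

text \<open>The edge polynomial is linear in coordinate \<open>c'\<close> of \<open>u\<close>, and
  its constant part is linear in coordinate \<open>c''\<close>. Coordinate \<open>c\<close> of
  \<open>u\<close> may occur in \<open>B\<close>: in \<open>vertex_nzd\<close> it has been set to
  zero.\<close>

lemma prime_attach:
  assumes c: "colours c c' c''" and "a \<noteq> u"
    and B: "prime_gen B" "fresh (u, c') B" "fresh (u, c'') B"
    and a: "pvar (a, c') \<notin> ideal_gen B" "nzd_mod (insert (pvar (a, c')) B) (pvar (a, c''))"
  shows "prime_gen (insert (lss_poly 3 a u) B)"
proof (rule prime_insert_linear[OF B(2,1) a(1)])
  show "lss_poly 3 a u = pvar (a, c') * pvar (u, c') +
      (pvar (a, c'') * pvar (u, c'') + pvar (a, c) * pvar (u, c))"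
    by (simp add: lss_poly_3[OF c])
  show "nzd_mod (insert (pvar (a, c')) B) (pvar (a, c'') * pvar (u, c'') + pvar (a, c) * pvar (u, c))"
    by (rule nzd_linear[of "(u, c'')", OF _ a(2) refl]) (use c B \<open>a \<noteq> u\<close> in \<open>auto dest!: colours_neq\<close>)
qed (use c \<open>a \<noteq> u\<close> in \<open>auto dest!: colours_neq\<close>)

text \<open>Modulo two coordinates of \<open>a\<close> its only edge becomes the third coordinate
  times a coordinate of the neighbour, which is regular. So the two coordinates can be followed by
  the edge, and a swap puts the edge before the second of them.\<close>

lemma end_vertex_regular:
  assumes H: "paths_cycles H" and prime: "prime_gen (lss_gens 3 (del H a) :: ('v \<times> nat, 'k::field) mpoly set)"
    and one: "\<And>t t'. {a, t} \<in> H \<Longrightarrow> {a, t'} \<in> H \<Longrightarrow> t = t'"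
    and c: "colours c c' c''"
  shows "nzd_mod (insert (pvar (a, c')) (lss_gens 3 H :: ('v \<times> nat, 'k) mpoly set)) (pvar (a, c''))"
proof (cases "\<exists>t. {a, t} \<in> H")
  case False
  then have "lss_gens 3 H = (lss_gens 3 (del H a) :: ('v \<times> nat, 'k) mpoly set)"
    by (subst lss_gens_del[of _ _ a]) auto
  then show ?thesis using c by (intro nzd_fresh) (auto simp: fresh_del dest!: colours_neq)
next
  case True
  then obtain t where t: "{a, t} \<in> H" by blast
  then have "t \<noteq> a" using paths_cycles_neq[OF H] by blast
  let ?B = "lss_gens 3 (del H a) :: ('v \<times> nat, 'k) mpoly set"
  let ?p = "lss_poly 3 t a"
  have "{t. {a, t} \<in> H} = {t}" using t one by blast
  then have gens: "lss_gens 3 H = insert ?p ?B"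
    by (subst lss_gens_del[of _ _ a]) auto
  have fresh: "fresh (a, l) ?B" for l by (rule fresh_del)
  have t': "nzd_mod ?B (pvar (t, c))"
    using prime_gen_nzd[OF prime] pvar_notin_lss_ideal[OF paths_cycles_mono[OF H del_subset]] by blast
  have "nzd_mod (insert (pvar (a, c')) ?B) (pvar (t, c))"
    by (rule nzd_insert_pvar[OF fresh t']) (use \<open>t \<noteq> a\<close> in auto)
  then have "nzd_mod (insert (pvar (a, c'')) (insert (pvar (a, c')) ?B)) (pvar (t, c))"
    by (rule nzd_insert_pvar[rotated]) (use \<open>t \<noteq> a\<close> c in \<open>auto simp: fresh dest!: colours_neq\<close>)
  then have "nzd_mod (insert (pvar (a, c'')) (insert (pvar (a, c')) ?B)) ?p"
    by (rule nzd_linear[of "(a, c)", rotated, where d = "pvar (t, c') * pvar (a, c') + pvar (t, c'') * pvar (a, c'')"])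
       (use c fresh \<open>t \<noteq> a\<close> in \<open>auto simp: lss_poly_3[OF c] dest!: colours_neq\<close>)
  moreover have "nzd_mod (insert (pvar (a, c')) ?B) (pvar (a, c''))"
    using c by (intro nzd_fresh) (auto simp: fresh dest!: colours_neq)
  ultimately show ?thesis
    using nzd_mod_swap insert_commute[of "pvar (a, c')" ?p ?B] unfolding gens by metis
qed

text \<open>Primality is assumed only after deletion of \<open>u\<close>, since
  \<open>cycle_prime\<close> applies this where primality for \<open>G\<close> is still
  open.\<close>

lemma vertex_nzd:
  assumes G: "paths_cycles G" and prime: "prime_gen (lss_gens 3 (del G u) :: ('v \<times> nat, 'k::field) mpoly set)"
    and prime': "\<And>a. {u, a} \<in> G \<Longrightarrow> prime_gen (lss_gens 3 (del (del G u) a) :: ('v \<times> nat, 'k) mpoly set)"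
    and c: "colours c c' c''"
  shows "nzd_mod (lss_gens 3 G :: ('v \<times> nat, 'k) mpoly set) (pvar (u, c))"
proof -
  let ?I = "lss_gens 3 (del G u) :: ('v \<times> nat, 'k) mpoly set"
  let ?r = "pvar (u, c) :: ('v \<times> nat, 'k) mpoly"
  let ?J = "insert ?r ?I"
  have H: "paths_cycles (del G u)" using paths_cycles_mono[OF G del_subset] .
  have fresh: "fresh (u, l) ?I" for l by (rule fresh_del)
  have freshJ: "fresh (u, c') ?J" "fresh (u, c'') ?J" using c fresh by (auto dest!: colours_neq)
  have r: "nzd_mod ?I ?r" by (rule nzd_fresh[OF fresh])
  have J: "prime_gen ?J" by (rule prime_insert_pvar[OF fresh prime])
  have nJ: "p \<notin> ideal_gen ?J" if "p \<notin> ideal_gen ?I" "free_of (u, c) p" for p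
    using that by (simp add: ideal_gen_insert_pvar[OF fresh] as_poly_free_of)
  have notJ: "pvar (a, l) \<notin> ideal_gen ?J" if "(a, l) \<noteq> (u, c)" for a l
    using that by (intro nJ pvar_notin_lss_ideal[OF H]) auto
  have one: "nzd_mod ?J (lss_poly 3 a u)" if "a \<noteq> u" for a
  proof (rule nzd_linear[OF freshJ(1)])
    show "nzd_mod ?J (pvar (a, c'))" using that by (intro prime_gen_nzd[OF J] notJ) auto
    show "lss_poly 3 a u = pvar (a, c') * pvar (u, c') +
        (pvar (a, c) * pvar (u, c) + pvar (a, c'') * pvar (u, c''))"
      by (simp add: lss_poly_3[OF c])
  qed (use that c in \<open>auto dest!: colours_neq\<close>)
  have gens: "lss_gens 3 G = ?I \<union> (\<lambda>a. lss_poly 3 a u) ` {a. {u, a} \<in> G}" by (rule lss_gens_del)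
  consider "{a. {u, a} \<in> G} = {}" | a where "{a. {u, a} \<in> G} = {a}"
    | a b where "{a. {u, a} \<in> G} = {a, b}" "a \<noteq> b"
    using paths_cycles_three[OF G, of u] by blast
  then show ?thesis
  proof cases
    case 1
    then show ?thesis using r gens by simp
  next
    case (2 a)
    then have "{u, a} \<in> G" by blast
    then have "a \<noteq> u" using paths_cycles_neq[OF G] by blast
    then show ?thesis using 2 nzd_mod_swap[OF r one[of a]] gens by simp
  next
    case (3 a b)
    then have edges: "{u, a} \<in> G" "{u, b} \<in> G" by auto
    then have neq: "a \<noteq> u" "b \<noteq> u" using paths_cycles_no_loop[OF G] by auto
    let ?p = "lss_poly 3 a u :: ('v \<times> nat, 'k) mpoly" and ?q = "lss_poly 3 b u :: ('v \<times> nat, 'k) mpoly"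
    have gens: "lss_gens 3 G = insert ?q (insert ?p ?I)"
      using 3 gens by auto
    have "nzd_mod (insert (pvar (a, c')) ?I) (pvar (a, c''))"
    proof (rule end_vertex_regular[OF H prime'[OF edges(1)] _ c])
      fix t t' assume tt: "{a, t} \<in> del G u" "{a, t'} \<in> del G u"
      moreover have "{a, u} \<in> G" using edges by (simp add: insert_commute)
      ultimately show "t = t'" using paths_cycles_three[OF G, of a t t' u] by (auto simp: del_def)
    qed
    then have "nzd_mod (insert ?r (insert (pvar (a, c')) ?I)) (pvar (a, c''))"
      by (rule nzd_insert_pvar[rotated]) (use neq fresh in auto)
    then have K: "prime_gen (insert ?p ?J)"
      using neq by (intro prime_attach[OF c _ J freshJ] notJ) (auto simp: insert_commute)
    have "?q \<notin> ideal_gen (insert ?p ?J)"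
    proof
      assume q: "?q \<in> ideal_gen (insert ?p ?J)"
      \<comment> \<open>Cramer's rule modulo \<open>?r\<close>: the two edges combine to a minor of
        \<open>a\<close>, \<open>b\<close> times coordinate \<open>c''\<close> of \<open>u\<close>,
        with coordinate \<open>c'\<close> eliminated.\<close>
      define m where "m = (pvar (a, c') * pvar (b, c'') - pvar (b, c') * pvar (a, c'') :: ('v \<times> nat, 'k) mpoly)"
      have "m * pvar (u, c'') = pvar (a, c') * ?q - pvar (b, c') * ?p -
          (pvar (a, c') * pvar (b, c) - pvar (b, c') * pvar (a, c)) * ?r"
        unfolding m_def lss_poly_3[OF c] by (simp add: algebra_simps)
      also have "\<dots> \<in> ideal_gen (insert ?p ?J)"
        by (intro ring_ideal.span_diff ideal_gen_mult_left q) (auto intro: ring_ideal.span_base)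
      finally have m: "m * pvar (u, c'') \<in> ideal_gen (insert ?p ?J)" .
      have "m * pvar (u, c'') \<in> ideal_gen ?J"
      proof (rule linear_elimination[OF freshJ(1) _ _ _ _ _ m])
        show "nzd_mod ?J (pvar (a, c'))" using neq by (intro prime_gen_nzd[OF J] notJ) auto
        show "?p = pvar (a, c') * pvar (u, c') +
            (pvar (a, c) * pvar (u, c) + pvar (a, c'') * pvar (u, c''))"
          by (simp add: lss_poly_3[OF c])
      qed (use neq c in \<open>auto simp: m_def dest!: colours_neq\<close>)
      then have "m \<in> ideal_gen ?J" using notJ[of u c''] c prime_gen_mult[OF J] by (auto dest!: colours_neq)
      moreover have "m \<notin> ideal_gen ?J"
        using minor_notin_lss_ideal[OF H 3(2), of c' c''] c neq
        by (intro nJ) (auto simp: m_def dest!: colours_neq)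
      ultimately show False by blast
    qed
    then have "nzd_mod (insert ?p ?J) ?q" by (rule prime_gen_nzd[OF K])
    then have "nzd_mod (insert ?r (insert ?p ?I)) ?q" by (simp add: insert_commute)
    then show ?thesis unfolding gens using nzd_mod_swap nzd_mod_swap[OF r one[OF neq(1)]] by blast
  qed
qed

lemma grade_lss_poly:
  assumes "\<And>l. l \<in> {1..d} \<Longrightarrow> w (i, l) = m" "\<And>l. l \<in> {1..d} \<Longrightarrow> w (j, l) = n"
  shows "grade w (lss_poly d i j) = monom (lss_poly d i j) (m + n)"
proof -
  have "grade w (lss_poly d i j) = (\<Sum>l = 1..d. monom (pvar (i, l) * pvar (j, l)) (m + n))"
    unfolding lss_poly_def hom_sum[OF grade_hom] by (rule sum.cong) (simp_all add: assms mult_monom)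
  then show ?thesis unfolding lss_poly_def by (simp add: monom_sum)
qed

lemma msubst_lss_poly:
  "(\<And>l. v (i, l) = pvar (i, l)) \<Longrightarrow> (\<And>l. v (j, l) = pvar (j, l)) \<Longrightarrow>
    msubst v (lss_poly d i j) = lss_poly d i j"
  unfolding lss_poly_def by (simp add: hom_sum[OF msubst_hom])

lemma del_psubset: "{w, a} \<in> E \<Longrightarrow> del E w \<subset> E"
proof -
  assume "{w, a} \<in> E"
  moreover have "{w, a} \<notin> del E w" by (simp add: del_def)
  ultimately have "del E w \<noteq> E" by metis
  with del_subset show ?thesis by (rule psubsetI)
qed

lemma del_insert: "w \<in> e \<Longrightarrow> del (insert e E) w = del E w"
  unfolding del_def by auto

lemma lss_gens_insert: "lss_gens d (insert {i, j} E) = insert (lss_poly d i j) (lss_gens d E)"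
proof -
  have "lss_poly d i' j' = lss_poly d i j" if "{i', j'} = {i, j}" for i' j'
    using that by (auto simp: doubleton_eq_iff intro: lss_poly_commute)
  then show ?thesis unfolding lss_gens_def by blast
qed

text \<open>Without the edge to \<open>w\<close>, the vertex \<open>u\<close> has at most one
  neighbour, so two of its coordinates form a regular sequence and \<open>w\<close> can be
  attached.\<close>

lemma degree_one_prime:
  assumes E: "paths_cycles E" and nbrs: "{a. {w, a} \<in> E} = {u}"
    and prime: "\<And>F. F \<subset> E \<Longrightarrow> prime_gen (lss_gens 3 F :: ('v \<times> nat, 'k::field) mpoly set)"
  shows "prime_gen (lss_gens 3 E :: ('v \<times> nat, 'k) mpoly set)"
proof -
  let ?H = "del E w"
  let ?B = "lss_gens 3 ?H :: ('v \<times> nat, 'k) mpoly set"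
  have wu: "{w, u} \<in> E" using nbrs by blast
  then have "u \<noteq> w" using paths_cycles_neq[OF E] by blast
  have H: "paths_cycles ?H" "?H \<subset> E"
    using paths_cycles_mono[OF E del_subset] wu by (auto simp: del_def)
  have "lss_gens 3 E = insert (lss_poly 3 u w) ?B"
    by (subst lss_gens_del[of _ E w]) (simp add: nbrs)
  moreover have "prime_gen (insert (lss_poly 3 u w) ?B)"
  proof (rule prime_attach[OF _ \<open>u \<noteq> w\<close> prime[OF H(2)] fresh_del fresh_del])
    show c: "colours 3 1 2" unfolding colours_def by auto
    show "pvar (u, 1) \<notin> ideal_gen ?B" by (rule pvar_notin_lss_ideal[OF H(1)])
    show "nzd_mod (insert (pvar (u, 1)) ?B) (pvar (u, 2))"
    proof (rule end_vertex_regular[OF H(1) _ _ c])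
      show "prime_gen (lss_gens 3 (del (del E w) u) :: ('v \<times> nat, 'k) mpoly set)"
        by (rule prime[OF subset_psubset_trans[OF del_subset H(2)]])
      fix t t' assume "{u, t} \<in> ?H" "{u, t'} \<in> ?H"
      moreover have "{u, w} \<in> E" using wu by (simp add: insert_commute)
      ultimately show "t = t'"
        using paths_cycles_three[OF E, of u t t' w] by (auto simp: del_def)
    qed
  qed
  ultimately show ?thesis by simp
qed

text \<open>Over the ring in which one coordinate of \<open>a\<close> is inverted, \<open>w\<close> ranges over the plane orthogonal
  to \<open>a\<close>, and \<open>b\<close> is expressed in a basis containing \<open>a\<close>. This turns the three equations of the
  edges at \<open>w\<close> and \<open>b\<close> into the equations \<open>P1\<close> and \<open>P2\<close>, which can be adjoined one at a time. The
  substitutions \<open>\<phi>\<close> and \<open>\<psi>\<close> are the two changes of coordinates with denominators cleared, so that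
  their composite is only a rescaling.\<close>

lemma cycle_prime:
  assumes E: "paths_cycles E" and sq: "square_free E"
    and wa: "{w, a} \<in> E" and wb: "{w, b} \<in> E" and bu: "{b, u} \<in> E" and "a \<noteq> b" "u \<noteq> w"
    and prime: "\<And>F. F \<subset> E \<Longrightarrow> prime_gen (lss_gens 3 F :: ('v \<times> nat, 'k::field) mpoly set)"
  shows "prime_gen (lss_gens 3 E :: ('v \<times> nat, 'k) mpoly set)"
proof -
  define F where "F = del (del E w) b"
  define J where "J = (lss_gens 3 F :: ('v \<times> nat, 'k) mpoly set)"
  define e where "e = (lss_poly 3 a u :: ('v \<times> nat, 'k) mpoly)"
  define y where "y i l = (pvar (i, l) :: ('v \<times> nat, 'k) mpoly)" for i l
  have "colours 1 2 3" unfolding colours_def by auto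
  then obtain p q r where c: "colours p q r" by blast
  have c': "colours q p r" using c unfolding colours_def by auto
  note col = colours_neq[OF c]
  have neq: "a \<noteq> w" "b \<noteq> w" "w \<noteq> b" "u \<noteq> b" "a \<noteq> b" "u \<noteq> w"
    using paths_cycles_neq[OF E] wa wb bu \<open>a \<noteq> b\<close> \<open>u \<noteq> w\<close> by blast+
  have wa': "{a, w} \<in> E" and wb': "{b, w} \<in> E" and bu': "{u, b} \<in> E"
    using wa wb bu by (simp_all add: insert_commute)
  have nbrs_w: "{x. {w, x} \<in> E} = {a, b}" and nbrs_b: "{x. {b, x} \<in> del E w} = {u}"
    using paths_cycles_three[OF E wa wb] paths_cycles_three[OF E wb' bu] wa wb wb' bu neq
    by (auto simp: del_def)
  have FE: "F \<subset> E"
    unfolding F_def using subset_psubset_trans[OF del_subset del_psubset[OF wa]] .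
  then have F: "paths_cycles F" using paths_cycles_mono[OF E] by blast
  have F_no: "\<And>x. {w, x} \<notin> F" "\<And>x. {b, x} \<notin> F" "\<And>x. {x, w} \<notin> F" "\<And>x. {x, b} \<notin> F"
    unfolding F_def del_def by auto
  have primeF: "prime_gen (lss_gens 3 F' :: ('v \<times> nat, 'k) mpoly set)" if "F' \<subseteq> F" for F'
    using prime FE that by blast
  have J_prime: "prime_gen J" unfolding J_def by (rule primeF) simp
  have fresh_b: "fresh (b, l) J" and fresh_w: "fresh (w, l) J" for l
    unfolding J_def F_def by (intro fresh_lss_gens; auto simp: del_def)+
  have e_free: "free_of (b, l) e" "free_of (w, l) e" for l
    unfolding e_def using neq by (auto intro!: free_of_lss_poly)
  have y_free: "free_of (j, m) (y i l)" if "(i, l) \<noteq> (j, m)" for i j l m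
    unfolding y_def using that by simp
  have e: "e = y a p * y u p + y a q * y u q + y a r * y u r"
    unfolding e_def y_def by (rule lss_poly_3[OF c])

  \<comment> \<open>Otherwise \<open>w\<close>, \<open>a\<close>, \<open>u\<close>, \<open>b\<close>
    would form a square.\<close>
  have au: "{a, u} \<notin> E"
  proof
    assume au: "{a, u} \<in> E"
    then have "{u, a} \<in> E" by (simp add: insert_commute)
    then show False using sq wa wb bu' \<open>a \<noteq> b\<close> \<open>u \<noteq> w\<close> unfolding square_free_def by blast
  qed
  \<comment> \<open>The same unit vector at \<open>a\<close> and \<open>u\<close> and zero
    elsewhere; this covers \<open>a = u\<close> too.\<close>
  have "e \<notin> ideal_gen J"
    unfolding J_def
  proof (rule notin_lss_ideal[of _ "{(a, p), (u, p)}"])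
    fix i j l assume "{i, j} \<in> F" "(i, l) \<in> {(a, p), (u, p)}"
    moreover have "{i, j} \<in> E" using \<open>{i, j} \<in> F\<close> FE by blast
    ultimately show "(j, l) \<notin> {(a, p), (u, p)}"
      using au paths_cycles_neq[OF E] by (auto simp: insert_commute)
  qed (use col in \<open>simp add: e y_def\<close>)
  then have e_nzd: "nzd_mod J e" by (rule prime_gen_nzd[OF J_prime])

  \<comment> \<open>If \<open>a = u\<close>, the vertices \<open>w\<close>, \<open>a\<close>,
    \<open>b\<close> form a triangle, \<open>a\<close> is isolated in \<open>F\<close>, and
    \<open>e\<close> is monic of degree two in each coordinate of \<open>a\<close>. Otherwise
    \<open>e\<close> is the polynomial of a new edge: in \<open>F\<close> both \<open>a\<close> and
    \<open>u\<close> have lost a neighbour, so adding \<open>{a, u}\<close> keeps the maximum degree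
    at most two.\<close>
  have nzd_e: "nzd_mod (insert e J) (y z l)" if z: "z \<in> {a, u}" and l: "colours l l' l''" for z l l' l''
  proof (cases "a = u")
    case True
    have "{a, x} \<notin> F" for x
    proof
      assume ax: "{a, x} \<in> F"
      then have "{a, x} \<in> E" "x \<noteq> w" "x \<noteq> b" using FE F_no by (auto simp: insert_commute)
      then show False using paths_cycles_three[OF E wa', of b x] bu' True neq by auto
    qed
    then have a_no: "f \<in> F \<Longrightarrow> a \<notin> f" for f
      using F unfolding paths_cycles_def card_2_iff by (metis insert_commute insert_iff singletonD)
    have fresh_a: "fresh (a, m) J" for m unfolding J_def by (rule fresh_lss_gens[OF a_no])
    have "nzd_mod (insert (y a l) J) e"
    proof (rule nzd_by_lead[of "(a, l')" _ _ 2])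
      have "as_poly (a, l') e = [:y a l * y a l + y a l'' * y a l'', 0, 1:]"
        using colours_neq[OF l] by (simp add: e_def y_def True lss_poly_3[OF l])
      then show "nzd_mod (insert (y a l) J) (coeff (as_poly (a, l') e) 2)"
        and "degree (as_poly (a, l') e) \<le> 2"
        by (simp_all add: nzd_mod_1 numeral_2_eq_2)
    qed (use colours_neq[OF l] fresh_a in \<open>auto simp: y_def\<close>)
    moreover have "nzd_mod J (y a l)" unfolding y_def by (rule nzd_fresh[OF fresh_a])
    ultimately show ?thesis using nzd_mod_swap z True by blast
  next
    case False
    let ?G = "insert {a, u} F"
    have one_a: "x = x'" if "{a, x} \<in> F" "{a, x'} \<in> F" for x x'
      using paths_cycles_three[OF E wa', of x x'] that FE F_no by (auto simp: insert_commute)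
    have one_u: "x = x'" if "{u, x} \<in> F" "{u, x'} \<in> F" for x x'
      using paths_cycles_three[OF E bu', of x x'] that FE F_no by (auto simp: insert_commute)
    have G_F: "{v, x} \<in> F \<or> v = a \<and> x = u \<or> v = u \<and> x = a" if "{v, x} \<in> ?G" for v x
      using that by (auto simp: doubleton_eq_iff)
    have G: "paths_cycles ?G"
      unfolding paths_cycles_def
    proof (intro conjI allI impI ballI)
      show "finite ?G" using F by (simp add: paths_cycles_def)
      show "card f = 2" if "f \<in> ?G" for f
        using that F False by (auto simp: paths_cycles_def)
      fix v x1 x2 x3 assume v: "{v, x1} \<in> ?G" "{v, x2} \<in> ?G" "{v, x3} \<in> ?G"
      show "x1 = x2 \<or> x1 = x3 \<or> x2 = x3"
        using G_F[OF v(1)] G_F[OF v(2)] G_F[OF v(3)] one_a one_u paths_cycles_three[OF F] False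
        by metis
    qed
    have eq: "lss_gens 3 ?G = insert e J" unfolding J_def e_def by (rule lss_gens_insert)
    \<comment> \<open>Deleting \<open>z\<close> removes the new edge again, so primality is used for
      subsets of \<open>F\<close> only.\<close>
    have delG: "del ?G z = del F z" using z by (intro del_insert) auto
    have "nzd_mod (lss_gens 3 ?G :: ('v \<times> nat, 'k) mpoly set) (pvar (z, l))"
    proof (rule vertex_nzd[OF G _ _ l])
      show "prime_gen (lss_gens 3 (del ?G z) :: ('v \<times> nat, 'k) mpoly set)"
        unfolding delG by (rule primeF[OF del_subset])
      show "prime_gen (lss_gens 3 (del (del ?G z) t) :: ('v \<times> nat, 'k) mpoly set)" for t
        unfolding delG by (rule primeF[OF order_trans[OF del_subset del_subset]])
    qed
    then show ?thesis by (simp add: y_def eq)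
  qed

  \<comment> \<open>With \<open>b\<close> written as \<open>b_p a + a_p (0, b_q, b_r)\<close>, the
    product \<open>u . b\<close> is \<open>P1\<close>. For \<open>w\<close> orthogonal to
    \<open>a\<close> and scaled by \<open>a_p\<close>, the product \<open>b . w\<close> is
    \<open>a_p^2 P2\<close>, where \<open>b_p\<close> has disappeared.\<close>
  define P1 where "P1 = e * y b p + y a p * (y u q * y b q + y u r * y b r)"
  define P2 where "P2 = y b q * y w q + y b r * y w r"
  have P1_free: "free_of (w, l) P1" for l
    unfolding P1_def using e_free neq by (auto simp: y_def)
  have Q1: "prime_gen (insert P1 J)"
  proof (rule prime_insert_linear[OF fresh_b J_prime \<open>e \<notin> ideal_gen J\<close> _ P1_def[unfolded y_def[of b p]]])
    show "nzd_mod (insert e J) (y a p * (y u q * y b q + y u r * y b r))"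
    proof (rule nzd_linear[of "(b, q)"])
      show "nzd_mod (insert e J) (y a p * y u q)"
        using nzd_e[OF _ c] nzd_e[OF _ c'] by (intro nzd_mod_mult) auto
      show "y a p * (y u q * y b q + y u r * y b r) = y a p * y u q * pvar (b, q) + y a p * y u r * y b r"
        by (simp add: y_def algebra_simps)
    qed (use e_free fresh_b neq col in \<open>auto simp: y_def\<close>)
  qed (use e_free neq col in \<open>auto simp: y_def\<close>)

  have Q2: "prime_gen (insert P2 (insert P1 J))"
  proof (rule prime_insert_linear[OF _ Q1 _ _ P2_def[unfolded y_def[of w q]]])
    show "fresh (w, q) (insert P1 J)" using fresh_w P1_free by simp
    show "y b q \<notin> ideal_gen (insert P1 J)"
    proof (rule notin_ideal_gen[OF eval_ind_hom[of "{(b, q)}"]])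
      fix x assume "x \<in> insert P1 J"
      then consider "x = P1" | i j where "x = lss_poly 3 i j" "i \<noteq> j"
        unfolding J_def lss_gens_def using paths_cycles_neq[OF F] by blast
      then show "eval_ind {(b, q)} x = 0"
      proof cases
        case 1
        then show ?thesis using neq col by (simp add: P1_def y_def)
      qed (auto simp: lss_poly_def hom_sum[OF eval_ind_hom] intro!: sum.neutral)
    qed (simp add: y_def)
    \<comment> \<open>Modulo \<open>y b q\<close> and \<open>y b r\<close>, \<open>P1\<close>
      reduces to \<open>e * y b p\<close>, which is regular. A swap then makes \<open>y b r\<close>
      regular modulo \<open>P1\<close> and \<open>y b q\<close>.\<close>
    have "nzd_mod (insert (y b q) J) e"
      unfolding y_def by (rule nzd_insert_pvar[OF fresh_b e_nzd e_free(1)])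
    then have e': "nzd_mod (insert (y b r) (insert (y b q) J)) e"
      unfolding y_def by (rule nzd_insert_pvar[rotated]) (use col fresh_b e_free in auto)
    have "nzd_mod (insert (y b r) (insert (y b q) J)) P1"
      by (rule nzd_linear[OF _ e' P1_def[unfolded y_def[of b p]]])
         (use col neq fresh_b e_free in \<open>auto simp: y_def\<close>)
    then have "nzd_mod (insert P1 (insert (y b q) J)) (y b r)"
      by (rule nzd_mod_swap[rotated]) (use col fresh_b in \<open>auto simp: y_def intro: nzd_fresh\<close>)
    then have "nzd_mod (insert (y b q) (insert P1 J)) (y b r)" by (simp add: insert_commute)
    moreover have "nzd_mod (insert (y b q) (insert P1 J)) (y w r)"
      unfolding y_def by (rule nzd_fresh) (use fresh_w P1_free neq in auto)
    ultimately show "nzd_mod (insert (y b q) (insert P1 J)) (y b r * y w r)" by (rule nzd_mod_mult)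
  qed (use neq col in \<open>auto simp: y_def\<close>)

  let ?L = "ideal_gen (lss_gens 3 E) :: ('v \<times> nat, 'k) mpoly set"
  let ?Q = "ideal_gen (insert P2 (insert P1 J))"
  have gens: "lss_gens 3 E = insert (lss_poly 3 a w) (insert (lss_poly 3 b w) (insert (lss_poly 3 u b) J))"
    by (subst lss_gens_del[of _ E w], subst lss_gens_del[of _ "del E w" b])
       (simp add: nbrs_w nbrs_b J_def F_def)
  have aw: "lss_poly 3 a w = y a p * y w p + y a q * y w q + y a r * y w r"
    and bw: "lss_poly 3 b w = y b p * y w p + y b q * y w q + y b r * y w r"
    and ub: "lss_poly 3 u b = y u p * y b p + y u q * y b q + y u r * y b r"
    unfolding y_def by (rule lss_poly_3[OF c])+

  define \<phi> where "\<phi> = (\<lambda>z. pvar z)((b, p) := y a p * y b p,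
      (b, q) := y a q * y b p + y a p * y b q, (b, r) := y a r * y b p + y a p * y b r,
      (w, p) := - (y a q * y w q + y a r * y w r), (w, q) := y a p * y w q, (w, r) := y a p * y w r)"
  define \<psi> where "\<psi> = (\<lambda>z. pvar z)((b, p) := y a p * y b p,
      (b, q) := y a p * y b q - y a q * y b p, (b, r) := y a p * y b r - y a r * y b p)"
  \<comment> \<open>The exponent of \<open>y a p\<close> in the composite substitution: 2 on the
    coordinates of \<open>b\<close>, 1 on those of \<open>w\<close>, where \<open>(w, p)\<close>
    agrees only modulo the edge \<open>{a, w}\<close>. Indices other than the three coordinates are
    fixed and get weight 0.\<close>
  define wt :: "'v \<times> nat \<Rightarrow> nat" where
    "wt = (\<lambda>(i, l). if l \<notin> {p, q, r} then 0 else if i = b then 2 else if i = w then 1 else 0)"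

  have fixed: "msubst \<phi> x = x" "msubst \<psi> x = x" if xJ: "x \<in> J" for x
  proof -
    obtain i j where x: "x = lss_poly 3 i j" "{i, j} \<in> F"
      using xJ unfolding J_def lss_gens_def by blast
    then have "i \<notin> {b, w}" "j \<notin> {b, w}" using F_no by auto
    then show "msubst \<phi> x = x" "msubst \<psi> x = x"
      unfolding x(1) by (auto intro!: msubst_lss_poly simp: \<phi>_def \<psi>_def)
  qed
  have y_other: "\<phi> (i, l) = y i l" "\<psi> (i, l) = y i l" if "i \<noteq> b" "i \<noteq> w" for i l
    using that by (auto simp: \<phi>_def \<psi>_def y_def)
  have \<phi>: "\<phi> (b, p) = y a p * y b p" "\<phi> (b, q) = y a q * y b p + y a p * y b q"
    "\<phi> (b, r) = y a r * y b p + y a p * y b r" "\<phi> (w, p) = - (y a q * y w q + y a r * y w r)"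
    "\<phi> (w, q) = y a p * y w q" "\<phi> (w, r) = y a p * y w r"
    using col neq by (auto simp: \<phi>_def)
  have \<psi>: "\<psi> (b, p) = y a p * y b p" "\<psi> (b, q) = y a p * y b q - y a q * y b p"
    "\<psi> (b, r) = y a p * y b r - y a r * y b p" "\<psi> (w, l) = y w l" for l
    using col neq by (auto simp: \<psi>_def y_def)
  have msubst_y: "msubst v (y i l) = v (i, l)" for v :: "'v \<times> nat \<Rightarrow> ('v \<times> nat, 'k) mpoly" and i l
    unfolding y_def by simp
  have in_Q: "P1 \<in> ?Q" "P2 \<in> ?Q" "x \<in> J \<Longrightarrow> x \<in> ?Q" for x by (auto intro: ring_ideal.span_base)
  have in_L: "lss_poly 3 a w \<in> ?L" "lss_poly 3 b w \<in> ?L" "lss_poly 3 u b \<in> ?L" "x \<in> J \<Longrightarrow> x \<in> ?L" for x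
    by (auto simp: gens intro: ring_ideal.span_base)
  have to_Q: "msubst \<phi> g \<in> ?Q" if "g \<in> ?L" for g
  proof (rule hom_ideal_gen[OF msubst_hom _ that])
    fix x :: "('v \<times> nat, 'k) mpoly" assume "x \<in> lss_gens 3 E"
    then consider "x = lss_poly 3 a w" | "x = lss_poly 3 b w" | "x = lss_poly 3 u b" | "x \<in> J"
      unfolding gens by blast
    then show "msubst \<phi> x \<in> ?Q"
    proof cases
      case 1
      have "msubst \<phi> x = 0"
        unfolding 1 aw using neq by (simp add: msubst_y y_other \<phi> algebra_simps)
      then show ?thesis by (simp add: ring_ideal.span_zero)
    next
      case 2
      have "msubst \<phi> x = y a p * y a p * P2"
        unfolding 2 bw P2_def using neq by (simp add: msubst_y y_other \<phi> algebra_simps)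
      then show ?thesis using in_Q ideal_gen_mult_left by metis
    next
      case 3
      have "msubst \<phi> x = P1"
        unfolding 3 ub P1_def e using neq by (simp add: msubst_y y_other \<phi> algebra_simps)
      then show ?thesis using in_Q by metis
    qed (simp add: fixed in_Q)
  qed
  have to_L: "msubst \<psi> g \<in> ?L" if "g \<in> ?Q" for g
  proof (rule hom_ideal_gen[OF msubst_hom _ that])
    fix x assume "x \<in> insert P2 (insert P1 J)"
    then consider "x = P1" | "x = P2" | "x \<in> J" by blast
    then show "msubst \<psi> x \<in> ?L"
    proof cases
      case 1
      have "msubst \<psi> x = y a p * y a p * lss_poly 3 u b"
        unfolding 1 ub P1_def e using neq by (simp add: msubst_y y_other \<psi> algebra_simps)
      then show ?thesis using in_L ideal_gen_mult_left by metis
    next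
      case 2
      have "msubst \<psi> x = y a p * lss_poly 3 b w - y b p * lss_poly 3 a w"
        unfolding 2 bw aw P2_def using neq by (simp add: msubst_y y_other \<psi> algebra_simps)
      then show ?thesis using in_L ring_ideal.span_diff ideal_gen_mult_left by metis
    qed (simp add: fixed in_L)
  qed
  have round_trip: "msubst \<psi> (msubst \<phi> g) - msubst (\<lambda>z. y a p ^ wt z * pvar z) g \<in> ?L" for g
  proof (rule hom_congruent[OF hom_comp[OF msubst_hom msubst_hom] msubst_hom])
    fix x :: "'v \<times> nat"
    obtain i l where x: "x = (i, l)" by (cases x)
    consider "x = (b, p)" | "x = (b, q)" | "x = (b, r)" | "x = (w, p)" | "x = (w, q)" | "x = (w, r)"
      | "x \<notin> {(b, p), (b, q), (b, r), (w, p), (w, q), (w, r)}" by blast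
    then have "msubst \<psi> (msubst \<phi> (pvar x)) - y a p ^ wt x * pvar x = 0 \<or>
        msubst \<psi> (msubst \<phi> (pvar x)) - y a p ^ wt x * pvar x = - lss_poly 3 a w"
    proof cases
      case 7
      then have "wt x = 0" "\<phi> x = pvar x" "\<psi> x = pvar x" by (auto simp: wt_def x \<phi>_def \<psi>_def)
      then show ?thesis by simp
    qed (use neq in \<open>simp_all add: \<phi> \<psi> msubst_y y_other wt_def aw algebra_simps power2_eq_square flip: y_def\<close>)
    then show "msubst \<psi> (msubst \<phi> (pvar x)) - msubst (\<lambda>z. y a p ^ wt z * pvar z) (pvar x) \<in> ?L"
      using in_L(1) ring_ideal.span_neg ring_ideal.span_zero by fastforce
  qed simp

  \<comment> \<open>\<open>wt\<close> is constant on the three coordinates of each vertex, so every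
    edge polynomial is homogeneous.\<close>
  have hom: "homogeneous wt (lss_gens 3 E :: ('v \<times> nat, 'k) mpoly set)"
    unfolding homogeneous_def
  proof
    fix x :: "('v \<times> nat, 'k) mpoly" assume "x \<in> lss_gens 3 E"
    then obtain i j where x: "x = lss_poly 3 i j" unfolding lss_gens_def by blast
    have "wt (i, l) = wt (i, p)" if "l \<in> {1..3}" for i l
    proof -
      have "{1..3} = {p, q, r}" using c unfolding colours_def by blast
      then have "l \<in> {p, q, r}" using that by blast
      then show ?thesis unfolding wt_def by auto
    qed
    then have "grade wt (lss_poly 3 i j) = monom (lss_poly 3 i j) (wt (i, p) + wt (j, p))"
      by (intro grade_lss_poly)
    then show "\<exists>n. grade wt x = monom x n" unfolding x by blast
  qed
  have a_nzd: "nzd_mod (lss_gens 3 E) (y a p)"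
    unfolding y_def
  proof (rule vertex_nzd[OF E _ _ c])
    show "prime_gen (lss_gens 3 (del E a) :: ('v \<times> nat, 'k) mpoly set)"
      "prime_gen (lss_gens 3 (del (del E a) t) :: ('v \<times> nat, 'k) mpoly set)" for t
      by (rule prime[OF del_psubset[OF wa']],
          rule prime[OF subset_psubset_trans[OF del_subset del_psubset[OF wa']]])
  qed
  \<comment> \<open>Applying \<psi> brings back a rescaled \<open>g\<close>, and the factors
    \<open>y a p\<close> cancel because \<open>y a p\<close> is regular of weight 0.\<close>
  have from_Q: "g \<in> ?L" if "msubst \<phi> g \<in> ?Q" for g
  proof (rule homogeneous_rescale[OF hom _ a_nzd])
    show "grade wt (y a p) = [:y a p:]" using neq by (simp add: y_def wt_def monom_0)
    show "msubst (\<lambda>z. y a p ^ wt z * pvar z) g \<in> ?L"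
      using ideal_gen_cong[OF round_trip[of g]] to_L[OF that] by blast
  qed
  show ?thesis
    unfolding prime_gen_def
  proof (intro conjI allI impI)
    show "1 \<notin> ?L"
      by (rule notin_lss_ideal[of _ "{}"]) auto
    fix g h assume "g * h \<in> ?L"
    from to_Q[OF this] have "msubst \<phi> g * msubst \<phi> h \<in> ?Q" by simp
    then show "g \<in> ?L \<or> h \<in> ?L" using from_Q by (auto simp: prime_gen_mult[OF Q2])
  qed
qed

lemma paths_cycles_nbr: "paths_cycles E \<Longrightarrow> E \<noteq> {} \<Longrightarrow> \<exists>w a. {w, a} \<in> E"
  unfolding paths_cycles_def card_2_iff by fastforce

lemma lss_prime_3:
  assumes "paths_cycles E" "square_free E"
  shows "prime_gen (lss_gens 3 E :: ('v \<times> nat, 'k::field) mpoly set)"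
proof -
  have "finite E" using assms(1) by (simp add: paths_cycles_def)
  then show ?thesis using assms
  proof (induction E rule: finite_psubset_induct)
    case (psubset E)
    have prime: "prime_gen (lss_gens 3 F :: ('v \<times> nat, 'k) mpoly set)" if "F \<subset> E" for F
      using psubset that paths_cycles_mono square_free_mono by blast
    show ?case
    proof (cases "\<exists>w u. {a. {w, a} \<in> E} = {u}")
      case True
      then show ?thesis using degree_one_prime[OF psubset.prems(1) _ prime] by blast
    next
      case False
      show ?thesis
      proof (cases "E = {}")
        case True
        then show ?thesis using prime_gen_empty by (simp add: lss_gens_def)
      next
        case nonempty: False
        have two: "\<exists>b. {w, b} \<in> E \<and> b \<noteq> a" if "{w, a} \<in> E" for w a
          using False that by blast
        obtain w a where wa: "{w, a} \<in> E" using paths_cycles_nbr[OF psubset.prems(1) nonempty] by blast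
        obtain b where wb: "{w, b} \<in> E" "b \<noteq> a" using two[OF wa] by blast
        then have "{b, w} \<in> E" by (simp add: insert_commute)
        then obtain u where "{b, u} \<in> E" "u \<noteq> w" using two by blast
        then show ?thesis
          using cycle_prime[OF psubset.prems wa wb(1) _ _ _ prime] wb(2) by blast
      qed
    qed
  qed
qed

section \<open>Regular sequences in dimension two\<close>

lemma lss_poly_2:
  "{1..2} = {l, l'} \<Longrightarrow> l \<noteq> l' \<Longrightarrow> lss_poly 2 i j = pvar (i, l) * pvar (j, l) + pvar (i, l') * pvar (j, l')"
  unfolding lss_poly_def by simp

text \<open>Modulo coordinate \<open>l\<close> of \<open>u\<close>, the edge to \<open>t\<close>
  becomes the product of the \<open>l'\<close> coordinates of \<open>t\<close> and \<open>u\<close>.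
  Induction along the path therefore exchanges the coordinates at every step.\<close>

lemma end_vertex_nzd_2:
  assumes "paths_cycles F" "{1..2} = {l, l'}" "l \<noteq> l'"
    and "\<And>t t'. {u, t} \<in> F \<Longrightarrow> {u, t'} \<in> F \<Longrightarrow> t = t'"
  shows "nzd_mod (lss_gens 2 F :: ('v \<times> nat, 'k::field) mpoly set) (pvar (u, l))"
proof -
  have "finite F" using assms(1) by (simp add: paths_cycles_def)
  then show ?thesis using assms
  proof (induction F arbitrary: u l l' rule: finite_psubset_induct)
    case (psubset F)
    note F = psubset.prems(1) and ll = psubset.prems(2,3) and one = psubset.prems(4)
    let ?B = "lss_gens 2 (del F u) :: ('v \<times> nat, 'k) mpoly set"
    have fresh: "fresh (u, m) ?B" for m by (rule fresh_del)
    have u: "nzd_mod ?B (pvar (u, l))" by (rule nzd_fresh[OF fresh])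
    have gens: "lss_gens 2 F = ?B \<union> (\<lambda>a. lss_poly 2 a u) ` {a. {u, a} \<in> F}" by (rule lss_gens_del)
    show ?case
    proof (cases "\<exists>t. {u, t} \<in> F")
      case False
      then show ?thesis using u gens by simp
    next
      case True
      then obtain t where t: "{u, t} \<in> F" by blast
      then have nbr: "{t. {u, t} \<in> F} = {t}" using one by blast
      have "t \<noteq> u" using paths_cycles_neq[OF F t] by blast
      have "nzd_mod ?B (pvar (t, l'))"
      proof (rule psubset.IH[OF del_psubset[OF t] paths_cycles_mono[OF F del_subset], of l' l])
        show "{1..2} = {l', l}" using ll by blast
        show "l' \<noteq> l" using ll by blast
        fix x x' assume "{t, x} \<in> del F u" "{t, x'} \<in> del F u"
        moreover have "{t, u} \<in> F" using t by (simp add: insert_commute)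
        ultimately show "x = x'" using paths_cycles_three[OF F, of t x x' u] by (auto simp: del_def)
      qed
      then have "nzd_mod (insert (pvar (u, l)) ?B) (pvar (t, l'))"
        by (rule nzd_insert_pvar[OF fresh]) (use \<open>t \<noteq> u\<close> in auto)
      then have "nzd_mod (insert (pvar (u, l)) ?B) (lss_poly 2 t u)"
        by (rule nzd_linear[of "(u, l')", rotated, where d = "pvar (t, l) * pvar (u, l)"])
           (use ll \<open>t \<noteq> u\<close> fresh in \<open>auto simp: lss_poly_2[OF ll]\<close>)
      from nzd_mod_swap[OF u this] show ?thesis using gens nbr by simp
    qed
  qed
qed

text \<open>The form of top weight takes the place of a leading coefficient, and homogeneity of
  \<open>B\<close> that of freshness.\<close>

lemma nzd_by_top_degree:
  assumes "homogeneous w B" "nzd_mod B (coeff (grade w f) d)" "degree (grade w f) \<le> d"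
  shows "nzd_mod B f"
  unfolding nzd_mod_def
proof (intro allI impI)
  fix g assume "f * g \<in> ideal_gen B"
  then have "coeff (grade w f * grade w g) n \<in> ideal_gen B" for n
    using homogeneous_coeff[OF assms(1), of "f * g"] by simp
  then have "coeff (grade w g) n \<in> ideal_gen B" for n
    by (rule coeff_nzd_lead[OF assms(2,3), of 0]) simp
  from poly_in_ideal_gen[OF this, of 1] show "g \<in> ideal_gen B" by (simp add: poly_grade_1)
qed

text \<open>A walk that never turns back repeats a vertex at some time. The first vertex met again
  is the starting one, for an inner vertex would acquire a third neighbour.\<close>

lemma closed_walk_cycle:
  assumes E: "paths_cycles E" "E \<noteq> {}"
    and two: "\<And>w a. {w, a} \<in> E \<Longrightarrow> \<exists>b. {w, b} \<in> E \<and> b \<noteq> a"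
  shows "\<exists>n v. n \<ge> 3 \<and> inj_on v {..<n} \<and> (\<forall>i<n. {v i, v (Suc i mod n)} \<in> E)"
proof -
  obtain w a where wa: "{w, a} \<in> E" using paths_cycles_nbr[OF E] by blast
  \<comment> \<open>The state is a pair of consecutive vertices, so that the next vertex can avoid
    the previous one.\<close>
  define step where "step = (\<lambda>(p, q). (q, SOME b. {q, b} \<in> E \<and> b \<noteq> p))"
  define f where "f k = (step ^^ k) (w, a)" for k
  define v where "v k = fst (f k)" for k
  have f_Suc: "f (Suc k) = step (f k)" for k by (simp add: f_def)
  then have snd_f: "snd (f k) = v (Suc k)" for k by (simp add: v_def step_def split: prod.split)
  have edge: "{v k, v (Suc k)} \<in> E" and turn: "v (Suc (Suc k)) \<noteq> v k" for k
  proof -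
    have step: "{v (Suc k), v (Suc (Suc k))} \<in> E \<and> v (Suc (Suc k)) \<noteq> v k" if "{v k, v (Suc k)} \<in> E" for k
    proof -
      have "{v (Suc k), v k} \<in> E" using that by (simp add: insert_commute)
      then have ex: "\<exists>b. {v (Suc k), b} \<in> E \<and> b \<noteq> v k" by (rule two)
      have "v (Suc (Suc k)) = (SOME b. {v (Suc k), b} \<in> E \<and> b \<noteq> v k)"
        using snd_f[of "Suc k"] snd_f[of k] by (simp add: f_Suc step_def v_def split: prod.splits)
      with someI_ex[OF ex] show ?thesis by simp
    qed
    show edge: "{v k, v (Suc k)} \<in> E" for k
    proof (induction k)
      case 0
      then show ?case using wa snd_f[of 0] by (simp add: v_def f_def)
    next
      case (Suc k)
      then show ?case using step by blast
    qed
    show "v (Suc (Suc k)) \<noteq> v k" using step[OF edge] by blast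
  qed
  have "finite E" and card2: "\<forall>e\<in>E. card e = 2" using E(1) by (simp_all add: paths_cycles_def)
  then have "finite (\<Union>E)" by (intro finite_Union) (auto intro: card_ge_0_finite)
  moreover have "range v \<subseteq> \<Union>E" using edge by blast
  ultimately have "finite (range v)" by (rule finite_subset[rotated])
  then have "\<not> inj v" using finite_imageD infinite_UNIV_nat by blast
  then have ex: "\<exists>n. \<exists>j<n. v n = v j" unfolding inj_def by (metis linorder_neqE_nat)
  define n where "n = (LEAST n. \<exists>j<n. v n = v j)"
  obtain j where j: "j < n" "v n = v j" using LeastI_ex[OF ex] unfolding n_def by blast
  have least: "v m \<noteq> v i" if "i < m" "m < n" for i m
    using not_less_Least[of m] that unfolding n_def by blast
  then have inj: "inj_on v {..<n}" unfolding inj_on_def by (metis lessThan_iff linorder_neqE_nat)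
  obtain m where m: "n = Suc m" using j(1) by (cases n) auto
  have "j = 0"
  proof (rule ccontr)
    assume "j \<noteq> 0"
    then obtain i where i: "j = Suc i" by (cases j) auto
    have "{v j, v i} \<in> E" "{v j, v (Suc j)} \<in> E" "{v j, v m} \<in> E"
      using edge[of i] edge[of j] edge[of m] j(2) i m by (simp_all add: insert_commute)
    then have "v i = v (Suc j) \<or> v i = v m \<or> v (Suc j) = v m"
      by (rule paths_cycles_three[OF E(1)])
    moreover have "v (Suc j) \<noteq> v i" using turn[of i] i by simp
    moreover have "v i \<noteq> v m" using least[of i m] i j(1) m by simp
    \<comment> \<open>Then either \<open>n = j + 2\<close> and the walk has turned back, or
      \<open>n = j + 1\<close> and an edge is a loop.\<close>
    ultimately have eq: "v (Suc j) = v m" by metis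
    have "Suc j < n \<or> Suc j = n" using j(1) by auto
    then show False
    proof
      assume "Suc j < n"
      then have "Suc j = m" using least[of "Suc j" m] eq m by (cases "Suc j < m") auto
      then show False using turn[of j] j(2) m by simp
    next
      assume "Suc j = n"
      then show False using eq m paths_cycles_neq[OF E(1) edge[of m]] by simp
    qed
  qed
  have "n \<noteq> 1" using j(2) \<open>j = 0\<close> paths_cycles_neq[OF E(1) edge[of 0]] by auto
  moreover have "n \<noteq> 2" using turn[of 0] j(2) \<open>j = 0\<close> by (auto simp: numeral_2_eq_2)
  ultimately have "n \<ge> 3" using j(1) by linarith
  moreover have "{v i, v (Suc i mod n)} \<in> E" if "i < n" for i
  proof (cases "Suc i < n")
    case True
    then show ?thesis using edge[of i] by simp
  next
    case False
    then have "Suc i = n" using that by simp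
    then show ?thesis using edge[of i] j(2) \<open>j = 0\<close> by simp
  qed
  ultimately show ?thesis using inj by blast
qed

lemma colours_2: "{1..2} = {1, 2::nat}" "1 \<noteq> (2::nat)"
  by auto

lemma grade_lss_poly_2:
  "grade w (lss_poly 2 i j) = monom (pvar (i, 1) * pvar (j, 1)) (w (i, 1) + w (j, 1)) +
     monom (pvar (i, 2) * pvar (j, 2)) (w (i, 2) + w (j, 2))"
  unfolding lss_poly_2[OF colours_2] by (simp only: grade_simps grade_pvar mult_monom)

lemma odd_cycle_edge_nzd:
  assumes E: "paths_cycles E" and n: "odd n" "n \<ge> 3" and inj: "inj_on v {..<n}"
    and cyc: "\<And>i. i < n \<Longrightarrow> {v i, v (Suc i mod n)} \<in> E"
  shows "nzd_mod (lss_gens 2 (E - {{v (n - 1), v 0}}) :: ('v \<times> nat, 'k::field) mpoly set)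
           (lss_poly 2 (v (n - 1)) (v 0))"
proof -
  let ?F = "E - {{v (n - 1), v 0}}"
  let ?B = "lss_gens 2 ?F :: ('v \<times> nat, 'k) mpoly set"
  have F: "paths_cycles ?F" using paths_cycles_mono[OF E] by blast
  have v_eq: "v i = v j \<longleftrightarrow> i = j" if "i < n" "j < n" for i j
    using inj_onD[OF inj] that by auto
  \<comment> \<open>Unit weights alternate between the two coordinates along the cycle, so both
    terms of a path edge have weight 1. As \<open>n\<close> is odd, \<open>n - 1\<close> and
    \<open>0\<close> are both even, and the terms of the closing edge have weights 2 and 0.\<close>
  define wt :: "'v \<times> nat \<Rightarrow> nat" where
    "wt = (\<lambda>(x, l). of_bool (\<exists>i<n. x = v i \<and> l = (if even i then 1 else 2)))"
  have wt: "wt (v i, 1) = of_bool (even i)" "wt (v i, 2) = of_bool (odd i)" if "i < n" for i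
    using that v_eq by (auto simp: wt_def)
  have wt0: "wt (x, l) = 0" if "x \<notin> v ` {..<n}" for x l using that by (auto simp: wt_def)
  have last: "{v (n - 1), v 0} \<in> E" using cyc[of "n - 1"] n(2) by simp
  have succ: "{v i, v (Suc i)} \<in> E" if "Suc i < n" for i using cyc[of i] that by simp
  \<comment> \<open>A vertex of the cycle has both its neighbours on the cycle, so no edge leaves
    it, and apart from the closing edge only consecutive indices are joined.\<close>
  have nbr: "\<exists>j<n. x = v j \<and> (j = Suc i \<or> i = Suc j)" if i: "i < n" and x: "{v i, x} \<in> ?F" for i x
  proof -
    obtain i1 i2 where i12: "i1 < n" "i2 < n" "i1 \<noteq> i2" "{v i, v i1} \<in> E" "{v i, v i2} \<in> E"
      and adj: "\<And>j. j \<in> {i1, i2} \<Longrightarrow> j = Suc i \<or> i = Suc j \<or> {v i, v j} = {v (n - 1), v 0}"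
    proof (cases "i = 0")
      case True
      then show ?thesis
        by (intro that[of 1 "n - 1"]) (use succ[of 0] last n(2) in \<open>auto simp: insert_commute\<close>)
    next
      case False
      then obtain i' where i': "i = Suc i'" by (cases i) auto
      show ?thesis
      proof (cases "Suc i < n")
        case True
        then show ?thesis
          using that[of i' "Suc i"] succ[of i] succ[of i'] i' by (auto simp: insert_commute)
      next
        case False
        then have "i = n - 1" using i by simp
        then show ?thesis
          by (intro that[of i' 0]) (use succ[of i'] last i' n(2) in \<open>auto simp: insert_commute\<close>)
      qed
    qed
    have "v i1 \<noteq> v i2" using i12 v_eq by simp
    then have "x = v i1 \<or> x = v i2" using paths_cycles_three[OF E i12(4,5), of x] x by auto
    then show ?thesis using adj x i12 by blast
  qed
  have "homogeneous wt ?B"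
    unfolding homogeneous_def
  proof
    fix b :: "('v \<times> nat, 'k) mpoly" assume "b \<in> ?B"
    then obtain x y where b: "b = lss_poly 2 x y" and xy: "{x, y} \<in> ?F" unfolding lss_gens_def by blast
    have "wt (x, 1) + wt (y, 1) = wt (x, 2) + wt (y, 2)"
    proof (cases "x \<in> v ` {..<n}")
      case True
      then obtain i where "i < n" "x = v i" by blast
      then obtain j where "j < n" "y = v j" "j = Suc i \<or> i = Suc j" using nbr xy by blast
      then show ?thesis using \<open>i < n\<close> \<open>x = v i\<close> by (auto simp: wt[unfolded One_nat_def])
    next
      case False
      have "y \<notin> v ` {..<n}"
      proof
        assume "y \<in> v ` {..<n}"
        then obtain i where i: "i < n" "y = v i" by blast
        moreover have "{y, x} \<in> ?F" using xy by (simp only: insert_commute)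
        ultimately show False using nbr[of i x] False by auto
      qed
      then show ?thesis using False by (simp add: wt0)
    qed
    then have "grade wt b = monom b (wt (x, 2) + wt (y, 2))"
      by (simp only: b grade_lss_poly_2 add_monom) (simp only: lss_poly_2[OF colours_2])
    then show "\<exists>m. grade wt b = monom b m" by blast
  qed
  then show ?thesis
  proof (rule nzd_by_top_degree[of _ _ _ 2])
    have grade: "grade wt (lss_poly 2 (v (n - 1)) (v 0)) =
        monom (pvar (v (n - 1), 1) * pvar (v 0, 1) :: ('v \<times> nat, 'k) mpoly) 2 +
        monom (pvar (v (n - 1), 2) * pvar (v 0, 2)) 0"
    proof -
      have "wt (v (n - 1), 1) = 1" "wt (v (n - 1), 2) = 0" "wt (v 0, 1) = 1" "wt (v 0, 2) = 0"
        using wt[of "n - 1"] wt[of 0] n by simp_all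
      then show ?thesis by (simp only: grade_lss_poly_2 one_add_one add_0)
    qed
    \<comment> \<open>Without the closing edge each of its ends has at most one neighbour.\<close>
    have "nzd_mod ?B (pvar (v (n - 1), 1))"
    proof (rule end_vertex_nzd_2[OF F, of 1 2])
      fix t t' assume "{v (n - 1), t} \<in> ?F" "{v (n - 1), t'} \<in> ?F"
      then show "t = t'" using paths_cycles_three[OF E last, of t t'] by auto
    qed auto
    moreover have "nzd_mod ?B (pvar (v 0, 1))"
    proof (rule end_vertex_nzd_2[OF F, of 1 2])
      fix t t' assume tt: "{v 0, t} \<in> ?F" "{v 0, t'} \<in> ?F"
      have "{v 0, v (n - 1)} \<in> E" using last by (simp add: insert_commute)
      then show "t = t'" using paths_cycles_three[OF E, of "v 0" "v (n - 1)" t t'] tt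
        by (auto simp: insert_commute)
    qed auto
    ultimately show "nzd_mod ?B (coeff (grade wt (lss_poly 2 (v (n - 1)) (v 0))) 2)"
      unfolding grade by (simp add: nzd_mod_mult)
    show "degree (grade wt (lss_poly 2 (v (n - 1)) (v 0) :: ('v \<times> nat, 'k) mpoly)) \<le> 2"
      unfolding grade by (rule degree_add_le) (simp_all add: degree_monom_le order_trans[OF degree_monom_le])
  qed
qed

definition no_even_cycle :: "'v set set \<Rightarrow> bool" where
  "no_even_cycle E \<longleftrightarrow> (\<forall>m\<ge>2. \<nexists>v. inj_on v {..<2 * m} \<and> (\<forall>i<2 * m. {v i, v (Suc i mod (2 * m))} \<in> E))"

lemma no_even_cycle_mono: "no_even_cycle E \<Longrightarrow> F \<subseteq> E \<Longrightarrow> no_even_cycle F"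
  unfolding no_even_cycle_def by (meson subsetD)

text \<open>The regular sequence is built from its end: an edge at a vertex of degree one, or else
  the closing edge of an odd cycle, can always come last.\<close>

lemma lss_last_edge_2:
  assumes E: "paths_cycles E" "no_even_cycle E" "E \<noteq> {}"
  shows "\<exists>i j. {i, j} \<in> E \<and>
    nzd_mod (lss_gens 2 (E - {{i, j}}) :: ('v \<times> nat, 'k::field) mpoly set) (lss_poly 2 i j)"
proof (cases "\<exists>w u. {a. {w, a} \<in> E} = {u}")
  case True
  then obtain w u where nbr: "{a. {w, a} \<in> E} = {u}" by blast
  then have wu: "{w, u} \<in> E" by blast
  then have uw: "{u, w} \<in> E" "u \<noteq> w" using paths_cycles_neq[OF E(1)] by (auto simp: insert_commute)
  let ?B = "lss_gens 2 (E - {{u, w}}) :: ('v \<times> nat, 'k) mpoly set"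
  have fresh: "fresh (w, l) ?B" for l
  proof (rule fresh_lss_gens)
    fix e assume e: "e \<in> E - {{u, w}}"
    show "w \<notin> e"
    proof
      assume "w \<in> e"
      have "card e = 2" using e E(1) by (simp add: paths_cycles_def)
      then obtain x where "e = {w, x}" using \<open>w \<in> e\<close> unfolding card_2_iff by blast
      then have "{w, x} \<in> E" using e by simp
      then have "x = u" using nbr by blast
      then have "e = {u, w}" using \<open>e = {w, x}\<close> by (simp only: insert_commute)
      then show False using e by simp
    qed
  qed
  have "nzd_mod ?B (pvar (u, 1))"
  proof (rule end_vertex_nzd_2[of _ 1 2])
    fix t t' assume "{u, t} \<in> E - {{u, w}}" "{u, t'} \<in> E - {{u, w}}"
    then show "t = t'" using paths_cycles_three[OF E(1) uw(1), of t t'] by auto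
  qed (use paths_cycles_mono[OF E(1)] in auto)
  then have "nzd_mod ?B (lss_poly 2 u w)"
    by (rule nzd_linear[of "(w, 1)", rotated, where d = "pvar (u, 2) * pvar (w, 2)"])
       (use uw fresh in \<open>auto simp: lss_poly_2[OF colours_2]\<close>)
  then show ?thesis using uw by blast
next
  case False
  have "\<exists>b. {w, b} \<in> E \<and> b \<noteq> a" if "{w, a} \<in> E" for w a using False that by blast
  from closed_walk_cycle[OF E(1,3) this] obtain n v where n: "n \<ge> 3" and inj: "inj_on v {..<n}"
    and cyc: "\<And>i. i < n \<Longrightarrow> {v i, v (Suc i mod n)} \<in> E" by blast
  have "odd n"
  proof
    assume "even n"
    then obtain m where "n = 2 * m" by blast
    moreover have "m \<ge> 2" using n calculation by linarith
    ultimately show False using E(2) inj cyc unfolding no_even_cycle_def by blast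
  qed
  moreover have "{v (n - 1), v 0} \<in> E" using cyc[of "n - 1"] n by simp
  ultimately show ?thesis using odd_cycle_edge_nzd[OF E(1) _ n inj cyc] by blast
qed

lemma lss_regular_order_2:
  assumes "paths_cycles E" "no_even_cycle E"
  shows "\<exists>fs. set fs = (lss_gens 2 E :: ('v \<times> nat, 'k::field) mpoly set) \<and>
    (\<forall>n<length fs. nzd_mod (set (take n fs)) (fs ! n))"
proof -
  have "finite E" using assms(1) by (simp add: paths_cycles_def)
  then show ?thesis using assms
  proof (induction E rule: finite_psubset_induct)
    case (psubset E)
    show ?case
    proof (cases "E = {}")
      case True
      then show ?thesis by (intro exI[of _ "[]"]) (simp add: lss_gens_def)
    next
      case False
      obtain i j where ij: "{i, j} \<in> E"
        and nzd: "nzd_mod (lss_gens 2 (E - {{i, j}}) :: ('v \<times> nat, 'k) mpoly set) (lss_poly 2 i j)"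
        using lss_last_edge_2[OF psubset.prems False] by blast
      let ?F = "E - {{i, j}}"
      have "?F \<subset> E" using ij by blast
      then obtain fs where fs: "set fs = (lss_gens 2 ?F :: ('v \<times> nat, 'k) mpoly set)"
        "\<And>n. n < length fs \<Longrightarrow> nzd_mod (set (take n fs)) (fs ! n)"
        using psubset.IH[of ?F] paths_cycles_mono[OF psubset.prems(1)] no_even_cycle_mono[OF psubset.prems(2)]
        by (metis psubset_imp_subset)
      have "E = insert {i, j} ?F" using ij by blast
      then have "lss_gens 2 E = insert (lss_poly 2 i j) (lss_gens 2 ?F :: ('v \<times> nat, 'k) mpoly set)"
        by (metis lss_gens_insert)
      then have "set (fs @ [lss_poly 2 i j]) = lss_gens 2 E" using fs(1) by simp
      moreover have "nzd_mod (set (take n (fs @ [lss_poly 2 i j]))) ((fs @ [lss_poly 2 i j]) ! n)"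
        if "n < length (fs @ [lss_poly 2 i j])" for n
        using that fs nzd by (cases "n = length fs") (auto simp: nth_append)
      ultimately show ?thesis by blast
    qed
  qed
qed

section \<open>Ideals of \<open>k[X]\<close>\<close>

lemma carrier_mpoly_ring: "p \<in> carrier (mpoly_ring k X) \<longleftrightarrow> indets p \<subseteq> X"
  by (simp add: mpoly_ring_def)

lemma mpoly_ring_closed [simp]:
  fixes p q :: "('x, 'k::comm_ring_1) mpoly" and k :: "'k itself"
  shows "p \<in> carrier (mpoly_ring k X) \<Longrightarrow> q \<in> carrier (mpoly_ring k X) \<Longrightarrow> p + q \<in> carrier (mpoly_ring k X)"
    and "p \<in> carrier (mpoly_ring k X) \<Longrightarrow> q \<in> carrier (mpoly_ring k X) \<Longrightarrow> p * q \<in> carrier (mpoly_ring k X)"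
    and "0 \<in> carrier (mpoly_ring k X)" "1 \<in> carrier (mpoly_ring k X)"
    and "p \<in> carrier (mpoly_ring k X) \<Longrightarrow> - p \<in> carrier (mpoly_ring k X)"
    and "p \<in> carrier (mpoly_ring k X) \<Longrightarrow> q \<in> carrier (mpoly_ring k X) \<Longrightarrow> p - q \<in> carrier (mpoly_ring k X)"
    and "x \<in> X \<Longrightarrow> pvar x \<in> carrier (mpoly_ring k X)"
    and "mconst c \<in> carrier (mpoly_ring k X)"
proof -
  interpret cring "mpoly_ring k X" by (rule cring_mpoly_ring)
  show add: "p + q \<in> carrier (mpoly_ring k X)"
    if "p \<in> carrier (mpoly_ring k X)" "q \<in> carrier (mpoly_ring k X)" for p q
    using a_closed[OF that] by (simp add: mpoly_ring_def)
  show mult: "p * q \<in> carrier (mpoly_ring k X)"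
    if "p \<in> carrier (mpoly_ring k X)" "q \<in> carrier (mpoly_ring k X)" for p q
    using m_closed[OF that] by (simp add: mpoly_ring_def)
  show "0 \<in> carrier (mpoly_ring k X)" "1 \<in> carrier (mpoly_ring k X)"
    using zero_closed one_closed by (simp_all add: mpoly_ring_def)
  show uminus: "- p \<in> carrier (mpoly_ring k X)" if "p \<in> carrier (mpoly_ring k X)" for p
    using that by (simp add: carrier_mpoly_ring indets_def)
  show "p - q \<in> carrier (mpoly_ring k X)"
    if "p \<in> carrier (mpoly_ring k X)" "q \<in> carrier (mpoly_ring k X)" for p q
    using add[OF that(1) uminus[OF that(2)]] by simp
  show "x \<in> X \<Longrightarrow> pvar x \<in> carrier (mpoly_ring k X)"
    by (simp add: carrier_mpoly_ring indets_def pvar_def)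
  show "mconst c \<in> carrier (mpoly_ring k X)"
    by (simp add: carrier_mpoly_ring indets_def mconst_def)
qed

lemma mpoly_ring_sum:
  "(\<And>x. x \<in> A \<Longrightarrow> f x \<in> carrier (mpoly_ring k X)) \<Longrightarrow> sum f A \<in> carrier (mpoly_ring k X)"
  by (induction A rule: infinite_finite_induct) auto

lemma mpoly_ring_prod:
  "(\<And>x. x \<in> A \<Longrightarrow> f x \<in> carrier (mpoly_ring k X)) \<Longrightarrow> prod f A \<in> carrier (mpoly_ring k X)"
  by (induction A rule: infinite_finite_induct) auto

definition restrict_vars :: "'x set \<Rightarrow> ('x, 'k::comm_ring_1) mpoly \<Rightarrow> ('x, 'k) mpoly" where
  "restrict_vars X = msubst (\<lambda>x. if x \<in> X then pvar x else 0)"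

lemma restrict_vars_hom: "is_ring_hom (restrict_vars X)"
  unfolding restrict_vars_def by (rule msubst_hom)

lemma restrict_vars_closed: "restrict_vars X p \<in> carrier (mpoly_ring k X)"
  by (induction p rule: mpoly_induct) (simp_all add: restrict_vars_def)

lemma restrict_vars_id: "p \<in> carrier (mpoly_ring k X) \<Longrightarrow> restrict_vars X p = p"
  unfolding restrict_vars_def carrier_mpoly_ring
  by (subst msubst_cong[of p _ pvar]) (auto simp: msubst_id)

text \<open>The retraction fixes the elements of \<open>B\<close> in a combination and moves its
  coefficients into \<open>k[X]\<close>.\<close>

lemma genideal_eq:
  fixes k :: "'k::comm_ring_1 itself"
  assumes B: "B \<subseteq> carrier (mpoly_ring k X)"
  shows "Idl\<^bsub>mpoly_ring k X\<^esub> B = ideal_gen B \<inter> carrier (mpoly_ring k X)"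
proof
  let ?R = "mpoly_ring k X"
  interpret R: cring ?R by (rule cring_mpoly_ring)
  have "ideal (ideal_gen B \<inter> carrier ?R) ?R"
  proof (rule idealI[OF R.ring_axioms])
    show "subgroup (ideal_gen B \<inter> carrier ?R) (add_monoid ?R)"
    proof (rule group.subgroupI[OF R.a_group])
      fix a assume a: "a \<in> ideal_gen B \<inter> carrier ?R"
      have "\<ominus>\<^bsub>?R\<^esub> a = - a"
        by (rule R.minus_equality) (use a in \<open>auto simp: mpoly_ring_def indets_def\<close>)
      then show "inv\<^bsub>add_monoid ?R\<^esub> a \<in> ideal_gen B \<inter> carrier ?R"
        using a by (simp add: a_inv_def ring_ideal.span_neg)
    next
      show "ideal_gen B \<inter> carrier ?R \<noteq> {}"
        using ring_ideal.span_zero mpoly_ring_closed(3) by blast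
    next
      fix a b assume "a \<in> ideal_gen B \<inter> carrier ?R" "b \<in> ideal_gen B \<inter> carrier ?R"
      then have "a + b \<in> ideal_gen B \<inter> carrier ?R" by (auto intro: ring_ideal.span_add)
      then show "a \<otimes>\<^bsub>add_monoid ?R\<^esub> b \<in> ideal_gen B \<inter> carrier ?R" by (simp add: mpoly_ring_def)
    qed auto
  next
    fix a x assume ax: "a \<in> ideal_gen B \<inter> carrier ?R" "x \<in> carrier ?R"
    then have "x * a \<in> ideal_gen B \<inter> carrier ?R" by (auto intro: ideal_gen_mult_left)
    then show "x \<otimes>\<^bsub>?R\<^esub> a \<in> ideal_gen B \<inter> carrier ?R" "a \<otimes>\<^bsub>?R\<^esub> x \<in> ideal_gen B \<inter> carrier ?R"
      by (simp_all add: mpoly_ring_def mult.commute)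
  qed
  then show "Idl\<^bsub>?R\<^esub> B \<subseteq> ideal_gen B \<inter> carrier ?R"
    by (rule R.genideal_minimal) (use B in \<open>auto intro: ring_ideal.span_base\<close>)
  interpret I: ideal "Idl\<^bsub>?R\<^esub> B" ?R by (rule R.genideal_ideal[OF B])
  have "restrict_vars X p \<in> Idl\<^bsub>?R\<^esub> B" if "p \<in> ideal_gen B" for p
    using that
  proof (induction rule: ring_ideal.span_induct_alt)
    case base
    show ?case using I.zero_closed by (simp add: hom_zero[OF restrict_vars_hom] mpoly_ring_def)
  next
    case (step c x y)
    have "x \<in> Idl\<^bsub>?R\<^esub> B" using R.genideal_self[OF B] step by blast
    then have "restrict_vars X c \<otimes>\<^bsub>?R\<^esub> x \<in> Idl\<^bsub>?R\<^esub> B"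
      by (rule I.I_l_closed[OF _ restrict_vars_closed])
    from I.a_closed[OF this step.IH] show ?case
      using B step by (simp add: hom_simps[OF restrict_vars_hom] restrict_vars_id[of x k] mpoly_ring_def subset_iff)
  qed
  then show "ideal_gen B \<inter> carrier ?R \<subseteq> Idl\<^bsub>?R\<^esub> B" using restrict_vars_id by fastforce
qed

lemma primeideal_genideal:
  fixes k :: "'k::comm_ring_1 itself"
  assumes B: "B \<subseteq> carrier (mpoly_ring k X)" "prime_gen B"
  shows "primeideal (Idl\<^bsub>mpoly_ring k X\<^esub> B) (mpoly_ring k X)"
proof (rule primeidealI)
  interpret R: cring "mpoly_ring k X" by (rule cring_mpoly_ring)
  show "ideal (Idl\<^bsub>mpoly_ring k X\<^esub> B) (mpoly_ring k X)" by (rule R.genideal_ideal[OF B(1)])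
  show "cring (mpoly_ring k X)" by (rule cring_mpoly_ring)
  have "1 \<notin> ideal_gen B" using B(2) by (simp add: prime_gen_def)
  then show "carrier (mpoly_ring k X) \<noteq> Idl\<^bsub>mpoly_ring k X\<^esub> B"
    unfolding genideal_eq[OF B(1)] using mpoly_ring_closed(4) by blast
  fix a b assume "a \<in> carrier (mpoly_ring k X)" "b \<in> carrier (mpoly_ring k X)"
    "a \<otimes>\<^bsub>mpoly_ring k X\<^esub> b \<in> Idl\<^bsub>mpoly_ring k X\<^esub> B"
  then show "a \<in> Idl\<^bsub>mpoly_ring k X\<^esub> B \<or> b \<in> Idl\<^bsub>mpoly_ring k X\<^esub> B"
    unfolding genideal_eq[OF B(1)] by (simp add: mpoly_ring_def prime_gen_mult[OF B(2)])
qed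

lemma not_primeideal_genideal:
  fixes k :: "'k::comm_ring_1 itself"
  assumes B: "B \<subseteq> carrier (mpoly_ring k X)" and P: "primeideal (Idl\<^bsub>mpoly_ring k X\<^esub> B) (mpoly_ring k X)"
    and ab: "a \<in> carrier (mpoly_ring k X)" "b \<in> carrier (mpoly_ring k X)" "a * b \<in> ideal_gen B"
  shows "a \<in> ideal_gen B \<or> b \<in> ideal_gen B"
proof -
  have "a \<otimes>\<^bsub>mpoly_ring k X\<^esub> b \<in> Idl\<^bsub>mpoly_ring k X\<^esub> B"
    unfolding genideal_eq[OF B] using ab mpoly_ring_closed(2)[OF ab(1,2)] by (simp add: mpoly_ring_def)
  from primeideal.I_prime[OF P ab(1,2) this] show ?thesis unfolding genideal_eq[OF B] by blast
qed


section \<open>Obstructions to primality in dimension three\<close>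

lemma lss_gensI: "{i, j} \<in> E \<Longrightarrow> lss_poly d i j \<in> ideal_gen (lss_gens d E)"
  unfolding lss_gens_def by (blast intro: ring_ideal.span_base)

text \<open>The three edge polynomials are the entries of \<open>M v\<close>, where \<open>M\<close>
  has rows \<open>a\<close>, \<open>b\<close>, \<open>c\<close>. Multiplying by the adjugate of
  \<open>M\<close> gives \<open>det M\<close> times each coordinate of \<open>v\<close>.\<close>

lemma star_relation_3:
  fixes E :: "'v set set"
  defines "y \<equiv> \<lambda>i l. pvar (i, l) :: ('v \<times> nat, 'k::field) mpoly"
  assumes "{v, a} \<in> E" "{v, b} \<in> E" "{v, c} \<in> E"
  shows "y v 1 * (y a 1 * (y b 2 * y c 3 - y b 3 * y c 2) - y b 1 * (y a 2 * y c 3 - y a 3 * y c 2) +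
      y c 1 * (y a 2 * y b 3 - y a 3 * y b 2)) \<in> ideal_gen (lss_gens 3 E)" (is "?p \<in> _")
proof -
  have "colours 1 2 3" unfolding colours_def by auto
  note f = lss_poly_3[OF this, folded y_def]
  have "?p = lss_poly 3 v a * (y b 2 * y c 3 - y b 3 * y c 2) -
      lss_poly 3 v b * (y a 2 * y c 3 - y a 3 * y c 2) + lss_poly 3 v c * (y a 2 * y b 3 - y a 3 * y b 2)"
    unfolding f y_def by (simp add: algebra_simps)
  then show ?thesis
    by (auto intro!: ring_ideal.span_add ring_ideal.span_diff ideal_gen_mult_right lss_gensI assms)
qed

text \<open>The vector product \<open>n\<close> of the vectors at \<open>u\<close> and \<open>u'\<close> satisfies
  \<open>n \<times> w = u' (u \<cdot> w) - u (u' \<cdot> w)\<close>, so it is parallel to \<open>w\<close> and \<open>w'\<close> modulo the ideal.\<close>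

lemma square_relation_3:
  fixes E :: "'v set set"
  defines "y \<equiv> \<lambda>i l. pvar (i, l) :: ('v \<times> nat, 'k::field) mpoly"
  assumes "{u, w} \<in> E" "{u, w'} \<in> E" "{u', w} \<in> E" "{u', w'} \<in> E"
  shows "(y u 1 * y u' 2 - y u' 1 * y u 2) * (y w 2 * y w' 3 - y w' 2 * y w 3) \<in> ideal_gen (lss_gens 3 E)"
    (is "?p \<in> _")
proof -
  have "colours 1 2 3" unfolding colours_def by auto
  note f = lss_poly_3[OF this, folded y_def]
  have "?p = y w 3 * (y u' 1 * lss_poly 3 u w' - y u 1 * lss_poly 3 u' w') -
      y w' 3 * (y u' 1 * lss_poly 3 u w - y u 1 * lss_poly 3 u' w)"
    unfolding f y_def by (simp add: algebra_simps)
  then show ?thesis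
    by (auto intro!: ring_ideal.span_add ring_ideal.span_diff ideal_gen_mult_left lss_gensI assms)
qed


section \<open>Obstructions to complete intersections in dimension two\<close>

lemma ideal_gen_list_coeffs:
  assumes "x \<in> ideal_gen (set xs)"
  shows "\<exists>a. x = (\<Sum>j<length xs. a j * xs ! j)"
  using assms
proof (induction rule: ring_ideal.span_induct_alt)
  case base
  show ?case by (intro exI[of _ "\<lambda>_. 0"]) simp
next
  case (step c z x)
  obtain a where a: "x = (\<Sum>j<length xs. a j * xs ! j)" using step.IH by blast
  obtain i where i: "i < length xs" "z = xs ! i" using step.hyps by (metis in_set_conv_nth)
  have "c * z = (\<Sum>j<length xs. (if j = i then c else 0) * xs ! j)"
    using i by (simp add: if_distrib[of "\<lambda>u. u * _"] sum.delta cong: if_cong)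
  then have "c * z + x = (\<Sum>j<length xs. ((if j = i then c else 0) + a j) * xs ! j)"
    using a by (simp add: distrib_right sum.distrib)
  then show ?case by (rule exI[of _ "\<lambda>j. (if j = i then c else 0) + a j"])
qed

text \<open>Regularity in \<open>k[X]\<close> is tested on elements of \<open>k[X]\<close> only, so
  coefficients must be found there.\<close>

lemma ideal_gen_list_coeffs_closed:
  fixes k :: "'k::comm_ring_1 itself"
  assumes "x \<in> ideal_gen (set xs)" "x \<in> carrier (mpoly_ring k X)" "set xs \<subseteq> carrier (mpoly_ring k X)"
  shows "\<exists>a. (\<forall>j. a j \<in> carrier (mpoly_ring k X)) \<and> x = (\<Sum>j<length xs. a j * xs ! j)"
proof -
  obtain a where a: "x = (\<Sum>j<length xs. a j * xs ! j)" using ideal_gen_list_coeffs[OF assms(1)] by blast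
  have "restrict_vars X x = (\<Sum>j<length xs. restrict_vars X (a j) * restrict_vars X (xs ! j))"
    unfolding a by (simp add: hom_sum[OF restrict_vars_hom] hom_mult[OF restrict_vars_hom])
  also have "\<dots> = (\<Sum>j<length xs. restrict_vars X (a j) * xs ! j)"
    using assms(3) by (intro sum.cong refl) (simp add: restrict_vars_id[of _ k] subset_iff)
  finally have "x = (\<Sum>j<length xs. restrict_vars X (a j) * xs ! j)"
    using restrict_vars_id[OF assms(2)] by simp
  then show ?thesis using restrict_vars_closed by (intro exI[of _ "\<lambda>j. restrict_vars X (a j)"]) blast
qed

text \<open>A consequence of Koszul exactness. By regularity the last coefficient lies in the ideal
  of the earlier members; substituting such an expression for it leaves a shorter syzygy.\<close>

lemma regular_sequence_syzygy:
  fixes k :: "'k::comm_ring_1 itself"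
  assumes reg: "regular_sequence (mpoly_ring k X) fs" and "n \<le> length fs"
    and "\<And>j. j < n \<Longrightarrow> a j \<in> carrier (mpoly_ring k X)" "(\<Sum>j<n. a j * fs ! j) = 0" "j < n"
  shows "a j \<in> ideal_gen (set (take n fs))"
  using assms(2-)
proof (induction n arbitrary: a j)
  case (Suc n)
  let ?R = "mpoly_ring k X"
  have fs: "set fs \<subseteq> carrier ?R" using reg by (simp add: regular_sequence_def)
  then have take: "set (take n fs) \<subseteq> carrier ?R" using set_take_subset by fast
  have nth: "fs ! i \<in> carrier ?R" if "i < length fs" for i using fs that by auto
  have take_nth: "take n fs ! i = fs ! i" if "i < n" for i using that by simp
  have len: "length (take n fs) = n" using Suc.prems(1) by simp
  have set_Suc: "set (take (Suc n) fs) = insert (fs ! n) (set (take n fs))"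
    using Suc.prems(1) by (simp add: take_Suc_conv_app_nth)
  have an: "a n \<in> carrier ?R" using Suc.prems(2) by simp
  have "fs ! n * a n = (\<Sum>i<n. (- a i) * fs ! i)"
    using Suc.prems(3) by (simp add: sum_negf algebra_simps eq_neg_iff_add_eq_0)
  also have "\<dots> \<in> ideal_gen (set (take n fs))"
    using Suc.prems(1)
    by (intro ring_ideal.span_sum ideal_gen_mult_left ring_ideal.span_base)
       (auto simp: in_set_conv_nth intro!: exI)
  finally have "fs ! n * a n \<in> ideal_gen (set (take n fs))" .
  moreover have "fs ! n * a n \<in> carrier ?R" using an nth[of n] Suc.prems(1) by simp
  ultimately have "fs ! n \<otimes>\<^bsub>?R\<^esub> a n \<in> Idl\<^bsub>?R\<^esub> set (take n fs)"
    unfolding genideal_eq[OF take] by (simp add: mpoly_ring_def)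
  then have "a n \<in> Idl\<^bsub>?R\<^esub> set (take n fs)"
    using reg an Suc.prems(1) unfolding regular_sequence_def by simp
  then have an': "a n \<in> ideal_gen (set (take n fs))" using genideal_eq[OF take] by blast
  obtain c where c: "\<And>i. c i \<in> carrier ?R" "a n = (\<Sum>i<n. c i * fs ! i)"
    using ideal_gen_list_coeffs_closed[OF an' an take] len take_nth by auto
  have "(\<Sum>i<n. (a i + c i * fs ! n) * fs ! i) = (\<Sum>i<n. a i * fs ! i) + a n * fs ! n"
    unfolding c(2) by (simp add: algebra_simps sum.distrib sum_distrib_left)
  also have "\<dots> = 0" using Suc.prems(3) by simp
  finally have "(\<Sum>i<n. (a i + c i * fs ! n) * fs ! i) = 0" .
  from Suc.IH[OF _ _ this] have IH: "a i + c i * fs ! n \<in> ideal_gen (set (take n fs))" if "i < n" for i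
    using that Suc.prems(1,2) c(1) nth[of n] by simp
  show ?case
  proof (cases "j = n")
    case True
    then show ?thesis unfolding set_Suc using an' by (simp add: ideal_gen_insertI)
  next
    case False
    then have "a j - (- c j) * fs ! n \<in> ideal_gen (set (take n fs))" using IH[of j] Suc.prems(4) by simp
    then show ?thesis unfolding set_Suc ideal_gen_insert by blast
  qed
qed simp

section \<open>Decomposition by total degree\<close>

abbreviation tdeg :: "('x, 'k::comm_ring_1) mpoly \<Rightarrow> ('x, 'k) mpoly poly" where
  "tdeg \<equiv> grade (\<lambda>_. Suc 0)"

lemma tdeg_coeff_closed:
  assumes "p \<in> carrier (mpoly_ring k X)"
  shows "coeff (tdeg p) n \<in> carrier (mpoly_ring k X)"
proof -
  have "coeff (tdeg (restrict_vars X p)) n \<in> carrier (mpoly_ring k X)"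
  proof (induction p arbitrary: n rule: mpoly_induct)
    case (const c)
    show ?case by (simp add: restrict_vars_def coeff_pCons split: nat.split)
  next
    case (mult p q)
    then show ?case by (simp add: hom_simps[OF restrict_vars_hom] coeff_mult mpoly_ring_sum)
  qed (simp_all add: hom_simps[OF restrict_vars_hom], simp add: restrict_vars_def)
  then show ?thesis using restrict_vars_id[OF assms] by simp
qed

lemma monom_sum_coeff: "(\<Sum>i\<in>A. monom (f i) n) = monom (\<Sum>i\<in>A. f i) n"
  by (induction A rule: infinite_finite_induct) (simp_all add: add_monom)

lemma tdeg_coeff: "tdeg (coeff (tdeg p) n) = monom (coeff (tdeg p) n) n"
proof (induction p arbitrary: n rule: mpoly_induct)
  case (const c)
  show ?case by (auto simp: coeff_pCons monom_0 split: nat.split)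
next
  case (mult p q)
  have "tdeg (coeff (tdeg (p * q)) n) =
      (\<Sum>i\<le>n. monom (coeff (tdeg p) i * coeff (tdeg q) (n - i)) n)"
    by (simp add: coeff_mult hom_sum[OF grade_hom] mult mult_monom)
  then show ?case by (simp add: coeff_mult monom_sum_coeff)
qed (auto simp: add_monom)

lemma eval_ind_mconst [simp]: "eval_ind S (mconst c) = c"
  unfolding eval_ind_def by (rule meval_mconst[OF hom_id])

lemma mconst_0 [simp]: "mconst 0 = 0"
  by (simp add: mconst_def)

lemma tdeg_coeff_0: "coeff (tdeg p) 0 = mconst (eval_ind {} p)"
  by (rule hom_eqI[OF hom_comp[OF hom_coeff_0 grade_hom] hom_comp[OF hom_mconst eval_ind_hom]])
     simp_all

text \<open>Let \<open>b = A f\<close> and \<open>f = B b\<close> for a regular sequence \<open>f\<close>. A syzygy \<open>c\<close> of the generators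
  \<open>b\<close> makes \<open>c A\<close> vanish modulo the ideal, whence \<open>c \<equiv> c N\<close> for \<open>N = 1 - A B\<close>. As \<open>N b = 0\<close> and the
  generators are linearly independent, \<open>N\<close> has no constant terms, and comparing degrees gives
  \<open>c \<equiv> 0\<close>.\<close>

lemma homogeneous_syzygy:
  fixes k :: "'k::idom itself" and B :: "('x, 'k) mpoly set"
  assumes reg: "regular_sequence (mpoly_ring k X) fs" and gen: "ideal_gen (set fs) = ideal_gen B"
    and B: "finite B" "B \<subseteq> carrier (mpoly_ring k X)" "\<And>b. b \<in> B \<Longrightarrow> tdeg b = monom b 2"
    and indep: "\<And>b. b \<in> B \<Longrightarrow> \<exists>h :: ('x, 'k) mpoly \<Rightarrow> 'k poly. is_ring_hom h \<and>
      (\<forall>p. coeff (h p) 0 = eval_ind {} p) \<and> h b \<noteq> 0 \<and> (\<forall>b'\<in>B - {b}. h b' = 0)"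
    and c: "\<And>b. b \<in> B \<Longrightarrow> c b \<in> carrier (mpoly_ring k X)" "\<And>b. b \<in> B \<Longrightarrow> tdeg (c b) = monom (c b) D"
      "(\<Sum>b\<in>B. c b * b) = 0"
    and "b \<in> B"
  shows "c b \<in> ideal_gen B"
proof -
  let ?R = "mpoly_ring k X" and ?r = "length fs"
  have fs: "set fs \<subseteq> carrier ?R" using reg by (simp add: regular_sequence_def)
  have "\<exists>a. (\<forall>j. a j \<in> carrier ?R) \<and> b = (\<Sum>j<?r. a j * fs ! j)" if "b \<in> B" for b
    using that B(2) by (intro ideal_gen_list_coeffs_closed fs) (auto simp: gen intro: ring_ideal.span_base)
  then have "\<exists>A. \<forall>b\<in>B. (\<forall>j. A b j \<in> carrier ?R) \<and> b = (\<Sum>j<?r. A b j * fs ! j)"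
    by (intro bchoice ballI)
  then obtain A where A: "\<And>b j. b \<in> B \<Longrightarrow> A b j \<in> carrier ?R" "\<And>b. b \<in> B \<Longrightarrow> b = (\<Sum>j<?r. A b j * fs ! j)"
    by blast
  have "\<exists>u. fs ! j = (\<Sum>b\<in>B. u b * b)" if "j < ?r" for j
  proof -
    have "fs ! j \<in> ideal_gen B" unfolding gen[symmetric] using that by (intro ring_ideal.span_base) simp
    then show ?thesis unfolding ring_ideal.span_finite[OF B(1)] by blast
  qed
  then have "\<exists>U. \<forall>j\<in>{..<?r}. fs ! j = (\<Sum>b\<in>B. U j b * b)" by (intro bchoice ballI) simp
  then obtain U where U: "\<And>j. j < ?r \<Longrightarrow> fs ! j = (\<Sum>b\<in>B. U j b * b)" by blast
  define N where "N b b' = of_bool (b = b') - (\<Sum>j<?r. A b j * U j b')" for b b'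
  have N_rel: "(\<Sum>b'\<in>B. N b b' * b') = 0" if "b \<in> B" for b
  proof -
    have "(\<Sum>b'\<in>B. (\<Sum>j<?r. A b j * U j b') * b') = (\<Sum>j<?r. A b j * fs ! j)"
      by (subst sum_distrib_right, subst sum.swap)
         (simp add: U sum_distrib_left mult.assoc)
    moreover have "(\<Sum>b'\<in>B. of_bool (b = b') * b') = b"
      using that B(1) by (simp add: of_bool_def if_distrib[of "\<lambda>u. u * _"] cong: if_cong)
    ultimately show ?thesis unfolding N_def using A(2)[OF that] by (simp add: left_diff_distrib sum_subtractf)
  qed
  \<comment> \<open>\<open>h\<close> kills every generator but \<open>b'\<close>, so the relation
    for \<open>N\<close> leaves \<open>h (N b b') * h b' = 0\<close> in a domain. Hence
    \<open>h (N b b')\<close> is zero, and so is the constant term of \<open>N b b'\<close>.\<close>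
  have N0: "coeff (tdeg (N b b')) 0 = 0" if b: "b \<in> B" "b' \<in> B" for b b'
  proof -
    obtain h :: "('x, 'k) mpoly \<Rightarrow> 'k poly" where h: "is_ring_hom h" "\<And>p. coeff (h p) 0 = eval_ind {} p"
      "h b' \<noteq> 0" "\<And>b''. b'' \<in> B - {b'} \<Longrightarrow> h b'' = 0"
      using indep[OF b(2)] by blast
    have "0 = h (\<Sum>b''\<in>B. N b b'' * b'')" using N_rel[OF b(1)] hom_zero[OF h(1)] by simp
    also have "\<dots> = (\<Sum>b''\<in>B. h (N b b'') * h b'')" by (simp add: hom_sum[OF h(1)] hom_mult[OF h(1)])
    also have "\<dots> = h (N b b') * h b'"
      using B(1) b(2) h(4) by (subst sum.remove[of _ b']) (auto intro!: sum.neutral)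
    finally have "h (N b b') = 0" using h(3) by simp
    then have "eval_ind {} (N b b') = 0" using h(2)[of "N b b'"] by simp
    then show ?thesis by (simp add: tdeg_coeff_0 mconst_def)
  qed
  define s where "s j = (\<Sum>b\<in>B. c b * A b j)" for j
  have "(\<Sum>j<?r. s j * fs ! j) = (\<Sum>b\<in>B. c b * (\<Sum>j<?r. A b j * fs ! j))"
    unfolding s_def sum_distrib_right sum_distrib_left by (subst sum.swap) (simp add: mult.assoc)
  also have "\<dots> = 0" using c(3) A(2) by simp
  finally have s0: "(\<Sum>j<?r. s j * fs ! j) = 0" .
  have s: "s j \<in> ideal_gen B" if "j < ?r" for j
    using regular_sequence_syzygy[OF reg order_refl _ s0 that] A(1) c(1)
    by (simp add: gen s_def mpoly_ring_sum)
  have "c b' - (\<Sum>b\<in>B. c b * N b b') \<in> ideal_gen B" if "b' \<in> B" for b'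
  proof -
    have "(\<Sum>b\<in>B. c b * N b b') = c b' - (\<Sum>j<?r. s j * U j b')"
    proof -
      have "(\<Sum>b\<in>B. c b * (\<Sum>j<?r. A b j * U j b')) = (\<Sum>j<?r. s j * U j b')"
        unfolding s_def sum_distrib_right sum_distrib_left by (subst sum.swap) (simp add: mult.assoc)
      moreover have "(\<Sum>b\<in>B. c b * of_bool (b = b')) = c b'"
        using that B(1) by (simp add: of_bool_def if_distrib[of "\<lambda>u. _ * u"] cong: if_cong)
      ultimately show ?thesis unfolding N_def by (simp add: right_diff_distrib sum_subtractf)
    qed
    moreover have "(\<Sum>j<?r. s j * U j b') \<in> ideal_gen B"
      by (intro ring_ideal.span_sum ideal_gen_mult_right s) simp
    ultimately show ?thesis by simp
  qed
  \<comment> \<open>The products \<open>c b' * N b' b\<close> have no component of degree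
    \<open>D\<close>, so the component of degree \<open>D\<close> is \<open>c b\<close>
    itself.\<close>
  from this[OF \<open>b \<in> B\<close>] have "coeff (tdeg (c b - (\<Sum>b'\<in>B. c b' * N b' b))) D \<in> ideal_gen B"
  proof (rule homogeneous_coeff[rotated])
    show "homogeneous (\<lambda>_. Suc 0) B" unfolding homogeneous_def using B(3) by blast
  qed
  moreover have "coeff (monom (c b') D * tdeg (N b' b)) D = 0" if "b' \<in> B" for b'
    using N0[OF that \<open>b \<in> B\<close>] by (simp add: coeff_monom_mult)
  ultimately show ?thesis using c(2) \<open>b \<in> B\<close> by (simp add: hom_sum[OF grade_hom] coeff_sum)
qed

lemma finite_lss_gens:
  assumes "finite E"
  shows "finite (lss_gens d E :: ('v \<times> nat, 'k::field) mpoly set)"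
  using assms
proof (induction E rule: finite_induct)
  case empty
  show ?case by (simp add: lss_gens_def)
next
  case (insert e E)
  show ?case
  proof (cases "\<exists>i j. e = {i, j}")
    case True
    then show ?thesis using insert.IH by (auto simp: lss_gens_insert)
  next
    case False
    then have "lss_gens d (insert e E) = (lss_gens d E :: ('v \<times> nat, 'k) mpoly set)"
      unfolding lss_gens_def by auto
    then show ?thesis using insert.IH by simp
  qed
qed

text \<open>A relation between one edge and the others becomes a homogeneous syzygy once its
  coefficients are restricted to \<open>k[X]\<close> and replaced by their components of degree
  \<open>D\<close>.\<close>

lemma lss_koszul:
  fixes k :: "'k::field itself" and E :: "'v set set"
  defines "B \<equiv> lss_gens 2 E :: ('v \<times> nat, 'k) mpoly set"
  assumes reg: "regular_sequence (mpoly_ring k X) fs" and gen: "ideal_gen (set fs) = ideal_gen B"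
    and E: "finite E" "\<forall>e\<in>E. card e = 2" and B: "B \<subseteq> carrier (mpoly_ring k X)"
    and b: "{i, j} \<in> E"
    and c: "c \<in> carrier (mpoly_ring k X)" "tdeg c = monom c D"
    and rel: "c * lss_poly 2 i j \<in> ideal_gen (lss_gens 2 (E - {{i, j}}))"
  shows "c \<in> ideal_gen B"
proof -
  have neq: "i' \<noteq> j'" if "{i', j'} \<in> E" for i' j' using E(2) that by fastforce
  have fin: "finite B" unfolding B_def by (rule finite_lss_gens[OF E(1)])
  have deg: "tdeg b = monom b 2" if bB: "b \<in> B" for b
  proof -
    obtain i j where "b = lss_poly 2 i j" using bB unfolding B_def lss_gens_def by blast
    then show ?thesis using grade_lss_poly[of 2 "\<lambda>_. Suc 0" i "Suc 0" j "Suc 0"]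
      by (simp add: numeral_2_eq_2)
  qed
  \<comment> \<open>With the first coordinates of \<open>i\<close> and \<open>j\<close> sent to
    \<open>T\<close> and everything else to 0, only the edge \<open>{i, j}\<close> survives, as
    \<open>T^2\<close>. This is the independence asked for by
    \<open>homogeneous_syzygy\<close>.\<close>
  define h :: "'v \<Rightarrow> 'v \<Rightarrow> ('v \<times> nat, 'k) mpoly \<Rightarrow> 'k poly" where
    "h i j = meval (\<lambda>c. [:c:]) (\<lambda>z. if z = (i, 1) \<or> z = (j, 1) then [:0, 1:] else 0)" for i j
  have h: "is_ring_hom (h i j)" for i j unfolding h_def by (rule meval_hom[OF hom_const])
  have h_var: "h i j (pvar z) = (if z = (i, 1) \<or> z = (j, 1) then [:0, 1:] else 0)" for i j z
    unfolding h_def by (rule meval_pvar[OF hom_const])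
  have h_const: "h i j (mconst c) = [:c:]" for i j c unfolding h_def by (rule meval_mconst[OF hom_const])
  have h0: "coeff (h i j p) 0 = eval_ind {} p" for i j p
    by (rule hom_eqI[OF hom_comp[OF hom_coeff_0 h] eval_ind_hom]) (simp_all add: h_var h_const)
  have h_lss: "h i j (lss_poly 2 i' j') = (if {i', j'} = {i, j} then [:0, 0, 1:] else 0)"
    if "i \<noteq> j" "i' \<noteq> j'" for i j i' j'
    using that by (auto simp: lss_poly_2[OF colours_2] hom_simps[OF h] h_var doubleton_eq_iff)
  have indep: "\<exists>h :: ('v \<times> nat, 'k) mpoly \<Rightarrow> 'k poly. is_ring_hom h \<and>
      (\<forall>p. coeff (h p) 0 = eval_ind {} p) \<and> h b \<noteq> 0 \<and> (\<forall>b'\<in>B - {b}. h b' = 0)" if bB: "b \<in> B" for b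
  proof -
    obtain i j where ij: "b = lss_poly 2 i j" "{i, j} \<in> E" using bB unfolding B_def lss_gens_def by blast
    have "h i j b' = 0" if b': "b' \<in> B - {b}" for b'
    proof -
      obtain i' j' where ij': "b' = lss_poly 2 i' j'" "{i', j'} \<in> E"
        using b' unfolding B_def lss_gens_def by blast
      have "{i', j'} \<noteq> {i, j}"
      proof
        assume "{i', j'} = {i, j}"
        then have "b' = b" unfolding ij ij' by (auto simp: doubleton_eq_iff intro: lss_poly_commute)
        then show False using b' by blast
      qed
      then show ?thesis unfolding ij' using h_lss[OF neq[OF ij(2)] neq[OF ij'(2)]] by simp
    qed
    moreover have "h i j b \<noteq> 0" unfolding ij using h_lss[OF neq[OF ij(2)] neq[OF ij(2)]] by simp
    ultimately show ?thesis using h h0 by blast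
  qed
  let ?f = "lss_poly 2 i j :: ('v \<times> nat, 'k) mpoly" and ?B' = "lss_gens 2 (E - {{i, j}}) :: ('v \<times> nat, 'k) mpoly set"
  have "insert {i, j} (E - {{i, j}}) = E" using b by blast
  then have B_insert: "B = insert ?f ?B'" unfolding B_def by (metis lss_gens_insert)
  have f_notin: "?f \<notin> ?B'"
  proof
    assume "?f \<in> ?B'"
    then obtain i' j' where ij': "?f = lss_poly 2 i' j'" "{i', j'} \<in> E - {{i, j}}" unfolding lss_gens_def by blast
    then have "h i j ?f = 0" using h_lss[OF neq[OF b], of i' j'] neq[of i' j'] by auto
    then show False using h_lss[OF neq[OF b] neq[OF b]] by simp
  qed
  have fin': "finite ?B'" using fin B_insert by simp
  obtain u where u: "c * ?f = (\<Sum>b\<in>?B'. u b * b)"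
    using rel unfolding ring_ideal.span_finite[OF fin'] by blast
  define u' where "u' b = coeff (tdeg (restrict_vars X (u b))) D" for b
  have fX: "?f \<in> carrier (mpoly_ring k X)" using B B_insert by blast
  have "c * ?f = restrict_vars X (c * ?f)" using c(1) fX by (simp add: restrict_vars_id[of _ k])
  also have "\<dots> = (\<Sum>b\<in>?B'. restrict_vars X (u b) * b)"
    unfolding u hom_sum[OF restrict_vars_hom] hom_mult[OF restrict_vars_hom]
    using B B_insert by (intro sum.cong refl) (simp add: restrict_vars_id[of _ k] subset_iff)
  finally have "tdeg (c * ?f) = tdeg (\<Sum>b\<in>?B'. restrict_vars X (u b) * b)" by simp
  then have "monom (c * ?f) (D + 2) = (\<Sum>b\<in>?B'. tdeg (restrict_vars X (u b)) * monom b 2)"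
    using deg B_insert c(2) by (simp add: hom_sum[OF grade_hom] mult_monom)
  then have "coeff (monom (c * ?f) (D + 2)) (D + 2) =
      coeff (\<Sum>b\<in>?B'. monom b 2 * tdeg (restrict_vars X (u b))) (D + 2)"
    by (simp add: mult.commute)
  then have rel': "c * ?f = (\<Sum>b\<in>?B'. u' b * b)"
    unfolding u'_def coeff_sum coeff_monom_mult by (simp add: mult.commute)
  define c' where "c' b = (if b = ?f then c else - u' b)" for b
  have "(\<Sum>b\<in>B. c' b * b) = c * ?f + (\<Sum>b\<in>?B'. - u' b * b)"
    unfolding B_insert using fin' f_notin by (auto simp: c'_def intro!: sum.cong)
  also have "\<dots> = 0" using rel' by (simp add: sum_negf)
  finally have sum0: "(\<Sum>b\<in>B. c' b * b) = 0" .
  have "c' ?f \<in> ideal_gen B"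
  proof (rule homogeneous_syzygy[OF reg gen fin B deg indep _ _ sum0])
    show "c' b \<in> carrier (mpoly_ring k X)" for b
      unfolding c'_def u'_def using c(1) by (simp add: tdeg_coeff_closed restrict_vars_closed)
    show "tdeg (c' b) = monom (c' b) D" for b
      unfolding c'_def u'_def using c(2) by (simp add: tdeg_coeff minus_monom)
  qed (auto simp: B_insert)
  then show ?thesis by (simp add: c'_def)
qed

text \<open>Three plane vectors are dependent: \<open>[b c] a = [a c] b - [a b] c\<close> with 2 by
  2 determinants. The relation is the product of this with \<open>v\<close>.\<close>

lemma star_relation_2:
  fixes E :: "'v set set"
  defines "y \<equiv> \<lambda>i l. pvar (i, l) :: ('v \<times> nat, 'k::field) mpoly"
  assumes "{v, b} \<in> E" "{v, c} \<in> E"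
  shows "(y b 1 * y c 2 - y c 1 * y b 2) * lss_poly 2 v a \<in> ideal_gen (lss_gens 2 E)" (is "?p \<in> _")
proof -
  note f = lss_poly_2[OF colours_2, folded y_def]
  have "?p = (y a 1 * y c 2 - y a 2 * y c 1) * lss_poly 2 v b - (y a 1 * y b 2 - y a 2 * y b 1) * lss_poly 2 v c"
    unfolding f y_def by (simp add: algebra_simps)
  then show ?thesis by (auto intro!: ring_ideal.span_diff ideal_gen_mult_left lss_gensI assms)
qed

lemma prod_congruent:
  assumes "\<And>x. x \<in> A \<Longrightarrow> f x - g x \<in> ideal_gen B"
  shows "prod f A - prod g A \<in> ideal_gen B"
  using assms
proof (induction A rule: infinite_finite_induct)
  case (insert x A)
  then have "(f x - g x) * prod f A + g x * (prod f A - prod g A) \<in> ideal_gen B"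
    by (intro ring_ideal.span_add ideal_gen_mult_left ideal_gen_mult_right) auto
  then show ?case using insert by (simp add: algebra_simps)
qed (simp_all add: ring_ideal.span_zero)

lemma prod_pairs: "(\<Prod>j<m. g (2 * j) * g (Suc (2 * j))) = (\<Prod>i<2 * m. g i :: 'a::comm_monoid_mult)"
  by (induction m) (simp_all add: mult.assoc)

lemma prod_rotate: "(\<Prod>i<n. g (Suc i mod n)) = (\<Prod>i<n. g i :: 'a::comm_monoid_mult)"
proof (cases n)
  case (Suc m)
  have "(\<Prod>i<m. g (Suc i mod n)) = (\<Prod>i<m. g (Suc i))" by (rule prod.cong) (simp_all add: Suc)
  moreover have "(\<Prod>i<n. g (Suc i mod n)) = (\<Prod>i<m. g (Suc i mod n)) * g 0" by (simp add: Suc)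
  ultimately show ?thesis
    using prod.lessThan_Suc_shift[of g m] by (simp add: mult.commute Suc)
qed simp

text \<open>Both perfect matchings of an even cycle turn the product of all first coordinates into the
  same multiple of the product of all second coordinates.\<close>

lemma even_cycle_relation_2:
  fixes E :: "'v set set" and v :: "nat \<Rightarrow> 'v"
  defines "y \<equiv> \<lambda>i l. pvar (v i, l) :: ('v \<times> nat, 'k::field) mpoly"
  assumes m: "m \<ge> 2" and inj: "inj_on v {..<2 * m}"
    and cyc: "\<And>i. i < 2 * m \<Longrightarrow> {v i, v (Suc i mod (2 * m))} \<in> E"
  shows "(\<Prod>j\<in>{1..<m}. - (y (2 * j) 2 * y (Suc (2 * j)) 2)) * lss_poly 2 (v 0) (v 1) \<in>
    ideal_gen (lss_gens 2 (E - {{v 0, v 1}}))"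
proof -
  let ?K = "ideal_gen (lss_gens 2 (E - {{v 0, v 1}})) :: ('v \<times> nat, 'k) mpoly set"
  let ?n = "2 * m"
  note f = lss_poly_2[OF colours_2]
  have v_eq: "v i = v j \<longleftrightarrow> i = j" if "i < ?n" "j < ?n" for i j
    using inj_onD[OF inj] that by auto
  have edge: "y i 1 * y (Suc i mod ?n) 1 - - (y i 2 * y (Suc i mod ?n) 2) \<in> ?K" if i: "0 < i" "i < ?n" for i
  proof -
    have "{v i, v (Suc i mod ?n)} \<noteq> {v 0, v 1}"
    proof
      assume eq: "{v i, v (Suc i mod ?n)} = {v 0, v 1}"
      have "Suc i mod ?n < ?n" using i by simp
      then have "(i = 0 \<and> Suc i mod ?n = 1) \<or> (i = 1 \<and> Suc i mod ?n = 0)"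
        using eq v_eq[of i 0] v_eq[of i 1] v_eq[of "Suc i mod ?n" 0] v_eq[of "Suc i mod ?n" 1] i(2) m
        unfolding doubleton_eq_iff by linarith
      then show False
      proof
        assume "i = 1 \<and> Suc i mod ?n = 0"
        then have "Suc 1 mod ?n = 0" by metis
        moreover have "Suc 1 mod ?n = Suc 1" using m by (intro mod_less) simp
        ultimately show False by linarith
      qed (use i in simp)
    qed
    then have "{v i, v (Suc i mod ?n)} \<in> E - {{v 0, v 1}}" using cyc[OF i(2)] by blast
    from lss_gensI[OF this, of 2, unfolded f] show ?thesis unfolding y_def by simp
  qed
  \<comment> \<open>The matching \<open>{1, 2}, {3, 4}, ..., {2m - 1, 0}\<close>, which avoids the
    removed edge, covers the same vertices as \<open>{0, 1}, {2, 3}, ...\<close>.\<close>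
  have rot: "(\<Prod>j<m. y (Suc (2 * j)) l * y (Suc (Suc (2 * j)) mod ?n) l) = (\<Prod>j<m. y (2 * j) l * y (Suc (2 * j)) l)"
    for l
  proof -
    have "(\<Prod>j<m. y (Suc (2 * j)) l * y (Suc (Suc (2 * j)) mod ?n) l) =
        (\<Prod>j<m. y (Suc (2 * j) mod ?n) l * y (Suc (Suc (2 * j)) mod ?n) l)"
      by (intro prod.cong refl) auto
    also have "\<dots> = (\<Prod>i<?n. y (Suc i mod ?n) l)" by (rule prod_pairs)
    also have "\<dots> = (\<Prod>i<?n. y i l)" by (rule prod_rotate)
    finally show ?thesis using prod_pairs[of "\<lambda>i. y i l" m] by simp
  qed
  have "(\<Prod>j<m. y (Suc (2 * j)) 1 * y (Suc (Suc (2 * j)) mod ?n) 1) -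
      (\<Prod>j<m. - (y (Suc (2 * j)) 2 * y (Suc (Suc (2 * j)) mod ?n) 2)) \<in> ?K"
    by (intro prod_congruent edge) auto
  then have all: "(\<Prod>j<m. y (2 * j) 1 * y (Suc (2 * j)) 1) -
      (\<Prod>j<m. - (y (2 * j) 2 * y (Suc (2 * j)) 2)) \<in> ?K"
    unfolding prod_uminus rot .
  have rest: "(\<Prod>j\<in>{1..<m}. y (2 * j) 1 * y (Suc (2 * j)) 1) - (\<Prod>j\<in>{1..<m}. - (y (2 * j) 2 * y (Suc (2 * j)) 2)) \<in> ?K"
    (is "?a - ?b \<in> _")
  proof (rule prod_congruent)
    fix j assume "j \<in> {1..<m}"
    then show "y (2 * j) 1 * y (Suc (2 * j)) 1 - - (y (2 * j) 2 * y (Suc (2 * j)) 2) \<in> ?K"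
      using edge[of "2 * j"] by simp
  qed
  have split: "prod g {..<m} = g 0 * prod g {1..<m}" for g :: "nat \<Rightarrow> ('v \<times> nat, 'k) mpoly"
  proof -
    have "{..<m} = insert 0 {1..<m}" using m by auto
    then show ?thesis by simp
  qed
  \<comment> \<open>Replacing \<open>?a\<close> by \<open>?b\<close> in \<open>all\<close> leaves
    \<open>?b\<close> times the two terms of the removed edge.\<close>
  have "(\<Prod>j<m. y (2 * j) 1 * y (Suc (2 * j)) 1) - (\<Prod>j<m. - (y (2 * j) 2 * y (Suc (2 * j)) 2)) -
      y 0 1 * y 1 1 * (?a - ?b) = ?b * lss_poly 2 (v 0) (v 1)"
    unfolding split f by (simp add: y_def algebra_simps)
  with ring_ideal.span_diff[OF all ideal_gen_mult_left[OF rest, of "y 0 1 * y 1 1"]]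
  show ?thesis by simp
qed

section \<open>Subgraphs\<close>

text \<open>Subgraphs need not be induced, so an injective map preserving edges suffices: its image,
  given only the image edges, is a copy of \<open>K\<close>.\<close>

lemma contains_graph_iff:
  fixes G :: "'v ugraph" and K :: "'w ugraph"
  assumes K: "simple_graph K"
  shows "contains_graph G K \<longleftrightarrow> (\<exists>\<psi>. inj_on \<psi> (verts K) \<and> \<psi> ` verts K \<subseteq> verts G \<and>
    (\<forall>i\<in>verts K. \<forall>j\<in>verts K. {i, j} \<in> edges K \<longrightarrow> {\<psi> i, \<psi> j} \<in> edges G))"
proof
  assume "contains_graph G K"
  then obtain H \<phi> where H: "is_subgraph H G" and \<phi>: "bij_betw \<phi> (verts H) (verts K)"
    "\<And>i j. i \<in> verts H \<Longrightarrow> j \<in> verts H \<Longrightarrow> {i, j} \<in> edges H \<longleftrightarrow> {\<phi> i, \<phi> j} \<in> edges K"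
    unfolding contains_graph_def graph_iso_def by blast
  define \<psi> where "\<psi> = inv_into (verts H) \<phi>"
  have \<psi>: "bij_betw \<psi> (verts K) (verts H)" unfolding \<psi>_def by (rule bij_betw_inv_into[OF \<phi>(1)])
  have "{\<psi> i, \<psi> j} \<in> edges G" if ij: "i \<in> verts K" "j \<in> verts K" "{i, j} \<in> edges K" for i j
  proof -
    have "\<psi> i \<in> verts H" "\<psi> j \<in> verts H" using \<psi> ij by (auto simp: bij_betw_def)
    moreover have "\<phi> (\<psi> i) = i" "\<phi> (\<psi> j) = j"
      using \<phi>(1) ij unfolding \<psi>_def by (simp_all add: bij_betw_inv_into_right)
    ultimately have "{\<psi> i, \<psi> j} \<in> edges H" using \<phi>(2) ij(3) by simp
    then show ?thesis using H by (auto simp: is_subgraph_def)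
  qed
  then show "\<exists>\<psi>. inj_on \<psi> (verts K) \<and> \<psi> ` verts K \<subseteq> verts G \<and>
      (\<forall>i\<in>verts K. \<forall>j\<in>verts K. {i, j} \<in> edges K \<longrightarrow> {\<psi> i, \<psi> j} \<in> edges G)"
    using \<psi> H unfolding bij_betw_def is_subgraph_def by (intro exI[of _ \<psi>]) auto
next
  assume "\<exists>\<psi>. inj_on \<psi> (verts K) \<and> \<psi> ` verts K \<subseteq> verts G \<and>
      (\<forall>i\<in>verts K. \<forall>j\<in>verts K. {i, j} \<in> edges K \<longrightarrow> {\<psi> i, \<psi> j} \<in> edges G)"
  then obtain \<psi> where inj: "inj_on \<psi> (verts K)" and V: "\<psi> ` verts K \<subseteq> verts G"
    and edge: "\<And>i j. i \<in> verts K \<Longrightarrow> j \<in> verts K \<Longrightarrow> {i, j} \<in> edges K \<Longrightarrow> {\<psi> i, \<psi> j} \<in> edges G"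
    by blast
  define H where "H = (\<psi> ` verts K, (\<lambda>e. \<psi> ` e) ` edges K)"
  have eK: "e \<subseteq> verts K" "card e = 2" if "e \<in> edges K" for e
    using K that by (auto simp: simple_graph_def)
  have "simple_graph H"
    unfolding simple_graph_def
  proof (intro conjI ballI)
    show "finite (verts H)" using K by (simp add: H_def simple_graph_def)
    fix e assume "e \<in> edges H"
    then obtain e' where e': "e' \<in> edges K" "e = \<psi> ` e'" by (auto simp: H_def)
    show "e \<subseteq> verts H" using eK(1)[OF e'(1)] by (auto simp: H_def e'(2))
    show "card e = 2"
      unfolding e'(2) using card_image[OF inj_on_subset[OF inj eK(1)[OF e'(1)]]] eK(2)[OF e'(1)] by simp
  qed
  moreover have "edges H \<subseteq> edges G"
  proof
    fix e assume "e \<in> edges H"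
    then obtain e' where e': "e' \<in> edges K" "e = \<psi> ` e'" by (auto simp: H_def)
    obtain i j where ij: "e' = {i, j}" using eK(2)[OF e'(1)] unfolding card_2_iff by blast
    then show "e \<in> edges G" using edge[of i j] eK(1)[OF e'(1)] e' by simp
  qed
  ultimately have "is_subgraph H G" using V by (simp add: is_subgraph_def H_def)
  moreover have "graph_iso H K"
    unfolding graph_iso_def
  proof (intro exI conjI ballI)
    show "bij_betw (inv_into (verts K) \<psi>) (verts H) (verts K)"
      unfolding H_def by (simp add: inj inj_on_imp_bij_betw bij_betw_inv_into)
    fix i j assume "i \<in> verts H" "j \<in> verts H"
    then obtain a b where ab: "a \<in> verts K" "b \<in> verts K" "i = \<psi> a" "j = \<psi> b" by (auto simp: H_def)
    have "{i, j} \<in> edges H \<longleftrightarrow> (\<exists>e\<in>edges K. \<psi> ` {a, b} = \<psi> ` e)" by (auto simp: H_def ab)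
    also have "\<dots> \<longleftrightarrow> {a, b} \<in> edges K"
      using inj_on_image_eq_iff[OF inj, of "{a, b}"] eK(1) ab by auto
    finally show "{i, j} \<in> edges H \<longleftrightarrow> {inv_into (verts K) \<psi> i, inv_into (verts K) \<psi> j} \<in> edges K"
      using ab inj by simp
  qed
  ultimately show "contains_graph G K" unfolding contains_graph_def by blast
qed

lemma simple_complete_bipartite: "simple_graph (complete_bipartite a b)"
  unfolding simple_graph_def complete_bipartite_def by (auto simp: card_insert_if)

lemma simple_cycle_graph:
  assumes "n \<ge> 3"
  shows "simple_graph (cycle_graph n)"
proof -
  have "i \<noteq> Suc i mod n" if "i < n" for i
  proof (cases "Suc i = n")
    case True
    then show ?thesis using assms by auto
  qed (use that in simp)
  then show ?thesis using assms unfolding simple_graph_def cycle_graph_def by auto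
qed

lemma simple_graph_neq: "simple_graph G \<Longrightarrow> {i, j} \<in> edges G \<Longrightarrow> i \<noteq> j"
  unfolding simple_graph_def by force

lemma simple_graph_verts: "simple_graph G \<Longrightarrow> {i, j} \<in> edges G \<Longrightarrow> i \<in> verts G \<and> j \<in> verts G"
  unfolding simple_graph_def by force

lemma contains_star:
  assumes G: "simple_graph G"
  shows "contains_graph G (complete_bipartite 1 3) \<longleftrightarrow>
    (\<exists>v a b c. {v, a} \<in> edges G \<and> {v, b} \<in> edges G \<and> {v, c} \<in> edges G \<and> a \<noteq> b \<and> a \<noteq> c \<and> b \<noteq> c)"
  unfolding contains_graph_iff[OF simple_complete_bipartite]
proof
  let ?K = "complete_bipartite 1 3"
  assume "\<exists>\<psi>. inj_on \<psi> (verts ?K) \<and> \<psi> ` verts ?K \<subseteq> verts G \<and>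
    (\<forall>i\<in>verts ?K. \<forall>j\<in>verts ?K. {i, j} \<in> edges ?K \<longrightarrow> {\<psi> i, \<psi> j} \<in> edges G)"
  then obtain \<psi> where inj: "inj_on \<psi> (verts ?K)"
    and edge: "\<And>i j. i \<in> verts ?K \<Longrightarrow> j \<in> verts ?K \<Longrightarrow> {i, j} \<in> edges ?K \<Longrightarrow> {\<psi> i, \<psi> j} \<in> edges G"
    by blast
  have V: "Inl 0 \<in> verts ?K" "j < 3 \<Longrightarrow> Inr j \<in> verts ?K" for j
    by (auto simp: complete_bipartite_def)
  have e: "{\<psi> (Inl 0), \<psi> (Inr j)} \<in> edges G" if "j < 3" for j
    using that by (intro edge V) (auto simp: complete_bipartite_def)
  have "\<psi> (Inr i) \<noteq> \<psi> (Inr j)" if "i < 3" "j < 3" "i \<noteq> j" for i j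
    using inj_onD[OF inj _ V(2)[OF that(1)] V(2)[OF that(2)]] that(3) by auto
  then show "\<exists>v a b c. {v, a} \<in> edges G \<and> {v, b} \<in> edges G \<and> {v, c} \<in> edges G \<and> a \<noteq> b \<and> a \<noteq> c \<and> b \<noteq> c"
    using e[of 0] e[of 1] e[of 2]
    by (intro exI[of _ "\<psi> (Inl 0)"] exI[of _ "\<psi> (Inr 0)"] exI[of _ "\<psi> (Inr 1)"] exI[of _ "\<psi> (Inr 2)"]) auto
next
  let ?K = "complete_bipartite 1 3"
  assume "\<exists>v a b c. {v, a} \<in> edges G \<and> {v, b} \<in> edges G \<and> {v, c} \<in> edges G \<and> a \<noteq> b \<and> a \<noteq> c \<and> b \<noteq> c"
  then obtain v a b c where e: "{v, a} \<in> edges G" "{v, b} \<in> edges G" "{v, c} \<in> edges G"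
    and neq: "a \<noteq> b" "a \<noteq> c" "b \<noteq> c" by blast
  \<comment> \<open>The centre differs from the leaves because there are no loops.\<close>
  note vs = simple_graph_neq[OF G e(1)] simple_graph_neq[OF G e(2)] simple_graph_neq[OF G e(3)]
  note Vs = simple_graph_verts[OF G e(1)] simple_graph_verts[OF G e(2)] simple_graph_verts[OF G e(3)]
  define \<psi> where "\<psi> = case_sum (\<lambda>_::nat. v) (\<lambda>j::nat. if j = 0 then a else if j = 1 then b else c)"
  have three: "j = 0 \<or> j = 1 \<or> j = 2" if "j < 3" for j :: nat using that by linarith
  have "inj_on \<psi> (verts ?K)"
    using neq vs by (auto simp: inj_on_def complete_bipartite_def \<psi>_def dest!: three)
  moreover have "\<psi> ` verts ?K \<subseteq> verts G"
    using Vs by (auto simp: complete_bipartite_def \<psi>_def)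
  moreover have "{\<psi> i, \<psi> j} \<in> edges G" if ij: "{i, j} \<in> edges ?K" for i j
  proof -
    obtain j' where "j' < 3" "{i, j} = {Inl 0, Inr j'}" using ij by (auto simp: complete_bipartite_def)
    then have "{\<psi> i, \<psi> j} = {v, \<psi> (Inr j')}" by (auto simp: doubleton_eq_iff \<psi>_def)
    then show ?thesis using e by (auto simp: \<psi>_def)
  qed
  ultimately show "\<exists>\<psi>. inj_on \<psi> (verts ?K) \<and> \<psi> ` verts ?K \<subseteq> verts G \<and>
    (\<forall>i\<in>verts ?K. \<forall>j\<in>verts ?K. {i, j} \<in> edges ?K \<longrightarrow> {\<psi> i, \<psi> j} \<in> edges G)" by blast
qed

lemma contains_square:
  assumes G: "simple_graph G"
  shows "contains_graph G (complete_bipartite 2 2) \<longleftrightarrow>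
    (\<exists>u u' w w'. u \<noteq> u' \<and> w \<noteq> w' \<and> {u, w} \<in> edges G \<and> {u, w'} \<in> edges G \<and>
       {u', w} \<in> edges G \<and> {u', w'} \<in> edges G)"
  unfolding contains_graph_iff[OF simple_complete_bipartite]
proof
  let ?K = "complete_bipartite 2 2"
  assume "\<exists>\<psi>. inj_on \<psi> (verts ?K) \<and> \<psi> ` verts ?K \<subseteq> verts G \<and>
    (\<forall>i\<in>verts ?K. \<forall>j\<in>verts ?K. {i, j} \<in> edges ?K \<longrightarrow> {\<psi> i, \<psi> j} \<in> edges G)"
  then obtain \<psi> where inj: "inj_on \<psi> (verts ?K)"
    and edge: "\<And>i j. i \<in> verts ?K \<Longrightarrow> j \<in> verts ?K \<Longrightarrow> {i, j} \<in> edges ?K \<Longrightarrow> {\<psi> i, \<psi> j} \<in> edges G"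
    by blast
  have V: "i < 2 \<Longrightarrow> Inl i \<in> verts ?K" "j < 2 \<Longrightarrow> Inr j \<in> verts ?K" for i j
    by (auto simp: complete_bipartite_def)
  have e: "{\<psi> (Inl i), \<psi> (Inr j)} \<in> edges G" if "i < 2" "j < 2" for i j
    using that by (intro edge V) (auto simp: complete_bipartite_def)
  have "\<psi> (Inl 0) \<noteq> \<psi> (Inl 1)" "\<psi> (Inr 0) \<noteq> \<psi> (Inr 1)"
    using inj_onD[OF inj _ V(1)[of 0] V(1)[of 1]] inj_onD[OF inj _ V(2)[of 0] V(2)[of 1]] by auto
  then show "\<exists>u u' w w'. u \<noteq> u' \<and> w \<noteq> w' \<and> {u, w} \<in> edges G \<and> {u, w'} \<in> edges G \<and>
       {u', w} \<in> edges G \<and> {u', w'} \<in> edges G"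
    using e[of 0 0] e[of 0 1] e[of 1 0] e[of 1 1]
    by (intro exI[of _ "\<psi> (Inl 0)"] exI[of _ "\<psi> (Inl 1)"] exI[of _ "\<psi> (Inr 0)"] exI[of _ "\<psi> (Inr 1)"]) auto
next
  let ?K = "complete_bipartite 2 2"
  assume "\<exists>u u' w w'. u \<noteq> u' \<and> w \<noteq> w' \<and> {u, w} \<in> edges G \<and> {u, w'} \<in> edges G \<and>
       {u', w} \<in> edges G \<and> {u', w'} \<in> edges G"
  then obtain u u' w w' where neq: "u \<noteq> u'" "w \<noteq> w'" and e: "{u, w} \<in> edges G" "{u, w'} \<in> edges G"
       "{u', w} \<in> edges G" "{u', w'} \<in> edges G" by blast
  note vs = simple_graph_neq[OF G e(1)] simple_graph_neq[OF G e(2)]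
    simple_graph_neq[OF G e(3)] simple_graph_neq[OF G e(4)]
  note Vs = simple_graph_verts[OF G e(1)] simple_graph_verts[OF G e(4)]
  define \<psi> where "\<psi> = case_sum (\<lambda>i::nat. if i = 0 then u else u') (\<lambda>j::nat. if j = 0 then w else w')"
  have two: "j = 0 \<or> j = 1" if "j < 2" for j :: nat using that by linarith
  have "inj_on \<psi> (verts ?K)"
    using neq vs by (auto simp: inj_on_def complete_bipartite_def \<psi>_def dest!: two)
  moreover have "\<psi> ` verts ?K \<subseteq> verts G"
    using Vs by (auto simp: complete_bipartite_def \<psi>_def)
  moreover have "{\<psi> i, \<psi> j} \<in> edges G" if ij: "{i, j} \<in> edges ?K" for i j
  proof -
    obtain i' j' where "{i, j} = {Inl i', Inr j'}" using ij by (auto simp: complete_bipartite_def)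
    then have "{\<psi> i, \<psi> j} = {\<psi> (Inl i'), \<psi> (Inr j')}" by (auto simp: doubleton_eq_iff)
    then show ?thesis using e by (auto simp: \<psi>_def)
  qed
  ultimately show "\<exists>\<psi>. inj_on \<psi> (verts ?K) \<and> \<psi> ` verts ?K \<subseteq> verts G \<and>
    (\<forall>i\<in>verts ?K. \<forall>j\<in>verts ?K. {i, j} \<in> edges ?K \<longrightarrow> {\<psi> i, \<psi> j} \<in> edges G)" by blast
qed

lemma contains_cycle:
  assumes G: "simple_graph G" and n: "n \<ge> 3"
  shows "contains_graph G (cycle_graph n) \<longleftrightarrow>
    (\<exists>v. inj_on v {..<n} \<and> (\<forall>i<n. {v i, v (Suc i mod n)} \<in> edges G))"
  unfolding contains_graph_iff[OF simple_cycle_graph[OF n]]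
proof (rule ex_cong1)
  fix v
  have V: "verts (cycle_graph n) = {..<n}" by (simp add: cycle_graph_def)
  have "v ` {..<n} \<subseteq> verts G" if "\<forall>i<n. {v i, v (Suc i mod n)} \<in> edges G"
    using that simple_graph_verts[OF G] by blast
  moreover have "(\<forall>i<n. \<forall>j<n. {i, j} \<in> edges (cycle_graph n) \<longrightarrow> {v i, v j} \<in> edges G) \<longleftrightarrow>
      (\<forall>i<n. {v i, v (Suc i mod n)} \<in> edges G)"
  proof (intro iffI allI impI)
    fix i assume i: "i < n" and *: "\<forall>i<n. \<forall>j<n. {i, j} \<in> edges (cycle_graph n) \<longrightarrow> {v i, v j} \<in> edges G"
    have "Suc i mod n < n" "{i, Suc i mod n} \<in> edges (cycle_graph n)"
      using i by (auto simp: cycle_graph_def)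
    then show "{v i, v (Suc i mod n)} \<in> edges G" using * i by blast
  next
    fix i j assume *: "\<forall>i<n. {v i, v (Suc i mod n)} \<in> edges G" "{i, j} \<in> edges (cycle_graph n)"
    then obtain l where l: "l < n" "{i, j} = {l, Suc l mod n}" by (auto simp: cycle_graph_def)
    then have "{v i, v j} = {v l, v (Suc l mod n)}" by (auto simp: doubleton_eq_iff)
    then show "{v i, v j} \<in> edges G" using * l by simp
  qed
  ultimately show "(inj_on v (verts (cycle_graph n)) \<and> v ` verts (cycle_graph n) \<subseteq> verts G \<and>
      (\<forall>i\<in>verts (cycle_graph n). \<forall>j\<in>verts (cycle_graph n). {i, j} \<in> edges (cycle_graph n) \<longrightarrow>
        {v i, v j} \<in> edges G)) \<longleftrightarrow>
      inj_on v {..<n} \<and> (\<forall>i<n. {v i, v (Suc i mod n)} \<in> edges G)"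
    unfolding V Ball_def lessThan_iff by blast
qed


section \<open>The characterisations\<close>

lemma lss_ideal_eq: "lss_ideal k d G = Idl\<^bsub>mpoly_ring k (verts G \<times> {1..d})\<^esub> (lss_gens d (edges G))"
  unfolding lss_ideal_def lss_ring_def lss_gens_def ..

lemma lss_gens_closed:
  fixes k :: "'k::field itself" and G :: "'v ugraph"
  assumes "simple_graph G"
  shows "lss_gens d (edges G) \<subseteq> carrier (mpoly_ring k (verts G \<times> {1..d}))"
proof
  fix p :: "('v \<times> nat, 'k) mpoly" assume "p \<in> lss_gens d (edges G)"
  then obtain i j where "p = lss_poly d i j" "i \<in> verts G" "j \<in> verts G"
    using simple_graph_verts[OF assms] unfolding lss_gens_def by blast
  then show "p \<in> carrier (mpoly_ring k (verts G \<times> {1..d}))"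
    using lss_poly_closed[of i G j d k] unfolding lss_ring_def by simp
qed

lemma paths_cycles_graph:
  assumes G: "simple_graph G" and "\<not> contains_graph G (complete_bipartite 1 3)"
  shows "paths_cycles (edges G)"
proof -
  have "edges G \<subseteq> Pow (verts G)" using G by (auto simp: simple_graph_def)
  then have "finite (edges G)" using G by (auto simp: simple_graph_def intro: finite_subset)
  then show ?thesis
    using assms(2) G unfolding contains_star[OF G] paths_cycles_def simple_graph_def by blast
qed

lemma lss_prime_imp:
  fixes k :: "'k::field itself" and G :: "'v ugraph"
  assumes G: "simple_graph G" and P: "primeideal (lss_ideal k 3 G) (lss_ring k 3 G)"
  shows "\<not> contains_graph G (complete_bipartite 1 3)" "\<not> contains_graph G (complete_bipartite 2 2)"
proof -
  let ?X = "verts G \<times> {1..3}"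
  let ?B = "lss_gens 3 (edges G) :: ('v \<times> nat, 'k) mpoly set"
  define y where "y i l = (pvar (i, l) :: ('v \<times> nat, 'k) mpoly)" for i l
  have P': "primeideal (Idl\<^bsub>mpoly_ring k ?X\<^esub> ?B) (mpoly_ring k ?X)"
    using P unfolding lss_ideal_eq lss_ring_def .
  have y: "y i l \<in> carrier (mpoly_ring k ?X)" if "i \<in> verts G" "l \<in> {1..3}" for i l
    unfolding y_def using that by simp
  note prime = not_primeideal_genideal[OF lss_gens_closed[OF G] P']
  note no_loop = simple_graph_neq[OF G]
  show "\<not> contains_graph G (complete_bipartite 1 3)"
  proof
    assume "contains_graph G (complete_bipartite 1 3)"
    then obtain v a b c where e: "{v, a} \<in> edges G" "{v, b} \<in> edges G" "{v, c} \<in> edges G"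
      and neq: "a \<noteq> b" "a \<noteq> c" "b \<noteq> c" unfolding contains_star[OF G] by blast
    have V: "v \<in> verts G" "a \<in> verts G" "b \<in> verts G" "c \<in> verts G"
      using simple_graph_verts[OF G] e by blast+
    have "y v 1 \<in> ideal_gen ?B \<or>
        y a 1 * (y b 2 * y c 3 - y b 3 * y c 2) - y b 1 * (y a 2 * y c 3 - y a 3 * y c 2) +
        y c 1 * (y a 2 * y b 3 - y a 3 * y b 2) \<in> ideal_gen ?B" (is "_ \<or> ?d \<in> _")
      by (rule prime[OF _ _ star_relation_3[where 'k = 'k, OF e, folded y_def]];
          intro mpoly_ring_closed y; simp add: V)
    moreover have "y v 1 \<notin> ideal_gen ?B"
      by (rule notin_lss_ideal[of _ "{(v, 1)}"]) (use no_loop in \<open>auto simp: y_def\<close>)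
    \<comment> \<open>The unit vectors at \<open>a\<close>, \<open>b\<close>, \<open>c\<close> are
      pairwise orthogonal, so edges among these vertices do no harm, and the determinant takes the
      value 1.\<close>
    moreover have "?d \<notin> ideal_gen ?B"
      by (rule notin_lss_ideal[of _ "{(a, 1), (b, 2), (c, 3)}"])
        (use no_loop neq in \<open>auto simp: y_def\<close>)
    ultimately show False by blast
  qed
  show "\<not> contains_graph G (complete_bipartite 2 2)"
  proof
    assume "contains_graph G (complete_bipartite 2 2)"
    then obtain u u' w w' where neq: "u \<noteq> u'" "w \<noteq> w'" and e: "{u, w} \<in> edges G" "{u, w'} \<in> edges G"
       "{u', w} \<in> edges G" "{u', w'} \<in> edges G" unfolding contains_square[OF G] by blast
    have V: "u \<in> verts G" "u' \<in> verts G" "w \<in> verts G" "w' \<in> verts G"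
      using simple_graph_verts[OF G] e by blast+
    have "y u 1 * y u' 2 - y u' 1 * y u 2 \<in> ideal_gen ?B \<or> y w 2 * y w' 3 - y w' 2 * y w 3 \<in> ideal_gen ?B"
      by (rule prime[OF _ _ square_relation_3[where 'k = 'k, OF e, folded y_def]];
          intro mpoly_ring_closed y; simp add: V)
    moreover have "y i l * y j l' - y j l * y i l' \<notin> ideal_gen ?B" if "i \<noteq> j" "l \<noteq> l'" for i j l l'
      by (rule notin_lss_ideal[of _ "{(i, l), (j, l')}"]) (use no_loop that in \<open>auto simp: y_def\<close>)
    ultimately show False using neq by (metis One_nat_def numeral_2_eq_2 n_not_Suc_n numeral_3_eq_3)
  qed
qed

lemma lss_complete_intersection_imp:
  fixes k :: "'k::field itself" and G :: "'v ugraph"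
  assumes G: "simple_graph G" and C: "complete_intersection (lss_ideal k 2 G) (lss_ring k 2 G)"
  shows "\<not> contains_graph G (complete_bipartite 1 3)"
    "\<And>m. m \<ge> 2 \<Longrightarrow> \<not> contains_graph G (cycle_graph (2 * m))"
proof -
  let ?R = "mpoly_ring k (verts G \<times> {1..2})"
  let ?B = "lss_gens 2 (edges G) :: ('v \<times> nat, 'k) mpoly set"
  define y where "y i l = (pvar (i, l) :: ('v \<times> nat, 'k) mpoly)" for i l
  have B: "?B \<subseteq> carrier ?R" by (rule lss_gens_closed[OF G])
  obtain fs where reg: "regular_sequence ?R fs" and fs: "Idl\<^bsub>?R\<^esub> ?B = Idl\<^bsub>?R\<^esub> set fs"
    using C unfolding complete_intersection_def lss_ideal_eq lss_ring_def by blast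
  have fsR: "set fs \<subseteq> carrier ?R" using reg by (simp add: regular_sequence_def)
  have eq: "ideal_gen ?B \<inter> carrier ?R = ideal_gen (set fs) \<inter> carrier ?R"
    using fs unfolding genideal_eq[OF B] genideal_eq[OF fsR] .
  \<comment> \<open>Both generating sets lie in \<open>k[X]\<close>, so the equality of ideals
    extends to the large ring.\<close>
  have gen: "ideal_gen (set fs) = ideal_gen ?B"
    unfolding ring_ideal.span_eq
    using eq B fsR ring_ideal.span_superset[of ?B] ring_ideal.span_superset[of "set fs"] by blast
  have "edges G \<subseteq> Pow (verts G)" using G by (auto simp: simple_graph_def)
  then have fin: "finite (edges G)" using G by (auto simp: simple_graph_def intro: finite_subset)
  have card: "\<forall>e\<in>edges G. card e = 2" using G by (auto simp: simple_graph_def)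
  have y: "y i l \<in> carrier ?R" if "i \<in> verts G" "l \<in> {1..2}" for i l unfolding y_def using that by simp
  note koszul = lss_koszul[OF reg gen fin card B]
  note no_loop = simple_graph_neq[OF G]
  have tdeg_y: "tdeg (y i l) = monom (y i l) 1" for i l by (simp add: y_def)
  show "\<not> contains_graph G (complete_bipartite 1 3)"
  proof
    assume "contains_graph G (complete_bipartite 1 3)"
    then obtain v a b c where e: "{v, a} \<in> edges G" "{v, b} \<in> edges G" "{v, c} \<in> edges G"
      and neq: "a \<noteq> b" "a \<noteq> c" "b \<noteq> c" unfolding contains_star[OF G] by blast
    have V: "v \<in> verts G" "a \<in> verts G" "b \<in> verts G" "c \<in> verts G"
      using simple_graph_verts[OF G] e by blast+
    let ?d = "y b 1 * y c 2 - y c 1 * y b 2"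
    have "?d \<in> ideal_gen ?B"
    proof (rule koszul[OF e(1)])
      show "?d \<in> carrier ?R" using V y by simp
      show "tdeg ?d = monom ?d 2" by (simp add: tdeg_y mult_monom diff_monom numeral_2_eq_2)
      have "{v, b} \<in> edges G - {{v, a}}" "{v, c} \<in> edges G - {{v, a}}"
        using e neq by (auto simp: doubleton_eq_iff)
      from star_relation_2[OF this] show "?d * lss_poly 2 v a \<in> ideal_gen (lss_gens 2 (edges G - {{v, a}}))"
        by (simp add: y_def)
    qed
    moreover have "?d \<notin> ideal_gen ?B"
      by (rule notin_lss_ideal[of _ "{(b, 1), (c, 2)}"]) (use no_loop neq in \<open>auto simp: y_def\<close>)
    ultimately show False by blast
  qed
  fix m :: nat assume m: "m \<ge> 2"
  show "\<not> contains_graph G (cycle_graph (2 * m))"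
  proof
    assume "contains_graph G (cycle_graph (2 * m))"
    moreover have "2 * m \<ge> 3" using m by simp
    ultimately obtain v where inj: "inj_on v {..<2 * m}"
      and cyc: "\<And>i. i < 2 * m \<Longrightarrow> {v i, v (Suc i mod (2 * m))} \<in> edges G"
      using contains_cycle[OF G] by blast
    have V: "v i \<in> verts G" if "i < 2 * m" for i using simple_graph_verts[OF G cyc[OF that]] by blast
    \<comment> \<open>The cofactor of the edge \<open>{v 0, v 1}\<close> in the even cycle relation:
      up to sign, the product of the second coordinates of the other cycle vertices.\<close>
    define c where "c = (\<Prod>j\<in>{1..<m}. - (y (v (2 * j)) 2 * y (v (Suc (2 * j))) 2))"
    have "c \<in> ideal_gen ?B"
    proof (rule koszul)
      have "Suc 0 mod (2 * m) = 1" using m by simp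
      then show "{v 0, v 1} \<in> edges G" using cyc[of 0] m by simp
      show "c \<in> carrier ?R"
        unfolding c_def using V y by (intro mpoly_ring_prod) auto
      have "tdeg (\<Prod>j\<in>A. - (y (v (2 * j)) 2 * y (v (Suc (2 * j))) 2)) =
          monom (\<Prod>j\<in>A. - (y (v (2 * j)) 2 * y (v (Suc (2 * j))) 2)) (\<Sum>j\<in>A. 2)" for A
        by (induction A rule: infinite_finite_induct)
           (simp_all add: tdeg_y mult_monom numeral_2_eq_2 monom_0 one_pCons flip: minus_monom)
      then show "tdeg c = monom c (\<Sum>j\<in>{1..<m}. 2)" unfolding c_def .
      show "c * lss_poly 2 (v 0) (v 1) \<in> ideal_gen (lss_gens 2 (edges G - {{v 0, v 1}}))"
        unfolding c_def y_def by (rule even_cycle_relation_2[OF m inj cyc])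
    qed
    \<comment> \<open>evaluation at the isotropic vector \<open>(T, 1)\<close> modulo \<open>T\<^sup>2 + 1\<close>\<close>
    define h :: "('v \<times> nat, 'k) mpoly \<Rightarrow> 'k poly" where
      "h = meval (\<lambda>c. [:c:]) (\<lambda>(i, l). if l = 1 then [:0, 1:] else 1)"
    have h: "is_ring_hom h" unfolding h_def by (rule meval_hom[OF hom_const])
    have h_pvar: "h (pvar (i, l)) = (if l = 1 then [:0, 1:] else 1)" for i l
      unfolding h_def by (simp add: meval_pvar[OF hom_const])
    have "h c \<in> ideal_gen {[:1, 0, 1:]}"
    proof (rule hom_ideal_gen[OF h _ \<open>c \<in> ideal_gen ?B\<close>])
      fix b assume "b \<in> ?B"
      then obtain i j where b: "b = lss_poly 2 i j" unfolding lss_gens_def by blast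
      have "h b = [:1, 0, 1:]"
        unfolding b lss_poly_2[OF colours_2] hom_simps[OF h] h_pvar by (simp add: one_pCons)
      then show "h b \<in> ideal_gen {[:1, 0, 1:]}" by (simp add: ring_ideal.span_base)
    qed
    then obtain q where q: "h c = q * [:1, 0, 1:]" unfolding ring_ideal.span_singleton by blast
    \<comment> \<open>All second coordinates become 1, so only a sign is left, and a nonzero
      constant is no multiple of a quadratic polynomial.\<close>
    have hc: "h c = (- 1) ^ (m - 1)"
      unfolding c_def y_def hom_prod[OF h] hom_simps[OF h] h_pvar by simp
    have "degree (h c) = 0" unfolding hc by (cases "even (m - 1)") simp_all
    moreover have "q \<noteq> 0" using q hc by auto
    then have "degree (q * [:1, 0, 1:]) = degree q + 2" by (subst degree_mult_eq) auto
    ultimately show False using q by simp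
  qed
qed

theorem theorem1p4:
  fixes k :: "'k::field itself" and G :: "'v ugraph"
  assumes "simple_graph G"
  shows "(primeideal (lss_ideal k 3 G) (lss_ring k 3 G) \<longleftrightarrow>
            \<not> contains_graph G (complete_bipartite 1 3) \<and>
            \<not> contains_graph G (complete_bipartite 2 2))
       \<and> (complete_intersection (lss_ideal k 2 G) (lss_ring k 2 G) \<longleftrightarrow>
            \<not> contains_graph G (complete_bipartite 1 3) \<and>
            (\<forall>m\<ge>2. \<not> contains_graph G (cycle_graph (2 * m))))"
proof -
  note G = assms
  have "primeideal (lss_ideal k 3 G) (lss_ring k 3 G)"
    if "\<not> contains_graph G (complete_bipartite 1 3)" "\<not> contains_graph G (complete_bipartite 2 2)"
  proof -
    have "square_free (edges G)"
      using that(2) unfolding contains_square[OF G] square_free_def by blast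
    from lss_prime_3[OF paths_cycles_graph[OF G that(1)] this] show ?thesis
      unfolding lss_ideal_eq lss_ring_def by (rule primeideal_genideal[OF lss_gens_closed[OF G]])
  qed
  moreover have "complete_intersection (lss_ideal k 2 G) (lss_ring k 2 G)"
    if "\<not> contains_graph G (complete_bipartite 1 3)" "\<forall>m\<ge>2. \<not> contains_graph G (cycle_graph (2 * m))"
  proof -
    let ?R = "mpoly_ring k (verts G \<times> {1..2})"
    have P: "paths_cycles (edges G)" by (rule paths_cycles_graph[OF G that(1)])
    have "no_even_cycle (edges G)"
      unfolding no_even_cycle_def
    proof (intro allI impI)
      fix m :: nat assume "m \<ge> 2"
      then have "\<not> contains_graph G (cycle_graph (2 * m))" "2 * m \<ge> 3" using that(2) by auto
      then show "\<nexists>v. inj_on v {..<2 * m} \<and> (\<forall>i<2 * m. {v i, v (Suc i mod (2 * m))} \<in> edges G)"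
        using contains_cycle[OF G] by blast
    qed
    from lss_regular_order_2[OF P this] obtain fs
      where fs: "set fs = (lss_gens 2 (edges G) :: ('v \<times> nat, 'k) mpoly set)"
        and nzd: "\<And>n. n < length fs \<Longrightarrow> nzd_mod (set (take n fs)) (fs ! n)" by blast
    have fsR: "set fs \<subseteq> carrier ?R" unfolding fs by (rule lss_gens_closed[OF G])
    \<comment> \<open>All generators vanish at the origin.\<close>
    have "1 \<notin> ideal_gen (set fs)" unfolding fs by (rule notin_lss_ideal[of _ "{}"]) auto
    then have "Idl\<^bsub>?R\<^esub> set fs \<noteq> carrier ?R"
      unfolding genideal_eq[OF fsR] using mpoly_ring_closed(4) by blast
    moreover have "g \<in> Idl\<^bsub>?R\<^esub> set (take n fs)"
      if "n < length fs" "g \<in> carrier ?R" "fs ! n \<otimes>\<^bsub>?R\<^esub> g \<in> Idl\<^bsub>?R\<^esub> set (take n fs)" for n g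
    proof -
      have take: "set (take n fs) \<subseteq> carrier ?R" using fsR set_take_subset by fast
      show ?thesis
        using that nzd[OF that(1)] unfolding genideal_eq[OF take] nzd_mod_def by (simp add: mpoly_ring_def)
    qed
    ultimately have "regular_sequence ?R fs" using fsR by (simp add: regular_sequence_def)
    then show ?thesis
      unfolding complete_intersection_def lss_ideal_eq lss_ring_def fs[symmetric] by blast
  qed
  ultimately show ?thesis
    using lss_prime_imp[OF G] lss_complete_intersection_imp[OF G] by blast
qed

end
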